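(* Let $N\ge 2$ and let $\Omega\subset\mathbb{R}^N$ be a convex domain with $C^2$ boundary whose boundary satisfies a uniform interior sphere condition, i.e. there exists $\bar r>0$ such that for every $x\in\partial\Omega$ there is a ball $B_{\bar r}\subset\Omega$ of radius $\bar r$ with $\overline{B_{\bar r}}\cap\overline{\Omega}=\{x\}$. Then $$\mu_1(\Omega)\ge 1,$$ and equality holds if $\Omega$ is any $N$-dimensional strip, i.e. a set of the form $S_a=\{x\in\mathbb{R}^N: -a<x_1<a\}$ (up to rigid motion) with $a\in(0,+\infty)$.
   Context: Let $d\gamma_N=(2\pi)^{-N/2}e^{-|x|^2/2}\,dx$ be the standard Gaussian measure on $\mathbb{R}^N$. The weighted Sobolev space is $H^1(\Omega,d\gamma_N)=\{u\in W^{1,1}_{\rm loc}(\Omega): u\in L^2(\Omega,d\gamma_N),\ |Du|\in L^2(\Omega,d\gamma_N)\}$ with norm $\|u\|_{L^2(\Omega,d\gamma_N)}+\|Du\|_{L^2(\Omega,d\gamma_N)}$. $\mu_1(\Omega)$ denotes the first nontrivial eigenvalue of the Neumann problem $-\mathrm{div}(e^{-|x|^2/2}Du)=\mu e^{-|x|^2/2}u$ in $\Omega$, $\partial u/\partial\nu=0$ on $\partial\Omega$, characterized variationally as $$\mu_1(\Omega)=\min\left\{\frac{\int_\Omega|D\psi|^2d\gamma_N}{\int_\Omega\psi^2d\gamma_N}:\ \psi\in H^1(\Omega,d\gamma_N)\setminus\{0\},\ \int_\Omega\psi\,d\gamma_N=0\right\}.$$ The domain $\Omega$ may be unbounded.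
   Formalization: The interior sphere condition is impossible as printed (a ball inside Ω has its whole closure in the closure of Ω); it is stated with the closed ball meeting the boundary ∂Ω, instead of the closure of Ω, exactly at x. *)

theory Defs
  imports "HOL-Analysis.Analysis"
begin

definition gauss :: "real^'n \<Rightarrow> real" where
  "gauss x = (2 * pi) powr (- real CARD('n) / 2) * exp (- (norm x)\<^sup>2 / 2)"

fun Ck :: "nat \<Rightarrow> (real^'n \<Rightarrow> real) \<Rightarrow> bool" where
  "Ck 0 f = continuous_on UNIV f"
| "Ck (Suc k) f = (\<exists>g. (\<forall>x. (f has_derivative (\<lambda>h. g x \<bullet> h)) (at x)) \<and> (\<forall>j. Ck k (\<lambda>x. g x $ j)))"

definition smooth :: "(real^'n \<Rightarrow> real) \<Rightarrow> bool" where
  "smooth f \<longleftrightarrow> (\<forall>k. Ck k f)"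

definition test_fun :: "(real^'n) set \<Rightarrow> (real^'n \<Rightarrow> real) \<Rightarrow> bool" where
  "test_fun \<Omega> \<phi> \<longleftrightarrow> smooth \<phi> \<and> compact (closure {x. \<phi> x \<noteq> 0}) \<and> closure {x. \<phi> x \<noteq> 0} \<subseteq> \<Omega>"

definition loc_integrable :: "(real^'n) set \<Rightarrow> (real^'n \<Rightarrow> real) \<Rightarrow> bool" where
  "loc_integrable \<Omega> f \<longleftrightarrow> (\<forall>K. compact K \<and> K \<subseteq> \<Omega> \<longrightarrow> set_integrable lebesgue K f)"

definition weak_gradient :: "(real^'n) set \<Rightarrow> (real^'n \<Rightarrow> real) \<Rightarrow> (real^'n \<Rightarrow> real^'n) \<Rightarrow> bool" where
  "weak_gradient \<Omega> u g \<longleftrightarrow> loc_integrable \<Omega> u \<and> (\<forall>j. loc_integrable \<Omega> (\<lambda>x. g x $ j)) \<and>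
     (\<forall>\<phi> d\<phi>. test_fun \<Omega> \<phi> \<and> (\<forall>x. (\<phi> has_derivative (\<lambda>h. d\<phi> x \<bullet> h)) (at x)) \<longrightarrow>
        (\<forall>j. (LINT x:\<Omega>|lebesgue. u x * d\<phi> x $ j) = - (LINT x:\<Omega>|lebesgue. g x $ j * \<phi> x)))"

definition H1_gauss :: "(real^'n) set \<Rightarrow> (real^'n \<Rightarrow> real) \<Rightarrow> (real^'n \<Rightarrow> real^'n) \<Rightarrow> bool" where
  "H1_gauss \<Omega> u g \<longleftrightarrow> weak_gradient \<Omega> u g \<and>
     set_integrable lebesgue \<Omega> (\<lambda>x. gauss x * (u x)\<^sup>2) \<and>
     set_integrable lebesgue \<Omega> (\<lambda>x. gauss x * (norm (g x))\<^sup>2)"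

text \<open>First nontrivial Neumann eigenvalue, via the variational characterization
  (infimum of the Rayleigh quotient over mean-zero nonzero H^1 functions).\<close>
definition mu1 :: "(real^'n) set \<Rightarrow> real" where
  "mu1 \<Omega> = Inf {R. \<exists>u g. H1_gauss \<Omega> u g \<and>
       (LINT x:\<Omega>|lebesgue. gauss x * u x) = 0 \<and>
       (LINT x:\<Omega>|lebesgue. gauss x * (u x)\<^sup>2) > 0 \<and>
       R = (LINT x:\<Omega>|lebesgue. gauss x * (norm (g x))\<^sup>2) / (LINT x:\<Omega>|lebesgue. gauss x * (u x)\<^sup>2)}"

definition C2_on :: "(real^'n) set \<Rightarrow> (real^'n \<Rightarrow> real) \<Rightarrow> bool" where
  "C2_on U \<rho> \<longleftrightarrow> (\<exists>D\<rho> D2\<rho>.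
     (\<forall>y\<in>U. (\<rho> has_derivative (\<lambda>h. D\<rho> y \<bullet> h)) (at y)) \<and>
     (\<forall>y\<in>U. \<forall>j. ((\<lambda>z. D\<rho> z $ j) has_derivative (\<lambda>h. D2\<rho> y j \<bullet> h)) (at y)) \<and>
     (\<forall>j k. continuous_on U (\<lambda>y. D2\<rho> y j $ k)))"

definition C2_boundary :: "(real^'n) set \<Rightarrow> bool" where
  "C2_boundary \<Omega> \<longleftrightarrow> (\<forall>x\<in>frontier \<Omega>. \<exists>U \<rho>. open U \<and> x \<in> U \<and> C2_on U \<rho> \<and>
      (\<forall>y\<in>U. \<forall>D. (\<rho> has_derivative (\<lambda>h. D \<bullet> h)) (at y) \<longrightarrow> D \<noteq> 0) \<and>
      \<Omega> \<inter> U = {y\<in>U. \<rho> y < 0})"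

definition uniform_interior_sphere :: "(real^'n) set \<Rightarrow> bool" where
  "uniform_interior_sphere \<Omega> \<longleftrightarrow> (\<exists>r>0. \<forall>x\<in>frontier \<Omega>. \<exists>c.
      ball c r \<subseteq> \<Omega> \<and> cball c r \<inter> frontier \<Omega> = {x})"

end

theory Submission
  imports Defs
begin

text \<open>The bound \<open>mu1 \<Omega> \<ge> 1\<close> is the Poincare inequality with constant 1 for the Gaussian measure
restricted to a convex open set. Following Maurey, it comes from the Prekopa-Leindler inequality: on a compact convex set \<open>K\<close> apply
it to \<open>exp (\<epsilon> h - \<epsilon>\<^sup>2 \<theta> |D h|\<^sup>2) gauss\<close>, \<open>exp (- \<epsilon> h) gauss\<close> and \<open>gauss\<close>; the parallelogram
identity for the Gaussian weight compensates the variation of \<open>h\<close>, and the terms of order \<open>\<epsilon>\<^sup>2\<close> say that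
the variance of \<open>h\<close> is at most the mean of \<open>|D h|\<^sup>2\<close>. A Sobolev function on \<open>\<Omega>\<close> is reached by
mollification on compact convex subsets exhausting \<open>\<Omega>\<close>. On a set invariant under
translations along a unit vector \<open>v\<close>, the coordinate \<open>x \<bullet> v\<close> is standard Gaussian,
so \<open>x \<mapsto> x \<bullet> v\<close> has Rayleigh quotient 1.\<close>

section \<open>The Prekopa-Leindler inequality\<close>

text \<open>The constant 1 is exactly what the midpoint form of Prekopa-Leindler gives. For the
  midpoint z of x and y, gauss x * gauss y equals (gauss z)^2 * exp (- |x - y|^2 / 4), and the
  maximum of \<epsilon> p d - d^2 / 4 over d is \<epsilon>^2 p^2; so a penalty \<epsilon>^2 |D h|^2
  pays for the first-order variation of h. The Taylor remainder of h costs a further multiple of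
  \<epsilon> |x - y|^2, which the factor \<theta>, slightly above 1 and tending to 1 with
  \<epsilon>, absorbs. A one-sided quadratic Taylor bound is thus all the smoothness required, and
  convolution with a fixed smooth kernel supplies it. Variances stay unnormalised, m * (integral of
  h^2) - (integral of h)^2 for a measure of mass m, a form that passes to limits and makes sense for
  m = 0. Mean zero on \<Omega> is not inherited by compact subsets, so the inequality carried along
  the exhaustion keeps the mean term. Compactness of K makes h bounded and the exponential integrals
  finite, and leaves a positive distance to the complement of \<Omega> as room for
  mollification.\<close>

lemma ennreal_AM_GM2: "4 * (a * b) \<le> (a + b)\<^sup>2" for a b :: ennreal
proof (cases "a = \<infinity> \<or> b = \<infinity>")
  case True
  then show ?thesis by (auto simp: power2_eq_square ennreal_top_mult ennreal_mult_top)
next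
  case False
  then obtain x y where xy: "a = ennreal x" "b = ennreal y" "x \<ge> 0" "y \<ge> 0"
    by (metis ennreal_cases infinity_ennreal_def)
  have "4 * (x * y) \<le> (x + y)\<^sup>2"
    using zero_le_power2[of "x - y"] by (simp add: power2_eq_square algebra_simps)
  then have "ennreal (4 * (x * y)) \<le> ennreal ((x + y)\<^sup>2)" by (rule ennreal_leI)
  then show ?thesis using xy
    by (simp add: ennreal_mult ennreal_power[symmetric] flip: ennreal_plus)
qed

section \<open>Brunn-Minkowski inequality on the line\<close>

lemma emeasure_lborel_half_vimage:
  fixes C :: "real set"
  assumes [measurable]: "C \<in> sets borel"
  shows "emeasure lborel {z. z / 2 \<in> C} = 2 * emeasure lborel C"
proof -
  have [measurable]: "{z::real. z / 2 \<in> C} \<in> sets borel"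
    by measurable
  have "(\<integral>\<^sup>+z. indicator {z. z / 2 \<in> C} z \<partial>lborel) 
     = ennreal \<bar>2\<bar> * (\<integral>\<^sup>+x. indicator {z. z / 2 \<in> C} (0 + 2 * x) \<partial>lborel)"
    by (rule nn_integral_real_affine) auto
  also have "(\<integral>\<^sup>+x. indicator {z. z / 2 \<in> C} (0 + 2 * x) \<partial>lborel) = (\<integral>\<^sup>+x. indicator C x \<partial>lborel)"
    by (intro nn_integral_cong) (auto simp: indicator_def)
  finally show ?thesis by simp
qed

lemma emeasure_lborel_translation_real:
  fixes A :: "real set"
  assumes "A \<in> sets borel"
  shows "emeasure lborel ((+) c ` A) = emeasure lborel A"
proof -
  have m: "(+) c ` A \<in> sets borel"
  proof -
    have "(+) c ` A = {x. x - c \<in> A}" by (auto simp: image_iff intro!: bexI[of _ "_ - c"])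
    then show ?thesis using assms by simp
  qed
  have "emeasure (distr lborel borel ((+) c)) ((+) c ` A) = emeasure lborel A"
    using m by (subst emeasure_distr) (auto simp: inj_vimage_image_eq)
  then show ?thesis by (simp add: lborel_distr_plus)
qed

text \<open>With a the maximum of A and b the minimum of B, the translates b + A and a + B both lie
  in A + B and meet only in the point a + b, which has measure zero. A Borel set \<open>C\<close>
  containing all midpoints takes the place of (A + B) / 2, so that the measurability of a sumset
  never comes up.\<close>

lemma brunn_minkowski_compact_real:
  fixes A B C :: "real set"
  assumes "compact A" "compact B" "A \<noteq> {}" "B \<noteq> {}" and C: "C \<in> sets borel"
    and mid: "\<And>x y. x \<in> A \<Longrightarrow> y \<in> B \<Longrightarrow> (x + y) / 2 \<in> C"
  shows "emeasure lborel A + emeasure lborel B \<le> 2 * emeasure lborel C"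
proof -
  obtain a where a: "a \<in> A" "\<And>x. x \<in> A \<Longrightarrow> x \<le> a"
    using compact_attains_sup[of A] assms by blast
  obtain b where b: "b \<in> B" "\<And>x. x \<in> B \<Longrightarrow> b \<le> x"
    using compact_attains_inf[of B] assms by blast
  have "emeasure lborel A + emeasure lborel B = emeasure lborel ((+) b ` A) + emeasure lborel ((+) a ` B)"
    using assms by (simp add: emeasure_lborel_translation_real borel_compact)
  also have "\<dots> = emeasure lborel ((+) b ` A) + emeasure lborel ((+) a ` B - {a + b})"
  proof -
    have "emeasure lborel ((+) a ` B - {a + b}) = emeasure lborel ((+) a ` B)"
      by (rule emeasure_Diff_null_set)
        (auto intro!: borel_compact compact_translation assms finite_imp_null_set_lborel)
    then show ?thesis by simp
  qed
  also have "\<dots> = emeasure lborel ((+) b ` A \<union> ((+) a ` B - {a + b}))"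
  proof (rule plus_emeasure)
    show "(+) b ` A \<inter> ((+) a ` B - {a + b}) = {}"
    proof -
      have "b + x = a + b" if "x \<in> A" "y \<in> B" "b + x = a + y" for x y
        using a(2)[of x] b(2)[of y] that by linarith
      then show ?thesis by auto
    qed
  next
    have 1: "(+) b ` A \<in> sets borel" "(+) a ` B \<in> sets borel"
      by (intro borel_compact compact_translation assms)+
    show "(+) b ` A \<in> sets lborel" "(+) a ` B - {a + b} \<in> sets lborel"
      using 1 by auto
  qed
  also have "\<dots> \<le> emeasure lborel {z. z / 2 \<in> C}"
  proof (rule emeasure_mono)
    show "{z. z / 2 \<in> C} \<in> sets lborel" using C by simp
    show "(+) b ` A \<union> ((+) a ` B - {a + b}) \<subseteq> {z. z / 2 \<in> C}"
      using mid[OF a(1)] mid[OF _ b(1)] by (auto simp: add.commute[of b])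
  qed
  also have "\<dots> = 2 * emeasure lborel C" by (rule emeasure_lborel_half_vimage[OF C])
  finally show ?thesis .
qed

lemma compact_inner_approx_lborel:
  fixes A :: "real set"
  assumes A: "A \<in> sets borel" and "c < emeasure lborel A"
  shows "\<exists>K. compact K \<and> K \<subseteq> A \<and> c < emeasure lborel K"
proof -
  \<comment> \<open>The slack \<open>e\<close> is taken below a finite value strictly between
    \<open>c\<close> and the measure of \<open>A\<close>, so that a set of infinite measure is
    covered as well.\<close>
  obtain e where e: "0 < e" "c + ennreal e < emeasure lborel A"
  proof -
    obtain d where d: "c < d" "d < emeasure lborel A" using dense assms(2) by blast
    obtain r where r: "c = ennreal r" "r \<ge> 0" using d by (cases c) auto
    obtain s where s: "d = ennreal s" "s \<ge> 0" using d by (cases d) auto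
    have "c + ennreal (s - r) = d" using r s d by (simp add: ennreal_less_iff flip: ennreal_plus)
    then show ?thesis using that[of "s - r"] d r s by (auto simp: ennreal_less_iff)
  qed
  have "A \<in> sets lebesgue" using A by simp
  then obtain T where T: "closed T" "T \<subseteq> A" "A - T \<in> lmeasurable" "emeasure lebesgue (A - T) < ennreal e"
    using sets_lebesgue_inner_closed[OF _ e(1)] by blast
  have Tb: "T \<in> sets borel" using T by simp
  have eq: "emeasure lborel (A - T) < ennreal e"
    using T(4) A Tb by (simp add: emeasure_completion)
  have "c < emeasure lborel T"
  proof (rule ccontr)
    assume nc: "\<not> c < emeasure lborel T"
    have "emeasure lborel A = emeasure lborel T + emeasure lborel (A - T)"
      using A Tb T(2) by (subst plus_emeasure) (auto simp: Un_absorb1)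
    also have "\<dots> \<le> c + ennreal e" using eq nc by (intro add_mono) auto
    finally show False using e by simp
  qed
  moreover have "(SUP n. emeasure lborel (T \<inter> {- real n..real n})) = emeasure lborel (\<Union>n. T \<inter> {- real n..real n})"
    using Tb by (intro SUP_emeasure_incseq) (auto simp: incseq_def)
  moreover have "(\<Union>n. T \<inter> {- real n..real n}) = T"
  proof -
    have "\<exists>n. x \<in> {- real n..real n}" for x
    proof -
      obtain n where "\<bar>x\<bar> \<le> real n" using real_arch_simple by blast
      then show ?thesis by (intro exI[of _ n]) auto
    qed
    then show ?thesis by blast
  qed
  ultimately have "c < (SUP n. emeasure lborel (T \<inter> {- real n..real n}))" by simp
  then obtain n where "c < emeasure lborel (T \<inter> {- real n..real n})"
    unfolding less_SUP_iff by blast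
  moreover have "compact (T \<inter> {- real n..real n})"
    using T(1) by (simp add: closed_Int_compact)
  ultimately show ?thesis using T(2) by (intro exI[of _ "T \<inter> {- real n..real n}"]) auto
qed

lemma brunn_minkowski_real:
  fixes A B C :: "real set"
  assumes A: "A \<in> sets borel" and B: "B \<in> sets borel" and "A \<noteq> {}" "B \<noteq> {}" and C: "C \<in> sets borel"
    and mid: "\<And>x y. x \<in> A \<Longrightarrow> y \<in> B \<Longrightarrow> (x + y) / 2 \<in> C"
  shows "emeasure lborel A + emeasure lborel B \<le> 2 * emeasure lborel C"
proof -
  define \<K> where "\<K> S = {K. compact K \<and> K \<subseteq> S \<and> K \<noteq> {}}" for S :: "real set"
  have ne: "\<K> S \<noteq> {}" if S: "S \<noteq> {}" for S
  proof -
    obtain s where "s \<in> S" using S by blast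
    then have "{s} \<in> \<K> S" by (simp add: \<K>_def)
    then show ?thesis by blast
  qed
  have approx: "emeasure lborel S \<le> (SUP K\<in>\<K> S. emeasure lborel K)" if S: "S \<in> sets borel" for S
  proof (rule dense_le)
    fix c assume c: "c < emeasure lborel S"
    obtain K where K: "compact K" "K \<subseteq> S" "c < emeasure lborel K"
      using compact_inner_approx_lborel[OF S c] by blast
    have "K \<in> \<K> S" using K by (auto simp: \<K>_def)
    then show "c \<le> (SUP K\<in>\<K> S. emeasure lborel K)" using K(3)
      by (meson SUP_upper2 order_less_imp_le)
  qed
  have "emeasure lborel A + emeasure lborel B 
      \<le> (SUP K\<in>\<K> A. emeasure lborel K) + (SUP L\<in>\<K> B. emeasure lborel L)"
    by (intro add_mono approx A B)
  also have "\<dots> = (SUP K\<in>\<K> A. SUP L\<in>\<K> B. emeasure lborel K + emeasure lborel L)"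
    by (simp add: ennreal_SUP_add_left[OF ne[OF assms(3)], symmetric] ennreal_SUP_add_right[OF ne[OF assms(4)], symmetric])
  also have "\<dots> \<le> 2 * emeasure lborel C"
    by (intro SUP_least brunn_minkowski_compact_real C) (auto simp: \<K>_def intro: mid)
  finally show ?thesis .
qed

section \<open>Prekopa-Leindler inequality on the line, by superlevel sets\<close>

text \<open>Tonelli, since \<open>min y 1\<close> is the length of the set of t in [0, 1) with t <
  y. The truncation at height 1 is for the function \<open>H\<close> of the next lemma, which may
  exceed 1 while only its levels below 1 are compared.\<close>

lemma nn_integral_eq_layers:
  fixes F :: "real \<Rightarrow> ennreal"
  assumes [measurable]: "F \<in> borel_measurable borel"
  shows "(\<integral>\<^sup>+x. min (F x) 1 \<partial>lborel) 
    = (\<integral>\<^sup>+t. emeasure lborel {x. ennreal t < F x} * indicator {0..<1} t \<partial>lborel)"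
proof -
  have len: "(\<integral>\<^sup>+t. indicator {0..<1} t * indicator {t. ennreal t < y} t \<partial>lborel) = min y 1" for y :: ennreal
  proof (cases "y \<ge> 1")
    case True
    have "(\<integral>\<^sup>+t. indicator {0..<1} t * indicator {t. ennreal t < y} t \<partial>lborel)
        = (\<integral>\<^sup>+t. indicator {0..<1::real} t \<partial>lborel)"
    proof (intro nn_integral_cong)
      fix t :: real
      have "ennreal t < y" if "t \<in> {0..<1}"
      proof -
        have "ennreal t < 1" using that ennreal_less_iff[of t 1] by simp
        then show ?thesis using True by (rule less_le_trans)
      qed
      then show "indicator {0..<1} t * indicator {t. ennreal t < y} t = (indicator {0..<1} t :: ennreal)"
        by (auto simp: indicator_def)
    qed
    then show ?thesis using True by (simp add: min_def)
  next
    case False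
    then obtain r where r: "y = ennreal r" "0 \<le> r" "r < 1"
      by (cases y) (auto simp: not_le ennreal_less_iff simp flip: ennreal_1)
    have "(\<integral>\<^sup>+t. indicator {0..<1} t * indicator {t. ennreal t < y} t \<partial>lborel)
        = (\<integral>\<^sup>+t. indicator {0..<r} t \<partial>lborel)"
      by (intro nn_integral_cong) (use r in \<open>auto simp: indicator_def ennreal_less_iff\<close>)
    then show ?thesis using r by (simp add: min_def ennreal_le_1)
  qed
  have "(\<integral>\<^sup>+x. min (F x) 1 \<partial>lborel) = (\<integral>\<^sup>+x. \<integral>\<^sup>+t. indicator {0..<1} t * indicator {t. ennreal t < F x} t \<partial>lborel \<partial>lborel)"
    by (simp add: len)
  also have "\<dots> = (\<integral>\<^sup>+t. \<integral>\<^sup>+x. indicator {0..<1} t * indicator {t. ennreal t < F x} t \<partial>lborel \<partial>lborel)"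
    by (rule lborel_pair.Fubini'[symmetric]) simp
  also have "\<dots> = (\<integral>\<^sup>+t. emeasure lborel {x. ennreal t < F x} * indicator {0..<1} t \<partial>lborel)"
  proof (intro nn_integral_cong)
    fix t :: real
    have "(\<integral>\<^sup>+x. indicator {0..<1} t * indicator {t. ennreal t < F x} t \<partial>lborel)
      = (\<integral>\<^sup>+x. indicator {0..<1} t * indicator {x. ennreal t < F x} x \<partial>lborel)"
      by (intro nn_integral_cong) (auto simp: indicator_def)
    also have "\<dots> = indicator {0..<1} t * emeasure lborel {x. ennreal t < F x}"
      by (simp add: nn_integral_cmult)
    finally show "(\<integral>\<^sup>+x. indicator {0..<1} t * indicator {t. ennreal t < F x} t \<partial>lborel)
       = emeasure lborel {x. ennreal t < F x} * indicator {0..<1} t" by (simp add: mult.commute)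
  qed
  finally show ?thesis .
qed

text \<open>Both suprema equal 1, so for every level t < 1 the superlevel sets of \<open>F\<close>
  and \<open>G\<close> are nonempty and Brunn-Minkowski applies to them; for an empty set the
  additive inequality would be false. Integrating over the levels bounds the sum of the two
  integrals, and the arithmetic-geometric mean inequality turns the sum into a product.\<close>

lemma prekopa_leindler_real_normalized:
  fixes F G H :: "real \<Rightarrow> ennreal"
  assumes [measurable]: "F \<in> borel_measurable borel" "G \<in> borel_measurable borel" "H \<in> borel_measurable borel"
    and le1: "\<And>x. F x \<le> 1" "\<And>x. G x \<le> 1"
    and sup: "\<And>t. t < 1 \<Longrightarrow> \<exists>x. t < F x" "\<And>t. t < 1 \<Longrightarrow> \<exists>x. t < G x"
    and FGH: "\<And>x y. F x * G y \<le> (H ((x + y) / 2))\<^sup>2"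
  shows "(\<integral>\<^sup>+x. F x \<partial>lborel) * (\<integral>\<^sup>+x. G x \<partial>lborel) \<le> (\<integral>\<^sup>+x. H x \<partial>lborel)\<^sup>2"
proof -
  have "(\<integral>\<^sup>+x. F x \<partial>lborel) + (\<integral>\<^sup>+x. G x \<partial>lborel) 
     = (\<integral>\<^sup>+x. min (F x) 1 \<partial>lborel) + (\<integral>\<^sup>+x. min (G x) 1 \<partial>lborel)"
    using le1 by (simp add: min_def antisym)
  also have "\<dots> = (\<integral>\<^sup>+t. (emeasure lborel {x. ennreal t < F x} + emeasure lborel {x. ennreal t < G x})
         * indicator {0..<1} t \<partial>lborel)"
    by (simp add: nn_integral_eq_layers distrib_right nn_integral_add)
  also have "\<dots> \<le> (\<integral>\<^sup>+t. 2 * (emeasure lborel {x. ennreal t < H x} * indicator {0..<1} t) \<partial>lborel)"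
  proof (intro nn_integral_mono)
    fix t :: real
    show "(emeasure lborel {x. ennreal t < F x} + emeasure lborel {x. ennreal t < G x}) * indicator {0..<1} t
      \<le> 2 * (emeasure lborel {x. ennreal t < H x} * indicator {0..<1} t)"
    proof (cases "t \<in> {0..<1}")
      case True
      have lt1: "ennreal t < 1" using True ennreal_less_iff[of t 1] by simp
      have "emeasure lborel {x. ennreal t < F x} + emeasure lborel {x. ennreal t < G x} 
          \<le> 2 * emeasure lborel {x. ennreal t < H x}"
      proof (rule brunn_minkowski_real)
        fix x y assume "x \<in> {x. ennreal t < F x}" "y \<in> {x. ennreal t < G x}"
        then have xy: "ennreal t < F x" "ennreal t < G y" by auto
        \<comment> \<open>If \<open>H\<close> were at most t at the midpoint, then H^2 <= t^2 <= t *
          G y < F x * G y. The strict step uses that \<open>G y\<close> is positive and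
          finite.\<close>
        show "(x + y) / 2 \<in> {x. ennreal t < H x}"
        proof (rule ccontr)
          assume "\<not> ?thesis"
          then have "H ((x + y) / 2) \<le> ennreal t" by auto
          then have "(H ((x + y) / 2))\<^sup>2 \<le> (ennreal t)\<^sup>2" by (intro power_mono) auto
          also have "\<dots> \<le> ennreal t * G y" using xy
            unfolding power2_eq_square by (intro mult_left_mono) auto
          also have "\<dots> < F x * G y" using xy le1(2)[of y]
            by (intro ennreal_mult_strict_right_mono) (auto intro: le_less_trans)
          finally show False using FGH[of x y] by simp
        qed
      qed (use sup[OF lt1] in auto)
      then show ?thesis using True by simp
    qed auto
  qed
  also have "\<dots> = 2 * (\<integral>\<^sup>+x. min (H x) 1 \<partial>lborel)"
    by (simp add: nn_integral_cmult nn_integral_eq_layers)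
  also have "\<dots> \<le> 2 * (\<integral>\<^sup>+x. H x \<partial>lborel)"
    by (intro mult_left_mono nn_integral_mono) auto
  finally have le: "(\<integral>\<^sup>+x. F x \<partial>lborel) + (\<integral>\<^sup>+x. G x \<partial>lborel) \<le> 2 * (\<integral>\<^sup>+x. H x \<partial>lborel)" .
  have "4 * ((\<integral>\<^sup>+x. F x \<partial>lborel) * (\<integral>\<^sup>+x. G x \<partial>lborel)) 
     \<le> ((\<integral>\<^sup>+x. F x \<partial>lborel) + (\<integral>\<^sup>+x. G x \<partial>lborel))\<^sup>2" by (rule ennreal_AM_GM2)
  also have "\<dots> \<le> (2 * (\<integral>\<^sup>+x. H x \<partial>lborel))\<^sup>2" using le by (intro power_mono) auto
  also have "\<dots> = 4 * (\<integral>\<^sup>+x. H x \<partial>lborel)\<^sup>2" by (simp add: power_mult_distrib)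
  finally show ?thesis by (subst (asm) ennreal_mult_le_mult_iff) auto
qed

text \<open>Dividing \<open>F\<close> and \<open>G\<close> by their suprema a and b, and
  \<open>H\<close> by sqrt (a * b), preserves the hypothesis and scales both sides of the conclusion
  alike. Boundedness makes a and b finite; if one of them is zero, so is the left-hand side.\<close>

lemma prekopa_leindler_real_bounded:
  fixes F G H :: "real \<Rightarrow> ennreal"
  assumes [measurable]: "F \<in> borel_measurable borel" "G \<in> borel_measurable borel" "H \<in> borel_measurable borel"
    and bd: "\<And>x. F x \<le> ennreal M" "\<And>x. G x \<le> ennreal M"
    and FGH: "\<And>x y. F x * G y \<le> (H ((x + y) / 2))\<^sup>2"
  shows "(\<integral>\<^sup>+x. F x \<partial>lborel) * (\<integral>\<^sup>+x. G x \<partial>lborel) \<le> (\<integral>\<^sup>+x. H x \<partial>lborel)\<^sup>2"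
proof (cases "(SUP x. F x) = 0 \<or> (SUP x. G x) = 0")
  case True
  then have "(\<forall>x. F x = 0) \<or> (\<forall>x. G x = 0)"
    by (auto simp: SUP_eq_iff bot_ennreal[symmetric])
  then show ?thesis by auto
next
  case False
  have "(SUP x. F x) \<le> ennreal M" "(SUP x. G x) \<le> ennreal M" using bd by (auto intro: SUP_least)
  then have "(SUP x. F x) < top" "(SUP x. G x) < top" using ennreal_less_top le_less_trans by blast+
  then have "(SUP x. F x) \<noteq> \<infinity>" "(SUP x. G x) \<noteq> \<infinity>" by (metis infinity_ennreal_def less_irrefl)+
  then obtain a b where ab: "(SUP x. F x) = ennreal a" "(SUP x. G x) = ennreal b" "a > 0" "b > 0"
    using False by (metis ennreal_cases infinity_ennreal_def ennreal_eq_0_iff not_le)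
  define ia ib where "ia = ennreal (1/a)" and "ib = ennreal (1/b)"
  have inv: "ia * ennreal a = 1" "ib * ennreal b = 1"
    using ab by (simp_all add: ia_def ib_def ennreal_mult[symmetric])
  define c where "c = ennreal (1 / sqrt (a * b))"
  have c2: "c\<^sup>2 = ia * ib"
    using ab by (simp add: c_def ia_def ib_def ennreal_power ennreal_mult[symmetric] power_divide)
  have lt: "\<exists>x. t < i * J x" if "t < 1" "i * ennreal s = 1" "(SUP x. J x) = ennreal s" "i = ennreal (1/s)" "s > 0" 
    for t i s and J :: "real \<Rightarrow> ennreal"
  proof -
    have "t < (SUP x. i * J x)" using that by (simp add: SUP_mult_left_ennreal[symmetric])
    then show ?thesis by (auto simp: less_SUP_iff)
  qed
  have le: "i * J x \<le> 1" if "i * ennreal s = 1" "(SUP x. J x) = ennreal s" for i s x and J :: "real \<Rightarrow> ennreal"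
  proof -
    have "J x \<le> ennreal s" using that(2) by (metis SUP_upper UNIV_I)
    then have "i * J x \<le> i * ennreal s" by (intro mult_left_mono) auto
    then show ?thesis using that by simp
  qed
  have "(\<integral>\<^sup>+x. ia * F x \<partial>lborel) * (\<integral>\<^sup>+x. ib * G x \<partial>lborel) \<le> (\<integral>\<^sup>+x. c * H x \<partial>lborel)\<^sup>2"
  proof (rule prekopa_leindler_real_normalized)
    show "ia * F x * (ib * G y) \<le> (c * H ((x + y) / 2))\<^sup>2" for x y
    proof -
      have "ia * F x * (ib * G y) = ia * ib * (F x * G y)" by (simp add: mult_ac)
      also have "\<dots> \<le> ia * ib * (H ((x + y) / 2))\<^sup>2" by (intro mult_left_mono FGH) auto
      finally show ?thesis by (simp add: power_mult_distrib c2)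
    qed
  qed (use lt[OF _ inv(1) ab(1) ia_def ab(3)] lt[OF _ inv(2) ab(2) ib_def ab(4)] le[OF inv(1) ab(1)] le[OF inv(2) ab(2)] in auto)
  then have "(ia * ib) * ((\<integral>\<^sup>+x. F x \<partial>lborel) * (\<integral>\<^sup>+x. G x \<partial>lborel)) \<le> (ia * ib) * (\<integral>\<^sup>+x. H x \<partial>lborel)\<^sup>2"
    by (simp add: nn_integral_cmult power_mult_distrib c2 mult_ac)
  moreover have "0 < ia * ib" "ia * ib < top"
    using ab by (auto simp: ia_def ib_def ennreal_mult[symmetric] ennreal_zero_less_mult_iff)
  ultimately show ?thesis using ennreal_mult_le_mult_iff[of "ia * ib"] by (metis less_irrefl)
qed

text \<open>Cutting \<open>F\<close> and \<open>G\<close> off at height n only lowers the left side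
  of the hypothesis, so the same \<open>H\<close> serves for all n and monotone convergence
  finishes.\<close>

lemma prekopa_leindler_real:
  fixes F G H :: "real \<Rightarrow> ennreal"
  assumes [measurable]: "F \<in> borel_measurable borel" "G \<in> borel_measurable borel" "H \<in> borel_measurable borel"
    and FGH: "\<And>x y. F x * G y \<le> (H ((x + y) / 2))\<^sup>2"
  shows "(\<integral>\<^sup>+x. F x \<partial>lborel) * (\<integral>\<^sup>+x. G x \<partial>lborel) \<le> (\<integral>\<^sup>+x. H x \<partial>lborel)\<^sup>2"
proof -
  define T where "T F n x = min (F x) (ennreal (real n))" for F :: "real \<Rightarrow> ennreal" and n x
  have lim: "(\<integral>\<^sup>+x. F x \<partial>lborel) = (SUP n. \<integral>\<^sup>+x. T F n x \<partial>lborel)" 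
    and inc: "incseq (\<lambda>n. \<integral>\<^sup>+x. T F n x \<partial>lborel)"
    if [measurable]: "F \<in> borel_measurable borel" for F
  proof -
    have "(SUP n. T F n x) = F x" for x
    proof -
      have "(SUP n. T F n x) = min (F x) (SUP n. ennreal (real n))"
        unfolding T_def by (simp add: inf_SUP flip: inf_min)
      then show ?thesis by (simp add: ennreal_SUP_of_nat_eq_top ennreal_of_nat_eq_real_of_nat[symmetric])
    qed
    moreover have i: "incseq (T F)"
      by (auto simp: incseq_def T_def le_fun_def min_le_iff_disj intro: ennreal_leI)
    ultimately show "(\<integral>\<^sup>+x. F x \<partial>lborel) = (SUP n. \<integral>\<^sup>+x. T F n x \<partial>lborel)"
      using nn_integral_monotone_convergence_SUP[OF i, of lborel] by (simp add: T_def[abs_def])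
    show "incseq (\<lambda>n. \<integral>\<^sup>+x. T F n x \<partial>lborel)" 
      using i by (auto simp: incseq_def le_fun_def intro!: nn_integral_mono)
  qed
  have "(\<integral>\<^sup>+x. T F n x \<partial>lborel) * (\<integral>\<^sup>+x. T G n x \<partial>lborel) \<le> (\<integral>\<^sup>+x. H x \<partial>lborel)\<^sup>2" for n
  proof (rule prekopa_leindler_real_bounded[where M = "real n"])
    show "T F n x * T G n y \<le> (H ((x + y) / 2))\<^sup>2" for x y
      by (rule order_trans[OF mult_mono FGH]) (auto simp: T_def)
  qed (auto simp: T_def[abs_def])
  then have "(SUP n. (\<integral>\<^sup>+x. T F n x \<partial>lborel) * (\<integral>\<^sup>+x. T G n x \<partial>lborel)) \<le> (\<integral>\<^sup>+x. H x \<partial>lborel)\<^sup>2"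
    by (rule SUP_least)
  moreover have "(SUP n. (\<integral>\<^sup>+x. T F n x \<partial>lborel) * (\<integral>\<^sup>+x. T G n x \<partial>lborel))
     = (\<integral>\<^sup>+x. F x \<partial>lborel) * (\<integral>\<^sup>+x. G x \<partial>lborel)"
  proof (rule LIMSEQ_unique)
    show "(\<lambda>n. (\<integral>\<^sup>+x. T F n x \<partial>lborel) * (\<integral>\<^sup>+x. T G n x \<partial>lborel)) \<longlonglongrightarrow> 
      (SUP n. (\<integral>\<^sup>+x. T F n x \<partial>lborel) * (\<integral>\<^sup>+x. T G n x \<partial>lborel))"
      using inc[of F] inc[of G] by (intro LIMSEQ_SUP) (auto simp: incseq_def intro!: mult_mono)
    have "(SUP n. (\<integral>\<^sup>+x. T F n x \<partial>lborel) * (\<integral>\<^sup>+x. T G n x \<partial>lborel)) 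
       = (SUP n. (\<integral>\<^sup>+x. T F n x \<partial>lborel)) * (SUP n. (\<integral>\<^sup>+x. T G n x \<partial>lborel))"
    proof (rule antisym)
      show "(SUP n. (\<integral>\<^sup>+x. T F n x \<partial>lborel)) * (SUP n. (\<integral>\<^sup>+x. T G n x \<partial>lborel))
        \<le> (SUP n. (\<integral>\<^sup>+x. T F n x \<partial>lborel) * (\<integral>\<^sup>+x. T G n x \<partial>lborel))"
        unfolding SUP_mult_right_ennreal SUP_mult_left_ennreal
      proof (intro SUP_least)
        fix n m
        have "(\<integral>\<^sup>+x. T F n x \<partial>lborel) * (\<integral>\<^sup>+x. T G m x \<partial>lborel)
          \<le> (\<integral>\<^sup>+x. T F (max n m) x \<partial>lborel) * (\<integral>\<^sup>+x. T G (max n m) x \<partial>lborel)"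
          using inc[of F] inc[of G] by (intro mult_mono) (auto simp: incseq_def)
        then show "(\<integral>\<^sup>+x. T F n x \<partial>lborel) * (\<integral>\<^sup>+x. T G m x \<partial>lborel)
          \<le> (SUP n. (\<integral>\<^sup>+x. T F n x \<partial>lborel) * (\<integral>\<^sup>+x. T G n x \<partial>lborel))"
          by (rule SUP_upper2[OF UNIV_I])
      qed
    qed (intro SUP_least mult_mono SUP_upper, auto)
    then show "(\<lambda>n. (\<integral>\<^sup>+x. T F n x \<partial>lborel) * (\<integral>\<^sup>+x. T G n x \<partial>lborel)) \<longlonglongrightarrow> 
      (\<integral>\<^sup>+x. F x \<partial>lborel) * (\<integral>\<^sup>+x. G x \<partial>lborel)"
      using inc[of F] inc[of G] LIMSEQ_SUP[of "\<lambda>n. (\<integral>\<^sup>+x. T F n x \<partial>lborel) * (\<integral>\<^sup>+x. T G n x \<partial>lborel)"]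
      by (simp add: lim incseq_def mult_mono)
  qed
  ultimately show ?thesis by simp
qed

section \<open>Prekopa-Leindler inequality in several dimensions\<close>

text \<open>Freezing coordinate i at s, t and (s + t) / 2 gives sections that satisfy the hypothesis
  in the remaining coordinates. The induction hypothesis for them is precisely the hypothesis of the
  one-dimensional inequality for the partial integrals as functions of coordinate i.\<close>

lemma prekopa_leindler_PiM:
  fixes F G H :: "('i \<Rightarrow> real) \<Rightarrow> ennreal"
  assumes "finite I"
    and "F \<in> borel_measurable (\<Pi>\<^sub>M i\<in>I. lborel)" "G \<in> borel_measurable (\<Pi>\<^sub>M i\<in>I. lborel)"
      "H \<in> borel_measurable (\<Pi>\<^sub>M i\<in>I. lborel)"
    and "\<And>x y. x \<in> extensional I \<Longrightarrow> y \<in> extensional I \<Longrightarrow> F x * G y \<le> (H (\<lambda>i\<in>I. (x i + y i) / 2))\<^sup>2"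
  shows "integral\<^sup>N (\<Pi>\<^sub>M i\<in>I. lborel) F * integral\<^sup>N (\<Pi>\<^sub>M i\<in>I. lborel) G \<le> (integral\<^sup>N (\<Pi>\<^sub>M i\<in>I. lborel) H)\<^sup>2"
  using assms
proof (induction I arbitrary: F G H rule: finite_induct)
  case empty
  interpret product_sigma_finite "\<lambda>_. lborel :: real measure" by standard
  show ?case
    using empty(4)[of "\<lambda>_. undefined" "\<lambda>_. undefined"] by (simp add: nn_integral_empty restrict_def)
next
  case (insert i I)
  interpret product_sigma_finite "\<lambda>_. lborel :: real measure" by standard
  interpret I: finite_product_sigma_finite "\<lambda>_. lborel :: real measure" I by standard fact
  note [measurable] = insert.prems(1-3)
  let ?P = "\<Pi>\<^sub>M i\<in>I. (lborel :: real measure)"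
  have sec[measurable]: "(\<lambda>x. J (x(i := s))) \<in> borel_measurable ?P"
    if [measurable]: "J \<in> borel_measurable (\<Pi>\<^sub>M i\<in>insert i I. (lborel :: real measure))" for J :: "('i \<Rightarrow> real) \<Rightarrow> ennreal" and s
    by measurable
  have [measurable]: "(\<lambda>s. \<integral>\<^sup>+x. J (x(i := s)) \<partial>?P) \<in> borel_measurable borel"
    if [measurable]: "J \<in> borel_measurable (\<Pi>\<^sub>M i\<in>insert i I. (lborel :: real measure))" for J :: "('i \<Rightarrow> real) \<Rightarrow> ennreal"
    by measurable
  have "(\<integral>\<^sup>+s. \<integral>\<^sup>+x. F (x(i := s)) \<partial>?P \<partial>lborel) * (\<integral>\<^sup>+s. \<integral>\<^sup>+x. G (x(i := s)) \<partial>?P \<partial>lborel)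
     \<le> (\<integral>\<^sup>+s. \<integral>\<^sup>+x. H (x(i := s)) \<partial>?P \<partial>lborel)\<^sup>2"
  proof (rule prekopa_leindler_real)
    fix s t
    show "(\<integral>\<^sup>+x. F (x(i := s)) \<partial>?P) * (\<integral>\<^sup>+x. G (x(i := t)) \<partial>?P) \<le> (\<integral>\<^sup>+x. H (x(i := (s + t) / 2)) \<partial>?P)\<^sup>2"
    proof (rule insert.IH)
      fix x y :: "'i \<Rightarrow> real" assume xy: "x \<in> extensional I" "y \<in> extensional I"
      have "x(i := s) \<in> extensional (insert i I)" "y(i := t) \<in> extensional (insert i I)"
        using xy by (auto simp: extensional_def)
      note insert.prems(4)[OF this]
      moreover have "(\<lambda>j\<in>insert i I. ((x(i := s)) j + (y(i := t)) j) / 2) = (\<lambda>j\<in>I. (x j + y j) / 2)(i := (s + t) / 2)"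
        by (auto simp: fun_eq_iff restrict_def)
      ultimately show "F (x(i := s)) * G (y(i := t)) \<le> (H ((\<lambda>j\<in>I. (x j + y j) / 2)(i := (s + t) / 2)))\<^sup>2"
        by (simp only:)
    qed measurable
  qed measurable
  then show ?case
    using insert.hyps by (simp add: product_nn_integral_insert_rev)
qed

theorem prekopa_leindler:
  fixes F G H :: "'a::euclidean_space \<Rightarrow> ennreal"
  assumes [measurable]: "F \<in> borel_measurable borel" "G \<in> borel_measurable borel" "H \<in> borel_measurable borel"
    and FGH: "\<And>x y. F x * G y \<le> (H ((x + y) /\<^sub>R 2))\<^sup>2"
  shows "(\<integral>\<^sup>+x. F x \<partial>lborel) * (\<integral>\<^sup>+x. G x \<partial>lborel) \<le> (\<integral>\<^sup>+x. H x \<partial>lborel)\<^sup>2"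
proof -
  let ?P = "\<Pi>\<^sub>M b\<in>(Basis :: 'a set). (lborel :: real measure)"
  let ?e = "\<lambda>f. \<Sum>b\<in>(Basis :: 'a set). f b *\<^sub>R b"
  have eq: "(\<integral>\<^sup>+x. J x \<partial>lborel) = (\<integral>\<^sup>+f. J (?e f) \<partial>?P)" 
    if [measurable]: "J \<in> borel_measurable borel" for J :: "'a \<Rightarrow> ennreal"
    unfolding lborel_eq[where 'a = 'a] by (subst nn_integral_distr) auto
  show ?thesis
    unfolding eq[OF assms(1)] eq[OF assms(2)] eq[OF assms(3)]
  proof (rule prekopa_leindler_PiM)
    fix x y :: "'a \<Rightarrow> real"
    have "(?e x + ?e y) /\<^sub>R 2 = ?e (\<lambda>i\<in>Basis. (x i + y i) / 2)"
      unfolding sum.distrib[symmetric] scaleR_add_left[symmetric] scaleR_sum_right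
      by (intro sum.cong) simp_all
    then show "F (?e x) * G (?e y) \<le> (H (?e (\<lambda>i\<in>Basis. (x i + y i) / 2)))\<^sup>2"
      using FGH[of "?e x" "?e y"] by simp
  qed auto
qed

section \<open>Variance bounds for functions with Lipschitz gradient\<close>

text \<open>The Maclaurin remainder has even order 4 and is therefore nonnegative. Stopping at the
  quadratic term would not give a lower bound for negative arguments.\<close>

lemma exp_ge_cubic: "1 + x + x\<^sup>2 / 2 + x ^ 3 / 6 \<le> exp (x::real)"
proof -
  obtain t where "exp x = (\<Sum>m<4. x ^ m / fact m) + exp t / fact 4 * x ^ 4"
    using Maclaurin_exp_le[of x 4] by blast
  then have "exp x = 1 + x + x\<^sup>2 / 2 + x ^ 3 / 6 + exp t / fact 4 * x ^ 4"
    by (simp add: eval_nat_numeral)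
  moreover have "0 \<le> exp t / fact 4 * x ^ 4" by simp
  ultimately show ?thesis by linarith
qed

text \<open>The coefficient 7 and the bound \<open>\<theta> \<le> 2\<close> are not sharp; only the order \<open>e ^ 3\<close> of the error matters.\<close>

lemma exp_ge_second_order:
  fixes e h q \<theta> B :: real
  assumes "0 < e" "e \<le> 1" "\<bar>h\<bar> \<le> B" "\<bar>q\<bar> \<le> B" "1 \<le> B" "0 \<le> \<theta>" "\<theta> \<le> 2"
  shows "1 + e * h + e\<^sup>2 * (h\<^sup>2 / 2 - \<theta> * q) - 7 * B ^ 3 * e ^ 3 \<le> exp (e * h - e\<^sup>2 * \<theta> * q)"
proof -
  define p where "p = e * h - e\<^sup>2 * \<theta> * q"
  have tq: "\<bar>\<theta> * q\<bar> \<le> 2 * B" using assms by (simp add: abs_mult mult_mono)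
  have etq: "\<bar>e * (\<theta> * q)\<bar> \<le> 2 * B"
    using tq assms mult_mono[of e 1 "\<bar>\<theta> * q\<bar>" "2 * B"] by (simp add: abs_mult)
  have p: "p = e * (h - e * (\<theta> * q))" by (simp add: p_def algebra_simps power2_eq_square)
  have r: "\<bar>h - e * (\<theta> * q)\<bar> \<le> 3 * B" using etq assms by linarith
  have "\<bar>p\<bar> \<le> e * (3 * B)"
    unfolding p abs_mult using r assms by (intro mult_mono) auto
  then have "\<bar>p\<bar> ^ 3 \<le> (e * (3 * B)) ^ 3" by (intro power_mono) auto
  then have "\<bar>p ^ 3\<bar> \<le> 27 * B ^ 3 * e ^ 3" by (simp add: power_abs power_mult_distrib mult_ac)
  \<comment> \<open>The 7 arises as 5 + 2: |p| <= 3 * B * e bounds the cubic term by 27 / 6 <= 5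
    times (B * e)^3, and the cross term of p^2 / 2 contributes 2 * B^3 * e^3. The remaining square
    in p^2 / 2 is nonnegative and is dropped.\<close>
  then have p3: "p ^ 3 / 6 \<ge> - 5 * B ^ 3 * e ^ 3" 
  proof -
    have "0 \<le> B ^ 3 * e ^ 3" using assms by simp
    then show ?thesis using \<open>\<bar>p ^ 3\<bar> \<le> 27 * B ^ 3 * e ^ 3\<close> by (simp add: mult.assoc)
  qed
  have "\<bar>(h * (\<theta> * q))\<bar> \<le> B * (2 * B)" using tq assms unfolding abs_mult[of h] by (intro mult_mono) auto
  then have "h * (\<theta> * q) \<le> 2 * B\<^sup>2" by (simp add: power2_eq_square)
  moreover have "B\<^sup>2 \<le> B ^ 3" using assms by (intro power_increasing) auto
  ultimately have "h * (\<theta> * q) \<le> 2 * B ^ 3" by linarith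
  then have c1: "e ^ 3 * (h * (\<theta> * q)) \<le> e ^ 3 * (2 * B ^ 3)" using assms by (intro mult_left_mono) auto
  have c2: "p\<^sup>2 / 2 = e\<^sup>2 * (h\<^sup>2 / 2) - e ^ 3 * (h * (\<theta> * q)) + (e\<^sup>2 * (\<theta> * q))\<^sup>2 / 2"
    unfolding p by (simp add: power2_eq_square power3_eq_cube field_simps)
  have p2: "p\<^sup>2 / 2 \<ge> e\<^sup>2 * (h\<^sup>2 / 2) - 2 * B ^ 3 * e ^ 3"
  proof -
    have "0 \<le> (e\<^sup>2 * (\<theta> * q))\<^sup>2 / 2" by simp
    then have "p\<^sup>2 / 2 \<ge> e\<^sup>2 * (h\<^sup>2 / 2) - e ^ 3 * (2 * B ^ 3)"
      using c1 c2 by linarith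
    then show ?thesis by (simp add: mult_ac)
  qed
  have "1 + e * h + e\<^sup>2 * (h\<^sup>2 / 2 - \<theta> * q) - 7 * B ^ 3 * e ^ 3 
     = 1 + p + (e\<^sup>2 * (h\<^sup>2 / 2) - 2 * B ^ 3 * e ^ 3) + (- 5 * B ^ 3 * e ^ 3)"
    unfolding p_def by (simp add: algebra_simps)
  also have "\<dots> \<le> 1 + p + p\<^sup>2 / 2 + p ^ 3 / 6" using p2 p3 by linarith
  also have "\<dots> \<le> exp p" by (rule exp_ge_cubic)
  finally show ?thesis by (simp add: p_def)
qed

text \<open>Second-order expansion of \<open>ineq\<close> at e = 0: both sides equal m^2 there, the
  terms of order e cancel because the two exponents have opposite signs, and the terms of order e^2
  are the claim. The factor 1 / (1 - C * e) tends to 1 and leaves no trace. In the application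
  \<open>q\<close> is the squared gradient.\<close>

lemma variance_le_of_exp_inequality:
  fixes M :: "'a measure" and h q :: "'a \<Rightarrow> real"
  assumes "finite_measure M"
    and [measurable]: "h \<in> borel_measurable M" "q \<in> borel_measurable M"
    and bdh: "AE x in M. \<bar>h x\<bar> \<le> B" and bdq: "AE x in M. \<bar>q x\<bar> \<le> B" and "C \<ge> 0"
    and ineq: "\<And>e. 0 < e \<Longrightarrow> C * e < 1 \<Longrightarrow> 
      (LINT x|M. exp (e * h x - e\<^sup>2 * (1 / (1 - C * e)) * q x)) * (LINT x|M. exp (- e * h x)) 
        \<le> (measure M (space M))\<^sup>2"
  shows "measure M (space M) * (LINT x|M. (h x)\<^sup>2) - (LINT x|M. h x)\<^sup>2 \<le> measure M (space M) * (LINT x|M. q x)"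
proof (cases "measure M (space M) = 0")
  case True
  then show ?thesis by simp
next
  case False
  interpret finite_measure M by fact
  define m where "m = measure M (space M)"
  have m: "m > 0" using False by (simp add: m_def zero_less_measure_iff)
  define B' where "B' = max 1 B"
  have B': "1 \<le> B'" "AE x in M. \<bar>h x\<bar> \<le> B'" "AE x in M. \<bar>q x\<bar> \<le> B'"
    using bdh bdq unfolding B'_def by (simp, (eventually_elim, simp)+)
  define s d m1 where "s = (LINT x|M. (h x)\<^sup>2)" and "d = (LINT x|M. q x)" and "m1 = (LINT x|M. h x)"
  have ih: "integrable M h" using B'(2) by (intro integrable_const_bound[where B = B']) auto
  have iq: "integrable M q" using B'(3) by (intro integrable_const_bound[where B = B']) auto
  have ihh: "integrable M (\<lambda>x. (h x)\<^sup>2)"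
  proof (rule integrable_const_bound[where B = "B'\<^sup>2"])
    show "AE x in M. norm ((h x)\<^sup>2) \<le> B'\<^sup>2"
      using B'(2) by eventually_elim (simp add: abs_le_square_iff[symmetric])
  qed auto
  define c where "c = 7 * B' ^ 3 * m"
  define \<theta> where "\<theta> e = 1 / (1 - C * e)" for e
  define a where "a e = s / 2 - \<theta> e * d - c * e" for e
  define b where "b e = s / 2 - c * e" for e
  \<comment> \<open>One estimate for both factors: the sign \<sigma> selects the exponent, and t is
    \<theta> e for the penalised factor and 0 for the other.\<close>
  have key: "m + e * g + e\<^sup>2 * (s / 2 - t * d - c * e) \<le> (LINT x|M. exp (e * (\<sigma> * h x) - e\<^sup>2 * t * q x))"
    if e: "0 < e" "e \<le> 1" "0 \<le> t" "t \<le> 2" and \<sigma>: "\<sigma> = 1 \<or> \<sigma> = -1" "g = \<sigma> * m1" for e t \<sigma> g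
  proof -
    have \<sigma>2: "\<bar>\<sigma> * z\<bar> = \<bar>z\<bar>" "(\<sigma> * z)\<^sup>2 = z\<^sup>2" for z using \<sigma> by (auto simp: power_mult_distrib)
    have "m + e * g + e\<^sup>2 * (s / 2 - t * d - c * e) 
       = (LINT x|M. 1 + e * (\<sigma> * h x) + e\<^sup>2 * ((\<sigma> * h x)\<^sup>2 / 2 - t * q x) - 7 * B' ^ 3 * e ^ 3)"
      unfolding \<sigma>2 using ih iq ihh
      by (simp add: m_def[symmetric] s_def[symmetric] d_def[symmetric] m1_def[symmetric] \<sigma>(2) c_def)
         (simp add: power2_eq_square power3_eq_cube algebra_simps)
    also have "\<dots> \<le> (LINT x|M. exp (e * (\<sigma> * h x) - e\<^sup>2 * t * q x))"
    proof (rule integral_mono_AE)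
      show "integrable M (\<lambda>x. 1 + e * (\<sigma> * h x) + e\<^sup>2 * ((\<sigma> * h x)\<^sup>2 / 2 - t * q x) - 7 * B' ^ 3 * e ^ 3)"
        unfolding \<sigma>2 using ih iq ihh by simp
      show "integrable M (\<lambda>x. exp (e * (\<sigma> * h x) - e\<^sup>2 * t * q x))"
      proof (rule integrable_const_bound[where B = "exp (e * B' + e\<^sup>2 * t * B')"])
        show "AE x in M. norm (exp (e * (\<sigma> * h x) - e\<^sup>2 * t * q x)) \<le> exp (e * B' + e\<^sup>2 * t * B')"
          using B'(2,3)
        proof eventually_elim
          case (elim x)
          have "e * (\<sigma> * h x) \<le> e * B'" using e elim \<sigma>2(1)[of "h x"] by (intro mult_left_mono) auto
          moreover have "e\<^sup>2 * t * (- q x) \<le> e\<^sup>2 * t * B'" using e elim by (intro mult_left_mono) auto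
          ultimately show ?case by simp
        qed
      qed measurable
      show "AE x in M. 1 + e * (\<sigma> * h x) + e\<^sup>2 * ((\<sigma> * h x)\<^sup>2 / 2 - t * q x) - 7 * B' ^ 3 * e ^ 3
        \<le> exp (e * (\<sigma> * h x) - e\<^sup>2 * t * q x)"
        using B'(2,3)
      proof eventually_elim
        case (elim x)
        show ?case by (rule exp_ge_second_order) (use e elim \<sigma>2(1)[of "h x"] B'(1) in auto)
      qed
    qed
    finally show ?thesis .
  qed
  have th: "(\<theta> \<longlongrightarrow> 1) (at_right 0)"
    unfolding \<theta>_def by (auto intro!: tendsto_eq_intros)
  have ta: "(a \<longlongrightarrow> s / 2 - d) (at_right 0)"
    unfolding a_def by (rule tendsto_eq_intros th refl | simp)+
  have tb: "(b \<longlongrightarrow> s / 2) (at_right 0)"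
    unfolding b_def by (auto intro!: tendsto_eq_intros)
  have e0: "((\<lambda>e::real. e) \<longlongrightarrow> 0) (at_right 0)" by (rule tendsto_ident_at)
  have tA: "((\<lambda>e. m + e * m1 + e\<^sup>2 * a e) \<longlongrightarrow> m) (at_right 0)"
    by (rule tendsto_eq_intros ta e0 refl | simp)+
  have tB: "((\<lambda>e. m - e * m1 + e\<^sup>2 * b e) \<longlongrightarrow> m) (at_right 0)"
    by (rule tendsto_eq_intros tb e0 refl | simp)+
  \<comment> \<open>The product of the two lower bounds is m^2 + e^2 * R e, so the hypothesis says R
    e <= 0 for small e.\<close>
  define R where "R e = m * b e + m * a e - m1\<^sup>2 + e * m1 * b e - e * m1 * a e + e\<^sup>2 * a e * b e" for e
  have tR: "(R \<longlongrightarrow> m * (s / 2) + m * (s / 2 - d) - m1\<^sup>2) (at_right 0)"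
    unfolding R_def by (rule tendsto_eq_intros ta tb e0 refl | simp)+
  have tCe: "((\<lambda>e. C * e) \<longlongrightarrow> 0) (at_right 0)" by (rule tendsto_eq_intros e0 refl | simp)+
  \<comment> \<open>The lower bounds may be multiplied only while they are positive, which holds
    near 0 as both tend to m > 0. The condition C * e < 1 / 2 keeps \<theta> e at most 2.\<close>
  have "eventually (\<lambda>e. R e \<le> 0) (at_right 0)"
    using order_tendstoD(1)[OF tA m] order_tendstoD(1)[OF tB m] order_tendstoD(2)[OF tCe half_gt_zero[OF zero_less_one]]
      order_tendstoD(2)[OF e0 zero_less_one] eventually_at_right_less[of 0]
  proof eventually_elim
    case (elim e)
    have \<theta>e: "0 \<le> \<theta> e" "\<theta> e \<le> 2" using elim by (auto simp: \<theta>_def field_simps)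
    have 1: "m + e * m1 + e\<^sup>2 * a e \<le> (LINT x|M. exp (e * h x - e\<^sup>2 * \<theta> e * q x))"
      using key[of e "\<theta> e" 1 m1] elim \<theta>e by (simp add: a_def)
    have 2: "m - e * m1 + e\<^sup>2 * b e \<le> (LINT x|M. exp (- e * h x))"
      using key[of e 0 "-1" "-m1"] elim by (simp add: b_def)
    have "(m + e * m1 + e\<^sup>2 * a e) * (m - e * m1 + e\<^sup>2 * b e) 
       \<le> (LINT x|M. exp (e * h x - e\<^sup>2 * \<theta> e * q x)) * (LINT x|M. exp (- e * h x))"
      using 1 2 elim by (intro mult_mono) auto
    also have "\<dots> \<le> m\<^sup>2"
      using ineq[of e] elim by (simp add: \<theta>_def m_def)
    finally have "e\<^sup>2 * R e \<le> 0" 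
      by (simp add: R_def power2_eq_square algebra_simps)
    then show ?case using elim by (simp add: mult_le_0_iff)
  qed
  then have "m * (s / 2) + m * (s / 2 - d) - m1\<^sup>2 \<le> 0"
    by (intro tendsto_upperbound[OF tR]) auto
  then show ?thesis by (simp add: m_def[symmetric] s_def d_def m1_def algebra_simps)
qed

section \<open>Restricted Gaussian measures and the Poincare inequality under a quadratic Taylor
  bound\<close>

text \<open>The measure is unnormalised and lives on the whole space with the Borel sigma-algebra,
  so continuous functions are measurable without restriction and integrals over
  \<open>lborel\<close>, where Prekopa-Leindler is stated, convert directly.\<close>

definition gauss_on :: "(real^'n) set \<Rightarrow> (real^'n) measure" where
  "gauss_on S = density lborel (\<lambda>x. ennreal (indicator S x * gauss x))"

lemma gauss_pos: "gauss x > 0"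
  by (simp add: gauss_def)

lemma continuous_on_gauss [continuous_intros]: "continuous_on S gauss"
  unfolding gauss_def by (intro continuous_intros) auto

lemma borel_measurable_gauss [measurable]: "gauss \<in> borel_measurable borel"
  by (intro borel_measurable_continuous_onI continuous_intros)

lemma sets_gauss_on [simp, measurable_cong]: "sets (gauss_on S) = sets borel"
  and space_gauss_on [simp]: "space (gauss_on S) = UNIV"
  by (simp_all add: gauss_on_def)

lemma AE_gauss_on:
  assumes [measurable]: "S \<in> sets borel"
  shows "(AE x in gauss_on S. P x) \<longleftrightarrow> (AE x in lborel. x \<in> S \<longrightarrow> P x)"
  unfolding gauss_on_def by (subst AE_density) (auto simp: indicator_def gauss_pos)

lemma finite_measure_gauss_on_compact:
  assumes "compact S"
  shows "finite_measure (gauss_on S)"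
proof -
  have [measurable]: "S \<in> sets borel" using assms by (rule borel_compact)
  have "emeasure (gauss_on S) (space (gauss_on S)) = (\<integral>\<^sup>+x. ennreal (indicator S x * gauss x) \<partial>lborel)"
    unfolding gauss_on_def by (subst emeasure_density) auto
  also have "\<dots> \<noteq> \<infinity>"
    using borel_integrable_compact[OF assms continuous_on_gauss]
    by (simp add: integrable_iff_bounded abs_of_nonneg less_imp_le[OF gauss_pos] less_top)
  finally show ?thesis by (intro finite_measureI) simp
qed

text \<open>\<open>D\<close> enters only through the lower Taylor bound on \<open>K\<close>. For x
  and y in \<open>K\<close> the hypothesis of Prekopa-Leindler reduces to e * (h x - h y) <= e^2 *
  \<theta> * |D x|^2 + |x - y|^2 / 4, which follows from that bound and completing a square;
  convexity puts the midpoint in \<open>K\<close>, and off \<open>K\<close> the left side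
  vanishes.\<close>

lemma poincare_C11:
  fixes K :: "(real^'n) set" and h :: "real^'n \<Rightarrow> real" and D :: "real^'n \<Rightarrow> real^'n"
  assumes K: "compact K" "convex K" and h: "continuous_on UNIV h" and D: "continuous_on UNIV D" and L: "L \<ge> 0"
    and taylor: "\<And>x y. x \<in> K \<Longrightarrow> y \<in> K \<Longrightarrow> h y \<ge> h x + D x \<bullet> (y - x) - L * (norm (y - x))\<^sup>2"
  defines "M \<equiv> gauss_on K"
  shows "measure M (space M) * (LINT x|M. (h x)\<^sup>2) - (LINT x|M. h x)\<^sup>2 
    \<le> measure M (space M) * (LINT x|M. (norm (D x))\<^sup>2)"
proof -
  have [measurable]: "K \<in> sets borel" using K(1) by (rule borel_compact)
  have [measurable]: "h \<in> borel_measurable borel" "D \<in> borel_measurable borel"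
    using h D by (auto intro: borel_measurable_continuous_onI)
  have [measurable_cong]: "sets M = sets borel" by (simp add: M_def)
  interpret finite_measure M unfolding M_def by (rule finite_measure_gauss_on_compact[OF K(1)])
  have "bounded (h ` K)" by (intro compact_imp_bounded compact_continuous_image continuous_on_subset[OF h] K) auto
  then obtain B1 where B1: "\<And>x. x \<in> K \<Longrightarrow> \<bar>h x\<bar> \<le> B1" by (auto simp: bounded_iff)
  have "bounded ((\<lambda>x. (norm (D x))\<^sup>2) ` K)" 
    by (intro compact_imp_bounded compact_continuous_image continuous_intros continuous_on_subset[OF D] K) auto
  then obtain B2 where B2: "\<And>x. x \<in> K \<Longrightarrow> \<bar>(norm (D x))\<^sup>2\<bar> \<le> B2" by (auto simp: bounded_iff)
  define B where "B = max B1 B2"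
  have Bh: "AE x in M. \<bar>h x\<bar> \<le> B" and Bq: "AE x in M. \<bar>(norm (D x))\<^sup>2\<bar> \<le> B"
    unfolding M_def AE_gauss_on[OF \<open>K \<in> sets borel\<close>] using B1 B2 by (auto simp: B_def le_max_iff_disj)
  show ?thesis
  proof (rule variance_le_of_exp_inequality[OF _ _ _ Bh Bq])
    show "finite_measure M" by unfold_locales
    show "4 * L \<ge> 0" using L by simp
    fix e :: real assume e: "0 < e" "4 * L * e < 1"
    \<comment> \<open>This value solves 1 / (4 * \<theta>) + e * L = 1 / 4: the completed square and
      the Taylor remainder together use up exactly the Gaussian gain |x - y|^2 / 4.\<close>
    define \<theta> where "\<theta> = 1 / (1 - 4 * L * e)"
    have \<theta>: "\<theta> > 0" "1 / (4 * \<theta>) + e * L = 1 / 4" using e by (auto simp: \<theta>_def field_simps)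
    define f1 where "f1 x = exp (e * h x - e\<^sup>2 * \<theta> * (norm (D x))\<^sup>2)" for x
    define f2 where "f2 x = exp (- e * h x)" for x
    have [measurable]: "f1 \<in> borel_measurable borel" "f2 \<in> borel_measurable borel" 
      unfolding f1_def f2_def by measurable
    have int: "(\<integral>\<^sup>+x. ennreal (indicator K x * gauss x * f x) \<partial>lborel) = ennreal (LINT x|M. f x)"
      if [measurable]: "f \<in> borel_measurable borel" and f: "AE x in M. norm (f x) \<le> c" "\<And>x. f x \<ge> 0" for f :: "real^'n \<Rightarrow> real" and c
    proof -
      have "integrable M f" using f by (intro integrable_const_bound[where B = c]) auto
      then have "ennreal (LINT x|M. f x) = (\<integral>\<^sup>+x. ennreal (f x) \<partial>M)"
        using f by (simp add: nn_integral_eq_integral)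
      also have "\<dots> = (\<integral>\<^sup>+x. ennreal (indicator K x * gauss x) * ennreal (f x) \<partial>lborel)"
        unfolding M_def gauss_on_def by (subst nn_integral_density) auto
      also have "\<dots> = (\<integral>\<^sup>+x. ennreal (indicator K x * gauss x * f x) \<partial>lborel)"
        using f(2) by (intro nn_integral_cong ennreal_mult[symmetric]) (simp_all add: less_imp_le[OF gauss_pos])
      finally show ?thesis by simp
    qed
    have i1: "(\<integral>\<^sup>+x. ennreal (indicator K x * gauss x * f1 x) \<partial>lborel) = ennreal (LINT x|M. f1 x)"
    proof (rule int)
      show "AE x in M. norm (f1 x) \<le> exp (e * B)"
        using Bh
      proof eventually_elim
        case (elim x)
        have "e * h x \<le> e * B" using e elim by (intro mult_left_mono) auto
        moreover have "0 \<le> e\<^sup>2 * \<theta> * (norm (D x))\<^sup>2" using \<theta> by simp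
        ultimately show ?case by (simp add: f1_def)
      qed
    qed (auto simp: f1_def)
    have i2: "(\<integral>\<^sup>+x. ennreal (indicator K x * gauss x * f2 x) \<partial>lborel) = ennreal (LINT x|M. f2 x)"
    proof (rule int)
      show "AE x in M. norm (f2 x) \<le> exp (e * B)"
        using Bh
      proof eventually_elim
        case (elim x)
        have "e * (- h x) \<le> e * B" using e elim by (intro mult_left_mono) auto
        then show ?case by (simp add: f2_def)
      qed
    qed (auto simp: f2_def)
    have i3: "(\<integral>\<^sup>+x. ennreal (indicator K x * gauss x) \<partial>lborel) = ennreal (measure M (space M))"
      using int[of "\<lambda>_. 1" 1] by simp
    have "(\<integral>\<^sup>+x. ennreal (indicator K x * gauss x * f1 x) \<partial>lborel) * (\<integral>\<^sup>+x. ennreal (indicator K x * gauss x * f2 x) \<partial>lborel)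
      \<le> (\<integral>\<^sup>+x. ennreal (indicator K x * gauss x) \<partial>lborel)\<^sup>2"
    proof (rule prekopa_leindler)
      fix x y :: "real^'n"
      show "ennreal (indicator K x * gauss x * f1 x) * ennreal (indicator K y * gauss y * f2 y)
        \<le> (ennreal (indicator K ((x + y) /\<^sub>R 2) * gauss ((x + y) /\<^sub>R 2)))\<^sup>2"
      proof (cases "x \<in> K \<and> y \<in> K")
        case True
        have mid: "(x + y) /\<^sub>R 2 \<in> K" 
          using convexD[OF K(2), of x y "1/2" "1/2"] True by (simp add: scaleR_add_right inverse_eq_divide)
        define d where "d = norm (y - x)"
        \<comment> \<open>Parallelogram identity: the strict convexity of the Gaussian exponent is
          the sole source of the gradient bound.\<close>
        have par: "(norm x)\<^sup>2 / 2 + (norm y)\<^sup>2 / 2 - (norm ((x + y) /\<^sub>R 2))\<^sup>2 = d\<^sup>2 / 4"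
          unfolding d_def power2_norm_eq_inner 
          by (simp add: inner_add inner_diff inner_commute field_simps)
        have "- (D x \<bullet> (y - x)) \<le> norm (D x) * d" unfolding d_def
          using Cauchy_Schwarz_ineq2[of "D x" "y - x"] by linarith
        then have "e * (- (D x \<bullet> (y - x))) \<le> e * (norm (D x) * d)" using e by (intro mult_left_mono) auto
        also have "\<dots> \<le> e\<^sup>2 * \<theta> * (norm (D x))\<^sup>2 + d\<^sup>2 * (1 / (4 * \<theta>))"
        proof -
          have "0 \<le> (2 * \<theta> * (e * norm (D x)) - d)\<^sup>2 / (4 * \<theta>)" using \<theta> by simp
          also have "\<dots> = e\<^sup>2 * \<theta> * (norm (D x))\<^sup>2 + d\<^sup>2 * (1 / (4 * \<theta>)) - e * (norm (D x) * d)"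
            using \<theta>(1) by (simp add: power2_eq_square field_simps)
          finally show ?thesis by simp
        qed
        finally have 1: "e * (- (D x \<bullet> (y - x))) \<le> e\<^sup>2 * \<theta> * (norm (D x))\<^sup>2 + d\<^sup>2 * (1 / (4 * \<theta>))" .
        have "e * (h x - h y) \<le> e * (- (D x \<bullet> (y - x)) + L * d\<^sup>2)"
          using taylor[of x y] True e by (intro mult_left_mono) (auto simp: d_def)
        then have "e * (h x - h y) \<le> e\<^sup>2 * \<theta> * (norm (D x))\<^sup>2 + d\<^sup>2 * (1 / (4 * \<theta>) + e * L)"
          using 1 by (simp add: algebra_simps)
        then have "e * h x - e\<^sup>2 * \<theta> * (norm (D x))\<^sup>2 - e * h y \<le> d\<^sup>2 / 4"
          unfolding \<theta>(2) by (simp add: algebra_simps)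
        then have ex: "- (norm x)\<^sup>2 / 2 + (e * h x - e\<^sup>2 * \<theta> * (norm (D x))\<^sup>2) + (- (norm y)\<^sup>2 / 2 + - e * h y) 
           \<le> - (norm ((x + y) /\<^sub>R 2))\<^sup>2 / 2 + - (norm ((x + y) /\<^sub>R 2))\<^sup>2 / 2"
          using par by simp
        define c :: real where "c = (2 * pi) powr (- real CARD('n) / 2)"
        have "gauss x * f1 x * (gauss y * f2 y) 
          = c\<^sup>2 * exp (- (norm x)\<^sup>2 / 2 + (e * h x - e\<^sup>2 * \<theta> * (norm (D x))\<^sup>2) + (- (norm y)\<^sup>2 / 2 + - e * h y))"
          unfolding exp_add by (simp add: gauss_def f1_def f2_def c_def power2_eq_square)
        also have "\<dots> \<le> c\<^sup>2 * exp (- (norm ((x + y) /\<^sub>R 2))\<^sup>2 / 2 + - (norm ((x + y) /\<^sub>R 2))\<^sup>2 / 2)"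
          using ex by (intro mult_left_mono) auto
        also have "\<dots> = (gauss ((x + y) /\<^sub>R 2))\<^sup>2"
          unfolding exp_add gauss_def c_def[symmetric] by (simp add: power2_eq_square)
        finally have "gauss x * f1 x * (gauss y * f2 y) \<le> (gauss ((x + y) /\<^sub>R 2))\<^sup>2" .
        then show ?thesis using True mid gauss_pos[of x] gauss_pos[of y] gauss_pos[of "(x + y) /\<^sub>R 2"]
          by (simp add: f1_def f2_def ennreal_power ennreal_mult[symmetric] ennreal_leI)
      qed auto
    qed measurable
    note pl = this
    have "ennreal ((LINT x|M. f1 x) * (LINT x|M. f2 x)) \<le> ennreal ((measure M (space M))\<^sup>2)"
    proof -
      have "0 \<le> (LINT x|M. f1 x)" "0 \<le> (LINT x|M. f2 x)" by (auto simp: f1_def f2_def)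
      then show ?thesis using pl unfolding i1 i2 i3 by (simp add: ennreal_power ennreal_mult)
    qed
    then have "(LINT x|M. f1 x) * (LINT x|M. f2 x) \<le> (measure M (space M))\<^sup>2"
      by (simp add: ennreal_le_iff)
    then show "(LINT x|M. exp (e * h x - e\<^sup>2 * (1 / (1 - 4 * L * e)) * (norm (D x))\<^sup>2)) * (LINT x|M. exp (- e * h x))
       \<le> (measure M (space M))\<^sup>2"
      by (simp add: f1_def f2_def \<theta>_def)
  qed measurable
qed

section \<open>Smooth mollifiers\<close>

lemma Ck_SucI:
  assumes "\<And>x. (f has_derivative (\<lambda>h. g x \<bullet> h)) (at x)" "\<And>j. Ck k (\<lambda>x. g x $ j)"
  shows "Ck (Suc k) f"
  unfolding Ck.simps using assms by (intro exI[of _ g] conjI allI)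

lemma Ck_const: "Ck k (\<lambda>x::real^'n. c)"
proof (induction k arbitrary: c)
  case (Suc k)
  show ?case by (rule Ck_SucI[where g = "\<lambda>x. 0"]) (use Suc in \<open>simp_all only: inner_zero_left zero_index has_derivative_const\<close>)
qed simp

lemma Ck_component: "Ck k (\<lambda>x::real^'n. x $ j)"
proof (cases k)
  case (Suc k')
  have "((\<lambda>x::real^'n. x $ j) has_derivative (\<lambda>h. axis j 1 \<bullet> h)) (at x)" for x
    by (simp add: inner_axis' bounded_linear_imp_has_derivative bounded_linear_vec_nth)
  then show ?thesis unfolding Suc by (rule Ck_SucI) (rule Ck_const)
qed (auto intro!: continuous_intros)

text \<open>Needed for the product rule, whose derivative contains the factors
  undifferentiated.\<close>

lemma Ck_SucD: "Ck (Suc k) f \<Longrightarrow> Ck k f"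
proof (induction k arbitrary: f)
  case 0
  then obtain g where "\<And>x. (f has_derivative (\<lambda>h. g x \<bullet> h)) (at x)" by auto
  then show ?case unfolding Ck.simps
    by (intro has_derivative_continuous_on[OF has_derivative_at_withinI])
next
  case (Suc k)
  then obtain g where g: "\<And>x. (f has_derivative (\<lambda>h. g x \<bullet> h)) (at x)" "\<And>j. Ck (Suc k) (\<lambda>x. g x $ j)"
    unfolding Ck.simps(2)[of "Suc k"] by blast
  show ?case by (rule Ck_SucI[OF g(1) Suc.IH[OF g(2)]])
qed

lemma Ck_add: "Ck k f \<Longrightarrow> Ck k g \<Longrightarrow> Ck k (\<lambda>x. f x + g x)"
proof (induction k arbitrary: f g)
  case (Suc k)
  obtain f' g' where d: "\<And>x. (f has_derivative (\<lambda>h. f' x \<bullet> h)) (at x)" "\<And>j. Ck k (\<lambda>x. f' x $ j)"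
     "\<And>x. (g has_derivative (\<lambda>h. g' x \<bullet> h)) (at x)" "\<And>j. Ck k (\<lambda>x. g' x $ j)"
    using Suc.prems unfolding Ck.simps(2) by blast
  show ?case
  proof (rule Ck_SucI)
    show "((\<lambda>x. f x + g x) has_derivative (\<lambda>h. (f' x + g' x) \<bullet> h)) (at x)" for x
      unfolding inner_add_left by (rule has_derivative_add[OF d(1,3)])
    show "Ck k (\<lambda>x. (f' x + g' x) $ j)" for j
      unfolding vector_add_component by (rule Suc.IH[OF d(2,4)])
  qed
qed (auto intro!: continuous_intros)

lemma Ck_mult: "Ck k f \<Longrightarrow> Ck k g \<Longrightarrow> Ck k (\<lambda>x. f x * g x)"
proof (induction k arbitrary: f g)
  case (Suc k)
  obtain f' g' where d: "\<And>x. (f has_derivative (\<lambda>h. f' x \<bullet> h)) (at x)" "\<And>j. Ck k (\<lambda>x. f' x $ j)"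
     "\<And>x. (g has_derivative (\<lambda>h. g' x \<bullet> h)) (at x)" "\<And>j. Ck k (\<lambda>x. g' x $ j)"
    using Suc.prems unfolding Ck.simps(2) by blast
  have "((\<lambda>x. f x * g x) has_derivative (\<lambda>h. (f x *\<^sub>R g' x + g x *\<^sub>R f' x) \<bullet> h)) (at x)" for x
    by (rule has_derivative_eq_rhs[OF has_derivative_mult[OF d(1) d(3)]])
       (auto simp: inner_add_left algebra_simps)
  moreover have "Ck k (\<lambda>x. (f x *\<^sub>R g' x + g x *\<^sub>R f' x) $ j)" for j
    using Suc.IH[OF Ck_SucD[OF Suc.prems(1)] d(4)] Suc.IH[OF Ck_SucD[OF Suc.prems(2)] d(2)]
    by (auto intro: Ck_add)
  ultimately show ?case by (rule Ck_SucI)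
qed (auto intro!: continuous_intros)

section \<open>Flat exponentials and smooth bump functions\<close>

text \<open>The powers of 1 / s are included because differentiating exp (- 1 / s) produces them:
  the span of the family over m is closed under differentiation, which makes smoothness an
  induction.\<close>

definition flat_exp :: "nat \<Rightarrow> real \<Rightarrow> real" where
  "flat_exp m s = (if s > 0 then exp (- 1 / s) / s ^ m else 0)"

lemma flat_exp_tendsto_0: "(flat_exp m \<longlongrightarrow> 0) (at 0)"
proof (rule filterlim_split_at_real)
  have "eventually (\<lambda>s::real. s < 0) (at_left 0)" by (simp add: eventually_at_filter)
  then have "eventually (\<lambda>s. flat_exp m s = 0) (at_left 0)"
    by eventually_elim (simp add: flat_exp_def)
  then show "(flat_exp m \<longlongrightarrow> 0) (at_left 0)" by (rule tendsto_eventually)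
  have "((\<lambda>s. (inverse s) ^ m / exp (inverse s)) \<longlongrightarrow> 0) (at_right (0::real))"
    by (rule filterlim_compose[OF tendsto_power_div_exp_0 filterlim_inverse_at_top_right])
  moreover have "eventually (\<lambda>s. (inverse s) ^ m / exp (inverse s) = flat_exp m s) (at_right (0::real))"
    using eventually_at_right_less[of 0]
    by eventually_elim (simp add: flat_exp_def exp_minus field_simps)
  ultimately show "(flat_exp m \<longlongrightarrow> 0) (at_right 0)" by (simp add: tendsto_cong)
qed

lemma flat_exp_has_derivative:
  "(flat_exp m has_field_derivative (flat_exp (m + 2) s - real m * flat_exp (m + 1) s)) (at s)"
proof -
  consider "s < 0" | "s = 0" | "s > 0" by linarith
  then show ?thesis
  proof cases
    case 1
    have "(flat_exp m has_field_derivative 0) (at s)"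
      by (rule DERIV_cong_ev[THEN iffD2, OF refl _ refl, of _ "\<lambda>_. 0"])
        (use 1 in \<open>auto intro!: eventually_mono[OF order_tendstoD(2)[OF tendsto_ident_at 1]] simp: flat_exp_def eventually_nhds intro: exI[of _ "{..<0}"]\<close>)
    then show ?thesis using 1 by (simp add: flat_exp_def)
  next
    case 2
    \<comment> \<open>At 0 the difference quotient of \<open>flat_exp m\<close> is
      \<open>flat_exp (Suc m)\<close> itself, which has already been shown to tend to 0.\<close>
    have "((\<lambda>h. (flat_exp m (0 + h) - flat_exp m 0) / h) \<longlongrightarrow> 0) (at 0)"
    proof (rule Lim_transform_eventually[OF flat_exp_tendsto_0[of "Suc m"]])
      show "eventually (\<lambda>h. flat_exp (Suc m) h = (flat_exp m (0 + h) - flat_exp m 0) / h) (at 0)"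
        by (auto simp: flat_exp_def eventually_at_filter)
    qed
    then show ?thesis using 2 by (simp add: DERIV_def flat_exp_def)
  next
    case 3
    have "((\<lambda>s. exp (- 1 / s) / s ^ m) has_field_derivative 
       (exp (- 1 / s) / s ^ (m + 2) - real m * (exp (- 1 / s) / s ^ (m + 1)))) (at s)"
    proof (cases m)
      case 0
      then show ?thesis using 3 by (auto intro!: derivative_eq_intros simp: power2_eq_square)
    next
      case (Suc k)
      have pw: "((\<lambda>s. s ^ m) has_field_derivative (real m * s ^ k)) (at s)"
        using DERIV_pow[of m s UNIV] Suc by simp
      have ex: "((\<lambda>s. exp (- 1 / s)) has_field_derivative (exp (- 1 / s) * (1 / (s * s)))) (at s)"
        using 3 by (auto intro!: derivative_eq_intros simp: power2_eq_square)
      have alg: "(E * (1 / (s * s)) * (s * P) - E * (M * P)) / ((s * P) * (s * P))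
         = E / (s * P * (s * s)) - M * (E / (s * P * s))" if "P > 0" for E P M :: real
        using 3 that by (simp add: field_simps)
      show ?thesis
        by (rule DERIV_cong[OF DERIV_divide[OF ex pw]])
           (use 3 alg[of "s ^ k" "exp (- 1 / s)" "real m"] in \<open>auto simp: Suc mult_ac\<close>)
    qed
    moreover have "eventually (\<lambda>s. flat_exp m s = exp (- 1 / s) / s ^ m) (nhds s)"
      using 3 by (auto simp: flat_exp_def eventually_nhds intro!: exI[of _ "{0<..}"])
    ultimately show ?thesis using 3 
      by (subst DERIV_cong_ev[OF refl _ refl]) (auto simp: flat_exp_def)
  qed
qed

text \<open>Induction on k for all m at once, since each derivative raises m. The centre x and the
  variable z are both kept so that reflected translates of the bump, the later test functions, are
  smooth without a composition rule for \<open>Ck\<close>.\<close>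

lemma Ck_flat_exp_ball: "Ck k (\<lambda>z::real^'n. flat_exp m (r - (norm (x - z))\<^sup>2))"
proof (induction k arbitrary: m)
  case 0
  have "continuous_on UNIV (flat_exp m)"
    by (rule DERIV_continuous_on[OF flat_exp_has_derivative])
  then have "continuous_on UNIV (flat_exp m \<circ> (\<lambda>z::real^'n. r - (norm (x - z))\<^sup>2))"
    by (intro continuous_on_compose continuous_intros) (auto intro: continuous_on_subset)
  then show ?case by (simp add: o_def)
next
  case (Suc k)
  let ?\<rho> = "\<lambda>z::real^'n. r - (norm (x - z))\<^sup>2"
  let ?g = "\<lambda>z. (2 * (flat_exp (m + 2) (?\<rho> z) - real m * flat_exp (m + 1) (?\<rho> z))) *\<^sub>R (x - z)"
  have "((\<lambda>z. flat_exp m (?\<rho> z)) has_derivative (\<lambda>h. ?g z \<bullet> h)) (at z)" for z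
  proof -
    have "(?\<rho> has_derivative (\<lambda>h. 2 * ((x - z) \<bullet> h))) (at z)"
      unfolding power2_norm_eq_inner
      by (auto intro!: derivative_eq_intros simp: inner_commute algebra_simps)
    then have "((\<lambda>z. flat_exp m (?\<rho> z)) has_derivative 
        (\<lambda>h. 2 * ((x - z) \<bullet> h) *\<^sub>R (flat_exp (m + 2) (?\<rho> z) - real m * flat_exp (m + 1) (?\<rho> z)))) (at z)"
      by (rule has_derivative_compose[OF _ flat_exp_has_derivative[unfolded has_field_derivative_def], THEN has_derivative_eq_rhs])
         (auto simp: mult_ac)
    then show ?thesis by (rule has_derivative_eq_rhs) (auto simp: mult_ac)
  qed
  moreover have "Ck k (\<lambda>z. ?g z $ j)" for j
  proof -
    have eq: "(\<lambda>z. ?g z $ j) = (\<lambda>z. (2 * flat_exp (m + 2) (?\<rho> z) + (- 2 * real m) * flat_exp (m + 1) (?\<rho> z)) * (x $ j + (- 1) * z $ j))"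
      by (auto simp: fun_eq_iff algebra_simps)
    show ?thesis unfolding eq by (intro Ck_mult Ck_add Ck_const Ck_component Suc)
  qed
  ultimately show ?case by (rule Ck_SucI)
qed

text \<open>The gradient is continuous and vanishes off a ball, hence is bounded, and the mean value
  inequality applies. The radius \<open>max R 0\<close> keeps the ball nonempty when
  \<open>R\<close> is negative.\<close>

lemma Ck_compact_support_Lipschitz:
  fixes f :: "real^'n \<Rightarrow> real"
  assumes "Ck 1 f" and supp: "\<And>x. norm x > R \<Longrightarrow> f x = 0"
  shows "\<exists>L\<ge>0. \<forall>x y. \<bar>f x - f y\<bar> \<le> L * norm (x - y)"
proof -
  obtain g where g: "\<And>x. (f has_derivative (\<lambda>h. g x \<bullet> h)) (at x)" and "\<And>j. continuous_on UNIV (\<lambda>x. g x $ j)"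
    using assms(1) by auto
  then have "continuous_on UNIV (\<lambda>x. \<chi> j. g x $ j)" by (intro continuous_on_vec_lambda)
  then have cg: "continuous_on UNIV g" by simp
  then have "bounded (g ` cball 0 (max R 0))"
    by (intro compact_imp_bounded compact_continuous_image continuous_on_subset[OF cg]) auto
  then obtain B where "\<forall>x\<in>g ` cball 0 (max R 0). norm x \<le> B" unfolding bounded_iff by blast
  then have B: "\<And>x. norm x \<le> max R 0 \<Longrightarrow> norm (g x) \<le> B" by simp
  have B0: "B \<ge> 0" using order_trans[OF norm_ge_zero B[of 0]] by simp
  have gB: "norm (g x) \<le> B" for x
  proof (cases "norm x \<le> max R 0")
    case False
    have "(f has_derivative (\<lambda>h. 0)) (at x)"
    proof (rule has_derivative_transform_within_open[of "\<lambda>_. 0" _ _ _ "- cball 0 (max R 0)"])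
      show "x \<in> - cball 0 (max R 0)" using False by auto
    qed (use supp in auto)
    then have "(\<lambda>h. g x \<bullet> h) = (\<lambda>h. 0)" using has_derivative_unique[OF g[of x]] by blast
    then have "g x \<bullet> g x = 0" by metis
    then show ?thesis using B0 by simp
  qed (use B in auto)
  have "norm (f x - f y) \<le> B * norm (x - y)" for x y
  proof (rule differentiable_bound[of UNIV f "\<lambda>x h. g x \<bullet> h"])
    show "onorm (\<lambda>h. g x \<bullet> h) \<le> B" for x
    proof (rule onorm_bound[OF B0])
      show "norm (g x \<bullet> h) \<le> B * norm h" for h
        using Cauchy_Schwarz_ineq2[of "g x" h] mult_right_mono[OF gB[of x], of "norm h"] by auto
    qed
  qed (use g in auto)
  then show ?thesis using B0 by auto
qed

text \<open>Mean value inequality for w \<mapsto> f w - g x \<bullet> w, whose gradient g w - g x is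
  at most L * |y - x| on the segment. Taking the supremum over the segment gives the constant L in
  place of L / 2.\<close>

lemma taylor_of_Lipschitz_gradient:
  fixes f :: "real^'n \<Rightarrow> real"
  assumes f: "\<And>x. (f has_derivative (\<lambda>h. g x \<bullet> h)) (at x)" and L: "\<And>x y. norm (g x - g y) \<le> L * norm (x - y)"
  shows "\<bar>f y - f x - g x \<bullet> (y - x)\<bar> \<le> L * (norm (y - x))\<^sup>2"
proof (cases "x = y")
  case False
  have L0: "L \<ge> 0"
  proof -
    have "0 \<le> L * norm (x - y)" using L[of x y] norm_ge_zero[of "g x - g y"] by linarith
    then show ?thesis using False by (simp add: zero_le_mult_iff)
  qed
  have "norm ((f y - g x \<bullet> y) - (f x - g x \<bullet> x)) \<le> (L * norm (y - x)) * norm (y - x)"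
  proof (rule differentiable_bound[of "closed_segment x y" "\<lambda>w. f w - g x \<bullet> w" "\<lambda>w h. g w \<bullet> h - g x \<bullet> h"])
    show "((\<lambda>w. f w - g x \<bullet> w) has_derivative (\<lambda>h. g w \<bullet> h - g x \<bullet> h)) (at w within closed_segment x y)" for w
      by (auto intro!: derivative_eq_intros has_derivative_at_withinI[OF f])
    show "onorm (\<lambda>h. g w \<bullet> h - g x \<bullet> h) \<le> L * norm (y - x)" if w: "w \<in> closed_segment x y" for w
    proof (rule onorm_bound)
      fix h
      have "norm (g w \<bullet> h - g x \<bullet> h) \<le> norm (g w - g x) * norm h"
        using Cauchy_Schwarz_ineq2[of "g w - g x" h] by (simp add: inner_diff_left)
      also have "norm (g w - g x) \<le> L * norm (w - x)" by (rule L)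
      also have "\<dots> \<le> L * norm (y - x)" using L0 segment_bound(1)[OF w] by (intro mult_left_mono) auto
      finally show "norm (g w \<bullet> h - g x \<bullet> h) \<le> L * norm (y - x) * norm h" by (simp add: mult_right_mono)
    qed (use L0 in auto)
  qed auto
  then show ?thesis by (simp add: inner_diff_right power2_eq_square algebra_simps)
qed simp

text \<open>The Lipschitz bound on the gradient gives every convolution the quadratic Taylor bound
  of \<open>poincare_C11\<close>. Smoothness is required of the reflected translates because these
  are the functions inserted into the definition of the weak gradient.\<close>

locale mollifier =
  fixes r L :: real and \<phi> :: "real^'n \<Rightarrow> real" and d\<phi> :: "real^'n \<Rightarrow> real^'n"
  assumes r: "r > 0" and nonneg: "\<phi> x \<ge> 0" and support: "norm x \<ge> r \<Longrightarrow> \<phi> x = 0"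
    and integral: "(LINT x|lborel. \<phi> x) = 1"
    and smooth: "smooth (\<lambda>z. \<phi> (x - z))"
    and deriv: "(\<phi> has_derivative (\<lambda>h. d\<phi> x \<bullet> h)) (at x)"
    and support_deriv: "norm x > r \<Longrightarrow> d\<phi> x = 0"
    and L: "L \<ge> 0"
    and Lipschitz: "\<bar>\<phi> x - \<phi> y\<bar> \<le> L * norm (x - y)" "norm (d\<phi> x - d\<phi> y) \<le> L * norm (x - y)"

text \<open>The kernel is the bump exp (- 1 / (r^2 - |z|^2)) divided by its integral.
  \<open>L\<close> adds the Lipschitz constants of the kernel and of all components of its gradient,
  so that one number serves both bounds.\<close>

lemma ex_mollifier:
  assumes r: "r > 0"
  shows "\<exists>L (\<phi> :: real^'n \<Rightarrow> real) d\<phi>. mollifier r L \<phi> d\<phi>"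
proof -
  define f :: "real^'n \<Rightarrow> real" where "f z = flat_exp 0 (r\<^sup>2 - (norm z)\<^sup>2)" for z
  have Ckf: "Ck k f" for k
    using Ck_flat_exp_ball[of k 0 "r\<^sup>2" "0::real^'n"] by (simp add: f_def[abs_def])
  have f0: "f z = 0" if "norm z \<ge> r" for z
  proof -
    have "r\<^sup>2 \<le> (norm z)\<^sup>2" using that r by (intro power_mono) auto
    then show ?thesis by (simp add: f_def flat_exp_def)
  qed
  have fpos: "f z > 0" if "norm z < r" for z
  proof -
    have "(norm z)\<^sup>2 < r\<^sup>2" using that r by (intro power_strict_mono) auto
    then show ?thesis by (simp add: f_def flat_exp_def)
  qed
  have fnn: "f z \<ge> 0" for z using f0[of z] fpos[of z] by (cases "norm z < r") auto
  have cf: "continuous_on UNIV f" using Ckf[of 0] by simp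
  have [measurable]: "f \<in> borel_measurable borel" using cf by (rule borel_measurable_continuous_onI)
  have "integrable lborel (\<lambda>x. indicator (cball 0 r) x *\<^sub>R f x)"
    by (intro borel_integrable_compact continuous_on_subset[OF cf]) auto
  moreover have "(\<lambda>x. indicator (cball 0 r) x *\<^sub>R f x) = f"
    using f0 by (auto simp: fun_eq_iff indicator_def)
  ultimately have int: "integrable lborel f" by simp
  define I where "I = (LINT x|lborel. f x)"
  have "I \<noteq> 0"
  proof
    assume "I = 0"
    then have "AE x in lborel. f x = 0" unfolding I_def
      using integral_nonneg_eq_0_iff_AE[OF int] fnn by auto
    then have "AE x in lborel. x \<notin> ball (0::real^'n) r"
    proof eventually_elim
      case (elim x)
      then show ?case using fpos[of x] by auto
    qed
    then have "ball 0 r \<in> null_sets (lborel :: (real^'n) measure)"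
      by (subst AE_iff_null_sets) auto
    then have "negligible (ball (0::real^'n) r)"
      unfolding negligible_iff_null_sets by (rule null_sets_completionI)
    then show False using r open_not_negligible[of "ball (0::real^'n) r"] by simp
  qed
  moreover have "I \<ge> 0" unfolding I_def using fnn by simp
  ultimately have I: "I > 0" by simp
  define \<phi> where "\<phi> x = (1 / I) * f x" for x
  have Ck\<phi>: "Ck k \<phi>" for k unfolding \<phi>_def by (intro Ck_mult Ck_const Ckf)
  obtain d\<phi> where d: "\<And>x. (\<phi> has_derivative (\<lambda>h. d\<phi> x \<bullet> h)) (at x)" and dC: "\<And>j. Ck 1 (\<lambda>x. d\<phi> x $ j)"
    using Ck\<phi>[of 2] unfolding numeral_2_eq_2 Ck.simps(2)[of 1, unfolded One_nat_def] One_nat_def by blast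
  have d0: "d\<phi> x = 0" if "norm x > r" for x
  proof -
    have "(\<phi> has_derivative (\<lambda>h. 0)) (at x)"
    proof (rule has_derivative_transform_within_open[of "\<lambda>_. 0" _ _ _ "- cball 0 r"])
      show "x \<in> - cball 0 r" using that by auto
    qed (auto simp: \<phi>_def f0)
    then have "(\<lambda>h. d\<phi> x \<bullet> h) = (\<lambda>h. 0)" using has_derivative_unique[OF d[of x]] by blast
    then have "d\<phi> x \<bullet> d\<phi> x = 0" by metis
    then show ?thesis by simp
  qed
  have "\<exists>L\<ge>0. \<forall>x y. \<bar>\<phi> x - \<phi> y\<bar> \<le> L * norm (x - y)"
    using Ck_compact_support_Lipschitz[OF Ck\<phi>[of 1], of r] f0 by (simp add: \<phi>_def)
  then obtain L0 where L0: "L0 \<ge> 0" "\<And>x y. \<bar>\<phi> x - \<phi> y\<bar> \<le> L0 * norm (x - y)" by blast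
  have "\<exists>L\<ge>0. \<forall>x y. \<bar>d\<phi> x $ j - d\<phi> y $ j\<bar> \<le> L * norm (x - y)" for j
    using Ck_compact_support_Lipschitz[OF dC, of r] d0 by simp
  then obtain L1 where L1: "\<And>j. L1 j \<ge> 0" "\<And>j x y. \<bar>d\<phi> x $ j - d\<phi> y $ j\<bar> \<le> L1 j * norm (x - y)"
    by metis
  define L where "L = L0 + (\<Sum>j\<in>UNIV. L1 j)"
  have s0: "(\<Sum>j\<in>UNIV. L1 j) \<ge> 0" using L1 by (intro sum_nonneg)
  have "mollifier r L \<phi> d\<phi>"
  proof
    show "r > 0" by fact
    show "\<phi> x \<ge> 0" for x using fnn I by (simp add: \<phi>_def)
    show "\<phi> x = 0" if "norm x \<ge> r" for x using f0[OF that] by (simp add: \<phi>_def)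
    show "(LINT x|lborel. \<phi> x) = 1" using I int by (simp add: \<phi>_def I_def)
    show "smooth (\<lambda>z. \<phi> (x - z))" for x
      unfolding smooth_def \<phi>_def f_def by (intro allI Ck_mult Ck_const Ck_flat_exp_ball)
    show "(\<phi> has_derivative (\<lambda>h. d\<phi> x \<bullet> h)) (at x)" for x by (rule d)
    show "d\<phi> x = 0" if "norm x > r" for x by (rule d0[OF that])
    show "L \<ge> 0" using L0 s0 by (simp add: L_def)
    show "\<bar>\<phi> x - \<phi> y\<bar> \<le> L * norm (x - y)" for x y
      using L0(2)[of x y] mult_right_mono[of L0 L "norm (x - y)"] s0 by (simp add: L_def)
    show "norm (d\<phi> x - d\<phi> y) \<le> L * norm (x - y)" for x y
    proof -
      have "norm (d\<phi> x - d\<phi> y) \<le> (\<Sum>j\<in>UNIV. \<bar>(d\<phi> x - d\<phi> y) $ j\<bar>)" by (rule norm_le_l1_cart)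
      also have "\<dots> \<le> (\<Sum>j\<in>UNIV. L1 j * norm (x - y))" using L1(2) by (intro sum_mono) simp
      also have "\<dots> \<le> L * norm (x - y)"
        unfolding L_def sum_distrib_right[symmetric] using L0(1) by (intro mult_right_mono) auto
      finally show ?thesis .
    qed
  qed
  then show ?thesis by blast
qed

section \<open>Convolution with a mollifier\<close>

lemma lborel_reflect_translate:
  fixes x :: "'a::euclidean_space"
  shows "distr lborel borel (\<lambda>z. x - z) = lborel"
  using lborel_affine[of "-1" x] by (simp add: density_1)

lemma lborel_translate_diff:
  fixes x :: "'a::euclidean_space"
  shows "distr lborel borel (\<lambda>z. z - x) = lborel"
proof -
  have "(\<lambda>z. z - x) = (+) (- x)" by auto
  then show ?thesis by (simp only: lborel_distr_plus)
qed

lemma integrable_lborel_reflect_translate: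
  fixes f :: "'a::euclidean_space \<Rightarrow> real"
  assumes "integrable lborel f"
  shows "integrable lborel (\<lambda>z. f (x - z))"
proof -
  have "integrable (distr lborel borel (\<lambda>z. x - z)) f" using assms by (simp add: lborel_reflect_translate)
  then show ?thesis by (subst (asm) integrable_distr_eq) (use assms in auto)
qed

lemma integrable_lborel_translate_diff:
  fixes f :: "'a::euclidean_space \<Rightarrow> real"
  assumes "integrable lborel f"
  shows "integrable lborel (\<lambda>z. f (z - x))"
proof -
  have "integrable (distr lborel borel (\<lambda>z. z - x)) f" using assms by (simp add: lborel_translate_diff)
  then show ?thesis by (subst (asm) integrable_distr_eq) (use assms in auto)
qed

lemma integral_lborel_reflect_translate:
  fixes f :: "'a::euclidean_space \<Rightarrow> real"
  assumes [measurable]: "f \<in> borel_measurable borel"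
  shows "(LINT z|lborel. f (x - z)) = (LINT z|lborel. f z)"
proof -
  have "integral\<^sup>L (distr lborel borel (\<lambda>z. x - z)) f = (LINT z|lborel. f (x - z))"
    by (rule integral_distr) auto
  then show ?thesis by (simp add: lborel_reflect_translate)
qed

lemma integral_lborel_translate_diff:
  fixes f :: "'a::euclidean_space \<Rightarrow> real"
  assumes [measurable]: "f \<in> borel_measurable borel"
  shows "(LINT z|lborel. f (z - x)) = (LINT z|lborel. f z)"
proof -
  have "integral\<^sup>L (distr lborel borel (\<lambda>z. z - x)) f = (LINT z|lborel. f (z - x))"
    by (rule integral_distr) auto
  then show ?thesis by (simp add: lborel_translate_diff)
qed

definition conv :: "(real^'n \<Rightarrow> real) \<Rightarrow> (real^'n \<Rightarrow> real) \<Rightarrow> real^'n \<Rightarrow> real" where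
  "conv P k x = (LINT z|lborel. P z * k (x - z))"

lemma integrable_mult_bounded_kernel:
  fixes P k :: "real^'n \<Rightarrow> real"
  assumes P: "integrable lborel P" and [measurable]: "k \<in> borel_measurable borel" and k: "\<And>x. \<bar>k x\<bar> \<le> B"
  shows "integrable lborel (\<lambda>z. P z * k (x - z))"
proof (rule Bochner_Integration.integrable_bound)
  show "integrable lborel (\<lambda>z. B * P z)" using P by simp
  have "\<bar>P z\<bar> * \<bar>k (x - z)\<bar> \<le> \<bar>P z\<bar> * \<bar>B\<bar>" for z
    using k[of "x - z"] by (intro mult_left_mono) auto
  then show "AE z in lborel. norm (P z * k (x - z)) \<le> norm (B * P z)" by (simp add: abs_mult mult.commute)
qed (use borel_measurable_integrable[OF P] in auto)

lemma conv_Lipschitz: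
  assumes P: "integrable lborel P" and [measurable]: "k \<in> borel_measurable borel" and k: "\<And>x. \<bar>k x\<bar> \<le> B"
    and L: "\<And>x y. \<bar>k x - k y\<bar> \<le> L * norm (x - y)"
  shows "\<bar>conv P k x - conv P k y\<bar> \<le> (LINT z|lborel. \<bar>P z\<bar>) * L * norm (x - y)"
proof -
  note i = integrable_mult_bounded_kernel[OF P assms(2) k]
  have "conv P k x - conv P k y = (LINT z|lborel. P z * k (x - z) - P z * k (y - z))"
    unfolding conv_def using i by (subst Bochner_Integration.integral_diff) auto
  also have "\<bar>\<dots>\<bar> \<le> (LINT z|lborel. \<bar>P z * k (x - z) - P z * k (y - z)\<bar>)" by (rule integral_abs_bound)
  also have "\<dots> \<le> (LINT z|lborel. \<bar>P z\<bar> * (L * norm (x - y)))"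
  proof (rule integral_mono)
    show "\<bar>P z * k (x - z) - P z * k (y - z)\<bar> \<le> \<bar>P z\<bar> * (L * norm (x - y))" for z
      using mult_left_mono[OF L[of "x - z" "y - z"], of "\<bar>P z\<bar>"] by (simp add: abs_mult[symmetric] right_diff_distrib)
  qed (use i P in auto)
  finally show ?thesis by (simp add: mult.assoc)
qed

lemma continuous_on_Lipschitz_abs:
  fixes f :: "'a::real_normed_vector \<Rightarrow> real"
  assumes "\<And>x y. \<bar>f x - f y\<bar> \<le> L * norm (x - y)"
  shows "continuous_on S f"
proof -
  have L: "\<bar>L\<bar>-lipschitz_on UNIV f"
  proof (rule lipschitz_onI)
    show "dist (f x) (f y) \<le> \<bar>L\<bar> * dist x y" for x y
      using order_trans[OF assms mult_right_mono[OF abs_ge_self[of L] norm_ge_zero]] by (simp add: dist_norm)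
  qed simp
  then show ?thesis by (meson lipschitz_on_continuous_on continuous_on_subset subset_UNIV)
qed

context mollifier
begin

lemma ex_far: "\<exists>p::real^'n. norm p = r + 1"
proof (rule exI)
  show "norm ((r + 1) *\<^sub>R axis undefined 1 :: real^'n) = r + 1" using r by (simp add: norm_axis_1)
qed

text \<open>Both functions are Lipschitz and vanish at a point p of norm r + 1, and a point of the
  closed ball of radius r is at distance at most 2 * r + 1 from p.\<close>

lemma bounded: "\<exists>B. \<forall>x. \<bar>\<phi> x\<bar> \<le> B \<and> norm (d\<phi> x) \<le> B"
proof -
  obtain p :: "real^'n" where p: "norm p = r + 1" using ex_far by blast
  have "\<bar>\<phi> x\<bar> \<le> L * (2 * r + 1) \<and> norm (d\<phi> x) \<le> L * (2 * r + 1)" for x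
  proof (cases "norm x > r")
    case True
    then show ?thesis using support[of x] support_deriv[of x] L r by simp
  next
    case False
    have "L * norm (x - p) \<le> L * (2 * r + 1)"
      using False p L norm_triangle_ineq4[of x p] by (intro mult_left_mono) auto
    then show ?thesis using Lipschitz[of x p] support[of p] support_deriv[of p] p by simp
  qed
  then show ?thesis by blast
qed

lemma continuous: "continuous_on S \<phi>"
  by (rule continuous_on_Lipschitz_abs[OF Lipschitz(1)])

lemma Lipschitz_component: "\<bar>d\<phi> x $ j - d\<phi> y $ j\<bar> \<le> L * norm (x - y)"
  using order_trans[OF component_le_norm_cart[of "d\<phi> x - d\<phi> y" j] Lipschitz(2)[of x y]] by simp

lemma continuous_component: "continuous_on S (\<lambda>x. d\<phi> x $ j)"
  by (rule continuous_on_Lipschitz_abs[OF Lipschitz_component])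

lemma measurable [measurable]: "\<phi> \<in> borel_measurable borel" "(\<lambda>x. d\<phi> x $ j) \<in> borel_measurable borel"
  by (intro borel_measurable_continuous_onI continuous continuous_component)+

text \<open>The integral of a nonintegrable function is 0 by convention, so the value 1 forces
  integrability.\<close>

lemma integrable: "integrable lborel \<phi>"
  using integral not_integrable_integral_eq by force

lemma taylor: "\<bar>\<phi> y - \<phi> x - d\<phi> x \<bullet> (y - x)\<bar> \<le> L * (norm (y - x))\<^sup>2"
  by (rule taylor_of_Lipschitz_gradient[OF deriv Lipschitz(2)])

lemma integrable_conv:
  assumes "integrable lborel P"
  shows "integrable lborel (\<lambda>z. P z * \<phi> (x - z))" "integrable lborel (\<lambda>z. P z * d\<phi> (x - z) $ j)"
proof -
  obtain B where B: "\<And>x. \<bar>\<phi> x\<bar> \<le> B" "\<And>x. norm (d\<phi> x) \<le> B" using bounded by blast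
  have "\<bar>d\<phi> x $ j\<bar> \<le> B" for x using order_trans[OF component_le_norm_cart B(2)] .
  then show "integrable lborel (\<lambda>z. P z * \<phi> (x - z))" "integrable lborel (\<lambda>z. P z * d\<phi> (x - z) $ j)"
    using integrable_mult_bounded_kernel[OF assms measurable(1) B(1)] 
      integrable_mult_bounded_kernel[OF assms measurable(2)] by blast+
qed

lemma continuous_conv:
  assumes "integrable lborel P"
  shows "continuous_on UNIV (conv P \<phi>)" "continuous_on UNIV (conv P (\<lambda>x. d\<phi> x $ j))"
proof -
  obtain B where B: "\<And>x. \<bar>\<phi> x\<bar> \<le> B" "\<And>x. norm (d\<phi> x) \<le> B" using bounded by blast
  have B': "\<bar>d\<phi> x $ j\<bar> \<le> B" for x using order_trans[OF component_le_norm_cart B(2)] .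
  show "continuous_on UNIV (conv P \<phi>)"
    by (rule continuous_on_Lipschitz_abs[OF conv_Lipschitz[OF assms measurable(1) B(1) Lipschitz(1)]])
  show "continuous_on UNIV (conv P (\<lambda>x. d\<phi> x $ j))"
    by (rule continuous_on_Lipschitz_abs[OF conv_Lipschitz[OF assms measurable(2) B' Lipschitz_component]])
qed

text \<open>The Taylor bound of the kernel at x - z is integrated against |P z|. This yields the
  hypothesis of \<open>poincare_C11\<close> directly, with no differentiation under the integral
  sign.\<close>

lemma conv_taylor:
  assumes P: "integrable lborel P"
  shows "conv P \<phi> y \<ge> conv P \<phi> x + (\<chi> j. conv P (\<lambda>x. d\<phi> x $ j) x) \<bullet> (y - x) 
     - (LINT z|lborel. \<bar>P z\<bar>) * L * (norm (y - x))\<^sup>2"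
proof -
  note i = integrable_conv[OF P]
  have eq: "(\<chi> j. conv P (\<lambda>x. d\<phi> x $ j) x) \<bullet> (y - x) = (LINT z|lborel. (\<Sum>j\<in>UNIV. P z * d\<phi> (x - z) $ j * (y - x) $ j))"
    using i by (simp add: inner_vec_def conv_def)
  have ig: "integrable lborel (\<lambda>z. \<Sum>j\<in>UNIV. P z * d\<phi> (x - z) $ j * (y - x) $ j)"
    using i by auto
  have "\<bar>conv P \<phi> y - conv P \<phi> x - (\<chi> j. conv P (\<lambda>x. d\<phi> x $ j) x) \<bullet> (y - x)\<bar>
     = \<bar>LINT z|lborel. P z * \<phi> (y - z) - P z * \<phi> (x - z) - (\<Sum>j\<in>UNIV. P z * d\<phi> (x - z) $ j * (y - x) $ j)\<bar>"
    unfolding eq unfolding conv_def using i ig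
    by (subst Bochner_Integration.integral_diff, simp, simp, subst Bochner_Integration.integral_diff) auto
  also have "\<dots> \<le> (LINT z|lborel. \<bar>P z * \<phi> (y - z) - P z * \<phi> (x - z) - (\<Sum>j\<in>UNIV. P z * d\<phi> (x - z) $ j * (y - x) $ j)\<bar>)"
    by (rule integral_abs_bound)
  also have "\<dots> \<le> (LINT z|lborel. \<bar>P z\<bar> * (L * (norm (y - x))\<^sup>2))"
  proof (rule integral_mono)
    show "\<bar>P z * \<phi> (y - z) - P z * \<phi> (x - z) - (\<Sum>j\<in>UNIV. P z * d\<phi> (x - z) $ j * (y - x) $ j)\<bar>
      \<le> \<bar>P z\<bar> * (L * (norm (y - x))\<^sup>2)" for z
    proof -
      have "(\<Sum>j\<in>UNIV. P z * d\<phi> (x - z) $ j * (y - x) $ j) = P z * (d\<phi> (x - z) \<bullet> (y - x))"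
        by (simp add: inner_vec_def sum_distrib_left mult.assoc)
      moreover have "\<bar>\<phi> (y - z) - \<phi> (x - z) - d\<phi> (x - z) \<bullet> (y - x)\<bar> \<le> L * (norm (y - x))\<^sup>2"
        using taylor[of "y - z" "x - z"] by simp
      ultimately show ?thesis 
        using mult_left_mono[of "\<bar>\<phi> (y - z) - \<phi> (x - z) - d\<phi> (x - z) \<bullet> (y - x)\<bar>" _ "\<bar>P z\<bar>"]
        by (simp add: abs_mult[symmetric] right_diff_distrib)
    qed
  qed (use i ig P in auto)
  finally show ?thesis by (simp add: mult.assoc abs_le_iff)
qed

text \<open>Jensen's inequality for the probability density z \<mapsto> \<phi> (x - z), obtained by
  expanding the integral of (P z - a)^2 with a = conv P \<phi> x.\<close>

lemma conv_square_le:
  assumes P: "integrable lborel P" and P2: "integrable lborel (\<lambda>z. (P z)\<^sup>2)"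
  shows "(conv P \<phi> x)\<^sup>2 \<le> conv (\<lambda>z. (P z)\<^sup>2) \<phi> x"
proof -
  define a where "a = conv P \<phi> x"
  note i = integrable_conv(1)[OF P, of x] integrable_conv(1)[OF P2, of x] integrable_lborel_reflect_translate[OF integrable, of x]
  have "0 \<le> (LINT z|lborel. (P z - a)\<^sup>2 * \<phi> (x - z))" using nonneg by simp
  also have "\<dots> = (LINT z|lborel. (P z)\<^sup>2 * \<phi> (x - z) - (2 * a) * (P z * \<phi> (x - z)) + a\<^sup>2 * \<phi> (x - z))"
    by (intro Bochner_Integration.integral_cong) (auto simp: power2_eq_square algebra_simps)
  also have "\<dots> = conv (\<lambda>z. (P z)\<^sup>2) \<phi> x - 2 * a * conv P \<phi> x + a\<^sup>2 * 1"
    unfolding conv_def integral[symmetric] integral_lborel_reflect_translate[OF measurable(1), of x, symmetric]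
    using i by simp
  finally show ?thesis by (simp add: a_def power2_eq_square)
qed

text \<open>The mollification moves from the merely integrable function \<open>P\<close> to the
  bounded weight \<open>w\<close>. Absolute integrability holds with the bound B times the L^1 norm
  of \<open>P\<close>.\<close>

lemma fubini_conv:
  assumes P: "integrable lborel P" and [measurable]: "w \<in> borel_measurable borel" and w: "\<And>x. \<bar>w x\<bar> \<le> B"
  shows "(LINT x|lborel. w x * conv P \<phi> x) = (LINT z|lborel. P z * (LINT x|lborel. w x * \<phi> (x - z)))"
proof -
  have [measurable]: "P \<in> borel_measurable borel" using borel_measurable_integrable[OF P] by simp
  note it = integrable_lborel_translate_diff[OF integrable]
  have iw: "integrable lborel (\<lambda>x. w x * \<phi> (x - z))" for z
  proof (rule Bochner_Integration.integrable_bound)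
    show "integrable lborel (\<lambda>x. B * \<phi> (x - z))" using it by simp
    show "AE x in lborel. norm (w x * \<phi> (x - z)) \<le> norm (B * \<phi> (x - z))"
      using w nonneg by (auto simp: abs_mult intro!: mult_right_mono AE_I2 order_trans[OF w abs_ge_self])
  qed measurable
  define f where "f z x = P z * (w x * \<phi> (x - z))" for z x
  have "integrable (lborel \<Otimes>\<^sub>M lborel) (case_prod f)"
  proof (rule lborel_pair.Fubini_integrable)
    show "case_prod f \<in> borel_measurable (lborel \<Otimes>\<^sub>M lborel)" unfolding f_def by measurable
    show "AE z in lborel. integrable lborel (\<lambda>x. case_prod f (z, x))" using iw by (simp add: f_def)
    show "integrable lborel (\<lambda>z. LINT x|lborel. norm (case_prod f (z, x)))"
    proof (rule Bochner_Integration.integrable_bound)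
      show "integrable lborel (\<lambda>z. B * P z)" using P by simp
      show "AE z in lborel. norm (LINT x|lborel. norm (case_prod f (z, x))) \<le> norm (B * P z)"
      proof (rule AE_I2)
        fix z
        have "(LINT x|lborel. norm (case_prod f (z, x))) \<le> (LINT x|lborel. (\<bar>P z\<bar> * B) * \<phi> (x - z))"
        proof (rule integral_mono)
          show "norm (case_prod f (z, x)) \<le> (\<bar>P z\<bar> * B) * \<phi> (x - z)" for x
            using w[of x] nonneg[of "x - z"] by (auto simp: f_def abs_mult mult.assoc intro!: mult_left_mono mult_right_mono)
        qed (use it iw in \<open>auto simp: f_def\<close>)
        also have "\<dots> = \<bar>P z\<bar> * B" using integral_lborel_translate_diff[OF measurable(1), of z] integral by simp
        finally have "(LINT x|lborel. norm (case_prod f (z, x))) \<le> \<bar>P z\<bar> * B" .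
        moreover have "B \<ge> 0" using order_trans[OF abs_ge_zero w] .
        ultimately show "norm (LINT x|lborel. norm (case_prod f (z, x))) \<le> norm (B * P z)"
          by (simp add: abs_mult mult.commute)
      qed
    qed (unfold f_def, measurable)
  qed
  from lborel_pair.Fubini_integral[OF this]
  have "(LINT x|lborel. LINT z|lborel. f z x) = (LINT z|lborel. LINT x|lborel. f z x)" .
  moreover have "(LINT z|lborel. f z x) = w x * conv P \<phi> x" for x
    unfolding conv_def f_def by (simp add: mult.left_commute flip: integral_mult_right_zero)
  moreover have "(LINT x|lborel. f z x) = P z * (LINT x|lborel. w x * \<phi> (x - z))" for z
    unfolding f_def by simp
  ultimately show ?thesis by simp
qed

end

text \<open>After Fubini the averages \<open>W n\<close> of the weight are bounded by
  \<open>B\<close> and converge at every continuity point of \<open>w\<close>, so dominated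
  convergence with dominating function B * |P z| applies. Continuity almost everywhere is the form
  needed for a weight that jumps across the boundary of \<open>K\<close>.\<close>

lemma mollified_integral_tendsto:
  fixes P w :: "real^'n \<Rightarrow> real"
  assumes m: "\<And>n. mollifier (r n) (L n) (\<phi> n) (d\<phi> n)" and r: "r \<longlonglongrightarrow> 0"
    and P: "integrable lborel P" and [measurable]: "w \<in> borel_measurable borel" and w: "\<And>x. \<bar>w x\<bar> \<le> B"
    and cont: "AE z in lborel. isCont w z"
  shows "(\<lambda>n. LINT x|lborel. w x * conv P (\<phi> n) x) \<longlonglongrightarrow> (LINT z|lborel. w z * P z)"
proof -
  have [measurable]: "P \<in> borel_measurable borel" using borel_measurable_integrable[OF P] by simp
  have [measurable]: "\<phi> n \<in> borel_measurable borel" for n by (rule mollifier.measurable(1)[OF m])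
  have it: "integrable lborel (\<lambda>x. \<phi> n (x - z))" for n z
    by (rule integrable_lborel_translate_diff[OF mollifier.integrable[OF m]])
  have i1: "(LINT x|lborel. \<phi> n (x - z)) = 1" for n z
    using integral_lborel_translate_diff[of "\<phi> n" z] mollifier.integral[OF m] by simp
  have nn: "\<phi> n x \<ge> 0" for n x by (rule mollifier.nonneg[OF m])
  have iw: "integrable lborel (\<lambda>x. w x * \<phi> n (x - z))" for n z
  proof (rule Bochner_Integration.integrable_bound)
    show "integrable lborel (\<lambda>x. B * \<phi> n (x - z))" using it by simp
    show "AE x in lborel. norm (w x * \<phi> n (x - z)) \<le> norm (B * \<phi> n (x - z))"
      using w nn by (auto simp: abs_mult intro!: mult_right_mono AE_I2 order_trans[OF w abs_ge_self])
  qed measurable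
  define W where "W n z = (LINT x|lborel. w x * \<phi> n (x - z))" for n z
  have WB: "\<bar>W n z\<bar> \<le> B" for n z
  proof -
    have "\<bar>W n z\<bar> \<le> (LINT x|lborel. \<bar>w x * \<phi> n (x - z)\<bar>)" unfolding W_def by (rule integral_abs_bound)
    also have "\<dots> \<le> (LINT x|lborel. B * \<phi> n (x - z))"
    proof (rule integral_mono)
      show "integrable lborel (\<lambda>x. \<bar>w x * \<phi> n (x - z)\<bar>)" using iw by simp
    qed (use it w nn in \<open>auto simp: abs_mult intro!: mult_right_mono\<close>)
    finally show ?thesis using i1 by simp
  qed
  have Wlim: "(\<lambda>n. W n z) \<longlonglongrightarrow> w z" if c: "isCont w z" for z
  proof (rule LIMSEQ_I)
    fix e :: real assume e: "e > 0"
    then obtain d where d: "d > 0" "\<And>x. dist x z < d \<Longrightarrow> dist (w x) (w z) < e / 2"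
      using c unfolding continuous_at_eps_delta by (metis half_gt_zero)
    obtain N where N: "\<And>n. n \<ge> N \<Longrightarrow> \<bar>r n\<bar> < d" using LIMSEQ_D[OF r d(1)] by auto
    have "norm (W n z - w z) < e" if "n \<ge> N" for n
    proof -
      have "W n z - w z = (LINT x|lborel. w x * \<phi> n (x - z)) - (LINT x|lborel. w z * \<phi> n (x - z))"
        using i1 by (simp add: W_def)
      also have "\<dots> = (LINT x|lborel. w x * \<phi> n (x - z) - w z * \<phi> n (x - z))"
        using iw it by (subst Bochner_Integration.integral_diff) auto
      also have "norm \<dots> \<le> (LINT x|lborel. norm (w x * \<phi> n (x - z) - w z * \<phi> n (x - z)))" by (rule integral_norm_bound)
      also have "\<dots> \<le> (LINT x|lborel. (e / 2) * \<phi> n (x - z))"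
      proof (rule integral_mono)
        show "norm (w x * \<phi> n (x - z) - w z * \<phi> n (x - z)) \<le> (e / 2) * \<phi> n (x - z)" for x
        proof (cases "norm (x - z) \<ge> r n")
          case True
          then show ?thesis using mollifier.support[OF m, of n "x - z"] by simp
        next
          case False
          then have "dist x z < d" using N[OF that] by (simp add: dist_norm)
          then have "\<bar>w x - w z\<bar> \<le> e / 2" using d(2)[of x] by (simp add: dist_real_def)
          then show ?thesis using nn[of n "x - z"] mult_right_mono[of "\<bar>w x - w z\<bar>" "e / 2" "\<phi> n (x - z)"]
            by (simp add: left_diff_distrib[symmetric] abs_mult)
        qed
      qed (use iw it in auto)
      also have "\<dots> = e / 2" using i1 by simp
      finally show ?thesis using e by simp
    qed
    then show "\<exists>no. \<forall>n\<ge>no. norm (W n z - w z) < e" by blast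
  qed
  have [measurable]: "W n \<in> borel_measurable borel" for n unfolding W_def by measurable
  have "(\<lambda>n. LINT z|lborel. P z * W n z) \<longlonglongrightarrow> (LINT z|lborel. P z * w z)"
  proof (rule integral_dominated_convergence[where w = "\<lambda>z. B * \<bar>P z\<bar>"])
    show "AE z in lborel. (\<lambda>n. P z * W n z) \<longlonglongrightarrow> P z * w z"
      using cont by eventually_elim (intro tendsto_intros Wlim)
    show "AE z in lborel. norm (P z * W n z) \<le> B * \<bar>P z\<bar>" for n
      using mult_left_mono[OF WB[of n], of "\<bar>P _\<bar>"] by (auto simp: abs_mult mult.commute intro!: AE_I2)
  qed (use P in auto)
  then show ?thesis
    using mollifier.fubini_conv[OF m P assms(4) w] by (simp add: W_def mult.commute)
qed

section \<open>Variance bounds for weakly differentiable functions\<close>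

text \<open>Nonnegativity of the unnormalised variance, from the integral of (m * f x - a)^2. A
  measure of mass 0 is treated separately because the last step divides by m.\<close>

lemma (in finite_measure) square_integral_le:
  fixes f :: "'a \<Rightarrow> real"
  assumes f: "integrable M f" and f2: "integrable M (\<lambda>x. (f x)\<^sup>2)"
  shows "(LINT x|M. f x)\<^sup>2 \<le> measure M (space M) * (LINT x|M. (f x)\<^sup>2)"
proof (cases "measure M (space M) = 0")
  case True
  then have "emeasure M (space M) = 0" by (simp add: emeasure_eq_measure)
  then have "space M \<in> null_sets M" by auto
  then have "AE x in M. f x = 0" using AE_not_in[of "space M" M] by (auto elim: AE_mp)
  then have "(LINT x|M. f x) = 0" by (rule integral_eq_zero_AE)
  then show ?thesis by (simp add: True)
next
  case False
  define m a where "m = measure M (space M)" and "a = (LINT x|M. f x)"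
  have m: "m > 0" using False by (simp add: m_def zero_less_measure_iff)
  have "0 \<le> (LINT x|M. (m * f x - a)\<^sup>2)" by simp
  also have "\<dots> = (LINT x|M. m\<^sup>2 * (f x)\<^sup>2 - 2 * m * a * f x + a\<^sup>2)"
    by (intro Bochner_Integration.integral_cong) (auto simp: power2_eq_square algebra_simps)
  also have "\<dots> = m\<^sup>2 * (LINT x|M. (f x)\<^sup>2) - 2 * m * a * a + a\<^sup>2 * m"
    using f f2 by (simp add: a_def m_def)
  also have "\<dots> = m * (m * (LINT x|M. (f x)\<^sup>2) - a\<^sup>2)" by (simp add: power2_eq_square algebra_simps)
  finally show ?thesis using m by (simp add: zero_le_mult_iff a_def m_def)
qed

lemma integral_gauss_on:
  fixes f :: "real^'n \<Rightarrow> real"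
  assumes [measurable]: "S \<in> sets borel" "f \<in> borel_measurable borel"
  shows "(LINT x|gauss_on S. f x) = (LINT x|lborel. indicator S x * gauss x * f x)"
  unfolding gauss_on_def by (subst integral_density) (auto simp: less_imp_le[OF gauss_pos])

lemma integrable_gauss_on:
  fixes f :: "real^'n \<Rightarrow> real"
  assumes [measurable]: "S \<in> sets borel" "f \<in> borel_measurable borel"
  shows "integrable (gauss_on S) f \<longleftrightarrow> integrable lborel (\<lambda>x. indicator S x * gauss x * f x)"
  unfolding gauss_on_def by (subst integrable_density) (auto simp: less_imp_le[OF gauss_pos])

lemma integrable_gauss_on_continuous:
  fixes f :: "real^'n \<Rightarrow> real"
  assumes "compact S" "continuous_on UNIV f"
  shows "integrable (gauss_on S) f"
proof -
  have [measurable]: "S \<in> sets borel" using assms by (intro borel_compact)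
  interpret finite_measure "gauss_on S" by (rule finite_measure_gauss_on_compact[OF assms(1)])
  have [measurable]: "f \<in> borel_measurable borel" using assms by (intro borel_measurable_continuous_onI)
  have "bounded (f ` S)"
    by (intro compact_imp_bounded compact_continuous_image continuous_on_subset[OF assms(2)] assms(1)) auto
  then obtain B where "\<forall>x\<in>f ` S. norm x \<le> B" unfolding bounded_iff by blast
  then show ?thesis
    by (intro integrable_const_bound[where B = B]) (auto simp: AE_gauss_on)
qed

text \<open>Writing the variance of the mollified function \<open>H\<close> as a supremum, \<open>Var H \<ge> 2 Cov (H, \<psi>) - Var \<psi>\<close>,
makes the left-hand side linear in \<open>H\<close>, so that the mollification can be moved onto \<open>\<psi>\<close> in the limit and no
strong convergence of \<open>H\<close> is needed.\<close>

lemma variance_dual_bound: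
  fixes K :: "(real^'n) set" and U \<psi> :: "real^'n \<Rightarrow> real" and V :: "real^'n \<Rightarrow> real^'n"
  assumes K: "compact K" "convex K" and U: "integrable lborel U"
    and V: "\<And>j. integrable lborel (\<lambda>z. V z $ j)" "\<And>j. integrable lborel (\<lambda>z. (V z $ j)\<^sup>2)"
    and \<delta>: "\<delta> > 0"
    and weak: "\<And>r L \<phi> d\<phi> x j. mollifier r L \<phi> d\<phi> \<Longrightarrow> r < \<delta> \<Longrightarrow> x \<in> K \<Longrightarrow>
        conv U (\<lambda>x. d\<phi> x $ j) x = conv (\<lambda>z. V z $ j) \<phi> x"
    and \<psi>: "continuous_on UNIV \<psi>"
  defines "M \<equiv> gauss_on K" 
  defines "m \<equiv> measure M (space M)"
  shows "2 * (m * (LINT x|M. U x * \<psi> x) - (LINT x|M. U x) * (LINT x|M. \<psi> x)) 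
      - (m * (LINT x|M. (\<psi> x)\<^sup>2) - (LINT x|M. \<psi> x)\<^sup>2) \<le> m * (\<Sum>j\<in>UNIV. LINT x|M. (V x $ j)\<^sup>2)"
proof -
  have Kb[measurable]: "K \<in> sets borel" using K(1) by (rule borel_compact)
  have \<psi>b[measurable]: "\<psi> \<in> borel_measurable borel" using \<psi> by (rule borel_measurable_continuous_onI)
  have [measurable]: "U \<in> borel_measurable borel" using borel_measurable_integrable[OF U] by simp
  have [measurable]: "(\<lambda>z. V z $ j) \<in> borel_measurable borel" for j
    using borel_measurable_integrable[OF V(1)] by simp
  interpret finite_measure M unfolding M_def by (rule finite_measure_gauss_on_compact[OF K(1)])
  \<comment> \<open>The shift by 2 keeps every radius strictly below \<delta>, including the one for
    n = 0, as \<open>weak\<close> demands.\<close>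
  define r where "r n = \<delta> / (real n + 2)" for n
  have rpos: "r n > 0" for n using \<delta> by (simp add: r_def)
  have rlt: "r n < \<delta>" for n using \<delta> by (simp add: r_def field_simps add_pos_nonneg)
  have rlim: "r \<longlonglongrightarrow> 0" 
    unfolding r_def using LIMSEQ_ignore_initial_segment[OF lim_const_over_n[of \<delta>], of 2] by (simp add: add.commute)
  have "\<exists>L \<phi> d\<phi>. mollifier (r n) L (\<phi> :: real^'n \<Rightarrow> real) d\<phi>" for n by (rule ex_mollifier[OF rpos])
  then obtain L \<phi> d\<phi> where m: "\<And>n. mollifier (r n) (L n) (\<phi> n :: real^'n \<Rightarrow> real) (d\<phi> n)" by metis
  define H where "H n = conv U (\<phi> n)" for n
  define D where "D n x = (\<chi> j. conv U (\<lambda>x. d\<phi> n x $ j) x)" for n x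
  have cH: "continuous_on UNIV (H n)" for n unfolding H_def by (rule mollifier.continuous_conv(1)[OF m U])
  have cD: "continuous_on UNIV (D n)" for n unfolding D_def 
    by (intro continuous_on_vec_lambda mollifier.continuous_conv(2)[OF m U])
  have D_eq: "D n x $ j = conv (\<lambda>z. V z $ j) (\<phi> n) x" if "x \<in> K" for n x j
    using weak[OF m rlt that] by (simp add: D_def)
  define w where "w f x = indicator K x * gauss x * f x" for f :: "real^'n \<Rightarrow> real" and x
  have lim: "(\<lambda>n. LINT x|lborel. w f x * conv P (\<phi> n) x) \<longlonglongrightarrow> (LINT x|lborel. w f x * P x)"
    if f: "continuous_on UNIV f" and P: "integrable lborel P" for f P
  proof -
    have "bounded ((\<lambda>x. gauss x * f x) ` K)"
      by (intro compact_imp_bounded compact_continuous_image continuous_intros continuous_on_subset[OF f] K) auto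
    then obtain B where B: "\<forall>x\<in>(\<lambda>x. gauss x * f x) ` K. norm x \<le> B" unfolding bounded_iff by blast
    show ?thesis
    proof (rule mollified_integral_tendsto[OF m rlim P])
      show "w f \<in> borel_measurable borel"
        unfolding w_def using borel_measurable_continuous_onI[OF f] by measurable
      show "\<bar>w f x\<bar> \<le> max B 0" for x using B by (auto simp: w_def indicator_def le_max_iff_disj)
      \<comment> \<open>The indicator of \<open>K\<close> is discontinuous only on the frontier,
        which is negligible because \<open>K\<close> is convex.\<close>
      have "frontier K \<in> null_sets lebesgue"
        using negligible_convex_frontier[OF K(2)] by (simp add: negligible_iff_null_sets)
      then have "frontier K \<in> null_sets lborel"
        by (simp add: null_sets_completion_iff)
      then have "AE z in lborel. z \<notin> frontier K" by (rule AE_not_in)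
      then show "AE z in lborel. isCont (w f) z"
      proof eventually_elim
        case (elim z)
        have "isCont (indicator K :: real^'n \<Rightarrow> real) z" using elim by (simp add: isCont_indicator)
        moreover have "isCont gauss z" "isCont f z"
          using continuous_on_gauss[of UNIV] f by (auto simp: continuous_on_eq_continuous_at)
        ultimately show ?case unfolding w_def by (intro continuous_intros)
      qed
    qed
  qed
  have int_w: "(LINT x|M. f x * g x) = (LINT x|lborel. w f x * g x)" 
    if "f \<in> borel_measurable borel" "g \<in> borel_measurable borel" for f g :: "real^'n \<Rightarrow> real"
    unfolding M_def w_def using that by (subst integral_gauss_on) (auto simp: mult_ac)
  have Hb[measurable]: "H n \<in> borel_measurable borel" for n using cH by (rule borel_measurable_continuous_onI)
  have iM: "integrable M f" if "continuous_on UNIV f" for f :: "real^'n \<Rightarrow> real"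
    unfolding M_def by (rule integrable_gauss_on_continuous[OF K(1) that])
  have step: "2 * (m * (LINT x|lborel. w \<psi> x * conv U (\<phi> n) x) - (LINT x|lborel. w (\<lambda>_. 1) x * conv U (\<phi> n) x) * (LINT x|M. \<psi> x)) 
      - (m * (LINT x|M. (\<psi> x)\<^sup>2) - (LINT x|M. \<psi> x)\<^sup>2) 
      \<le> m * (\<Sum>j\<in>UNIV. LINT x|lborel. w (\<lambda>_. 1) x * conv (\<lambda>z. (V z $ j)\<^sup>2) (\<phi> n) x)" for n
  proof -
    have i: "integrable M (H n)" "integrable M \<psi>" "integrable M (\<lambda>x. (H n x)\<^sup>2)" "integrable M (\<lambda>x. (\<psi> x)\<^sup>2)"
      "integrable M (\<lambda>x. H n x * \<psi> x)"
      by (intro iM continuous_intros cH \<psi>)+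
    have e1: "(LINT x|M. H n x - \<psi> x) = (LINT x|M. H n x) - (LINT x|M. \<psi> x)" using i by simp
    have "(LINT x|M. (H n x - \<psi> x)\<^sup>2) = (LINT x|M. (H n x)\<^sup>2 - 2 * (H n x * \<psi> x) + (\<psi> x)\<^sup>2)"
      by (intro Bochner_Integration.integral_cong) (auto simp: power2_eq_square algebra_simps)
    then have e2: "(LINT x|M. (H n x - \<psi> x)\<^sup>2) = (LINT x|M. (H n x)\<^sup>2) - 2 * (LINT x|M. H n x * \<psi> x) + (LINT x|M. (\<psi> x)\<^sup>2)"
      using i by simp
    have "(LINT x|M. H n x - \<psi> x)\<^sup>2 \<le> m * (LINT x|M. (H n x - \<psi> x)\<^sup>2)"
      unfolding m_def by (rule square_integral_le) (intro iM continuous_intros cH \<psi>)+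
    then have "2 * (m * (LINT x|M. H n x * \<psi> x) - (LINT x|M. H n x) * (LINT x|M. \<psi> x)) 
      - (m * (LINT x|M. (\<psi> x)\<^sup>2) - (LINT x|M. \<psi> x)\<^sup>2) \<le> m * (LINT x|M. (H n x)\<^sup>2) - (LINT x|M. H n x)\<^sup>2"
      unfolding e1 e2 by (simp add: power2_eq_square algebra_simps)
    also have "\<dots> \<le> m * (LINT x|M. (norm (D n x))\<^sup>2)"
      unfolding m_def M_def
    proof (rule poincare_C11[OF K cH cD])
      show "0 \<le> (LINT z|lborel. \<bar>U z\<bar>) * L n" using mollifier.L[OF m] by simp
      show "H n y \<ge> H n x + D n x \<bullet> (y - x) - (LINT z|lborel. \<bar>U z\<bar>) * L n * (norm (y - x))\<^sup>2" for x y
        unfolding H_def D_def by (rule mollifier.conv_taylor[OF m U])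
    qed
    \<comment> \<open>On \<open>K\<close> the components of \<open>D n\<close> are mollifications of
      \<open>V\<close>, and Jensen bounds their squares by mollifications of the squares. The
      right-hand side thereby becomes linear in mollified functions too, and the same limit lemma
      handles both sides.\<close>
    also have "(LINT x|M. (norm (D n x))\<^sup>2) \<le> (LINT x|M. (\<Sum>j\<in>UNIV. conv (\<lambda>z. (V z $ j)\<^sup>2) (\<phi> n) x))"
    proof (rule integral_mono_AE)
      show "AE x in M. (norm (D n x))\<^sup>2 \<le> (\<Sum>j\<in>UNIV. conv (\<lambda>z. (V z $ j)\<^sup>2) (\<phi> n) x)"
        unfolding M_def AE_gauss_on[OF Kb]
      proof (intro AE_I2 impI)
        fix x assume x: "x \<in> K"
        have "(norm (D n x))\<^sup>2 = (\<Sum>j\<in>UNIV. (conv (\<lambda>z. V z $ j) (\<phi> n) x)\<^sup>2)"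
          unfolding power2_norm_eq_inner inner_vec_def by (simp add: D_eq[OF x] power2_eq_square)
        also have "\<dots> \<le> (\<Sum>j\<in>UNIV. conv (\<lambda>z. (V z $ j)\<^sup>2) (\<phi> n) x)"
          by (intro sum_mono mollifier.conv_square_le[OF m] V)
        finally show "(norm (D n x))\<^sup>2 \<le> (\<Sum>j\<in>UNIV. conv (\<lambda>z. (V z $ j)\<^sup>2) (\<phi> n) x)" .
      qed
    qed (intro iM continuous_intros cD mollifier.continuous_conv(1)[OF m] V)+
    also have "(LINT x|M. (\<Sum>j\<in>UNIV. conv (\<lambda>z. (V z $ j)\<^sup>2) (\<phi> n) x)) 
       = (\<Sum>j\<in>UNIV. LINT x|M. 1 * conv (\<lambda>z. (V z $ j)\<^sup>2) (\<phi> n) x)"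
      by (subst Bochner_Integration.integral_sum) (auto intro!: iM mollifier.continuous_conv(1)[OF m] V)
    also have "\<dots> = (\<Sum>j\<in>UNIV. LINT x|lborel. w (\<lambda>_. 1) x * conv (\<lambda>z. (V z $ j)\<^sup>2) (\<phi> n) x)"
      by (intro sum.cong refl int_w borel_measurable_continuous_onI mollifier.continuous_conv(1)[OF m] V) auto
    also have "(LINT x|M. H n x * \<psi> x) = (LINT x|lborel. w \<psi> x * conv U (\<phi> n) x)"
      using int_w[OF \<psi>b Hb] by (simp add: H_def mult.commute)
    also have "(LINT x|M. H n x) = (LINT x|lborel. w (\<lambda>_. 1) x * conv U (\<phi> n) x)"
      using int_w[OF borel_measurable_const Hb, of 1] by (simp add: H_def)
    finally show ?thesis by (simp add: m_def mult_left_mono)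
  qed
  have "2 * (m * (LINT x|lborel. w \<psi> x * U x) - (LINT x|lborel. w (\<lambda>_. 1) x * U x) * (LINT x|M. \<psi> x)) 
      - (m * (LINT x|M. (\<psi> x)\<^sup>2) - (LINT x|M. \<psi> x)\<^sup>2) 
      \<le> m * (\<Sum>j\<in>UNIV. LINT x|lborel. w (\<lambda>_. 1) x * (V x $ j)\<^sup>2)"
  proof (rule LIMSEQ_le)
    show "(\<lambda>n. 2 * (m * (LINT x|lborel. w \<psi> x * conv U (\<phi> n) x) - (LINT x|lborel. w (\<lambda>_. 1) x * conv U (\<phi> n) x) * (LINT x|M. \<psi> x)) 
      - (m * (LINT x|M. (\<psi> x)\<^sup>2) - (LINT x|M. \<psi> x)\<^sup>2)) \<longlonglongrightarrow> 
      2 * (m * (LINT x|lborel. w \<psi> x * U x) - (LINT x|lborel. w (\<lambda>_. 1) x * U x) * (LINT x|M. \<psi> x)) 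
      - (m * (LINT x|M. (\<psi> x)\<^sup>2) - (LINT x|M. \<psi> x)\<^sup>2)"
      by (intro tendsto_intros lim \<psi> U continuous_on_const)
    show "(\<lambda>n. m * (\<Sum>j\<in>UNIV. LINT x|lborel. w (\<lambda>_. 1) x * conv (\<lambda>z. (V z $ j)\<^sup>2) (\<phi> n) x))
      \<longlonglongrightarrow> m * (\<Sum>j\<in>UNIV. LINT x|lborel. w (\<lambda>_. 1) x * (V x $ j)\<^sup>2)"
      by (intro tendsto_intros lim V continuous_on_const)
  qed (use step in blast)
  then show ?thesis
    using int_w[of \<psi> U] int_w[of "\<lambda>_. 1" U] int_w[of "\<lambda>_. 1" "\<lambda>x. (V x $ _)\<^sup>2"]
    by (simp add: mult.commute)
qed

text \<open>Dominated convergence in each term, with \<open>b\<close> dominating the test functions.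
  It is applied once with \<open>b\<close> constant, to clamped continuous approximations, and once
  with b = U, to remove the clamping.\<close>

lemma tendsto_dual_functional:
  fixes M :: "'a measure" and U b :: "'a \<Rightarrow> real"
  assumes "finite_measure M"
    and U: "U \<in> borel_measurable M" "integrable M (\<lambda>x. (U x)\<^sup>2)"
    and b: "b \<in> borel_measurable M" "integrable M (\<lambda>x. (b x)\<^sup>2)"
    and \<psi>s: "\<And>n. \<psi>s n \<in> borel_measurable M" and \<psi>: "\<psi> \<in> borel_measurable M"
    and lim: "AE x in M. (\<lambda>n. \<psi>s n x) \<longlonglongrightarrow> \<psi> x" and le: "\<And>n x. \<bar>\<psi>s n x\<bar> \<le> \<bar>b x\<bar>"
  defines "m \<equiv> measure M (space M)"
  defines "J \<equiv> \<lambda>\<psi>. 2 * (m * (LINT x|M. U x * \<psi> x) - (LINT x|M. U x) * (LINT x|M. \<psi> x)) 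
      - (m * (LINT x|M. (\<psi> x)\<^sup>2) - (LINT x|M. \<psi> x)\<^sup>2)"
  shows "(\<lambda>n. J (\<psi>s n)) \<longlonglongrightarrow> J \<psi>"
proof -
  interpret finite_measure M by fact
  note [measurable] = U(1) b(1) \<psi>s \<psi>
  have ib: "integrable M b" by (rule square_integrable_imp_integrable[OF b])
  have iUb: "integrable M (\<lambda>x. U x * b x)" 
  proof (rule Bochner_Integration.integrable_bound)
    show "integrable M (\<lambda>x. (U x)\<^sup>2 + (b x)\<^sup>2)" using U b by simp
    have "\<bar>U x * b x\<bar> \<le> (U x)\<^sup>2 + (b x)\<^sup>2" for x
    proof -
      have "2 * \<bar>U x * b x\<bar> \<le> (U x)\<^sup>2 + (b x)\<^sup>2"
        using sum_squares_bound[of "\<bar>U x\<bar>" "\<bar>b x\<bar>"] by (simp add: abs_mult)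
      then show ?thesis using abs_ge_zero[of "U x * b x"] by linarith
    qed
    then show "AE x in M. norm (U x * b x) \<le> norm ((U x)\<^sup>2 + (b x)\<^sup>2)" by simp
  qed measurable
  have 1: "(\<lambda>n. LINT x|M. U x * \<psi>s n x) \<longlonglongrightarrow> (LINT x|M. U x * \<psi> x)"
  proof (rule integral_dominated_convergence[where w = "\<lambda>x. \<bar>U x * b x\<bar>"])
    show "AE x in M. (\<lambda>n. U x * \<psi>s n x) \<longlonglongrightarrow> U x * \<psi> x"
      using lim by eventually_elim (intro tendsto_intros)
    show "integrable M (\<lambda>x. \<bar>U x * b x\<bar>)" using iUb by simp
  qed (use le in \<open>auto simp: abs_mult intro!: mult_left_mono\<close>)
  have 2: "(\<lambda>n. LINT x|M. \<psi>s n x) \<longlonglongrightarrow> (LINT x|M. \<psi> x)"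
    by (rule integral_dominated_convergence[where w = "\<lambda>x. \<bar>b x\<bar>"]) (use ib le lim in auto)
  have 3: "(\<lambda>n. LINT x|M. (\<psi>s n x)\<^sup>2) \<longlonglongrightarrow> (LINT x|M. (\<psi> x)\<^sup>2)"
  proof (rule integral_dominated_convergence[where w = "\<lambda>x. (b x)\<^sup>2"])
    show "AE x in M. (\<lambda>n. (\<psi>s n x)\<^sup>2) \<longlonglongrightarrow> (\<psi> x)\<^sup>2"
      using lim by eventually_elim (intro tendsto_intros)
  qed (use b le in \<open>auto simp: abs_le_square_iff\<close>)
  show ?thesis unfolding J_def by (intro tendsto_intros 1 2 3)
qed

lemma ex_continuous_approximation:
  fixes U :: "real^'n \<Rightarrow> real"
  assumes "U \<in> borel_measurable borel"
  shows "\<exists>g. (\<forall>n. continuous_on UNIV (g n)) \<and> (AE x in lborel. (\<lambda>n. g n x :: real) \<longlonglongrightarrow> U x)"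
proof -
  have "U \<in> borel_measurable lebesgue" using assms by (simp add: measurable_completion)
  then have "U measurable_on UNIV" by (simp add: measurable_on_iff_borel_measurable)
  then obtain N g where N: "negligible N" "\<And>n. continuous_on UNIV (g n)"
    "\<And>x. x \<notin> N \<Longrightarrow> (\<lambda>n. g n x) \<longlonglongrightarrow> U x" unfolding measurable_on_def by auto
  have "AE x in lebesgue. (\<lambda>n. g n x) \<longlonglongrightarrow> U x"
    using N(1,3) by (auto simp: negligible_iff_null_sets intro: AE_I')
  then have "AE x in lborel. (\<lambda>n. g n x) \<longlonglongrightarrow> U x" by (simp add: AE_completion_iff)
  then show ?thesis using N(2) by blast
qed

text \<open>The dual functional \<open>J\<close> takes the variance of \<open>U\<close> as its value
  at \<psi> = U, but the dual bound is known for continuous \<psi> only. Continuous functions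
  converging to \<open>U\<close> almost everywhere need not be dominated, so they are clamped at a
  level c; first the approximation index and then c goes to infinity.\<close>

lemma variance_le_of_weak_gradient:
  fixes K :: "(real^'n) set" and U :: "real^'n \<Rightarrow> real" and V :: "real^'n \<Rightarrow> real^'n"
  assumes K: "compact K" "convex K" and U: "integrable lborel U"
    and V: "\<And>j. integrable lborel (\<lambda>z. V z $ j)" "\<And>j. integrable lborel (\<lambda>z. (V z $ j)\<^sup>2)"
    and \<delta>: "\<delta> > 0"
    and weak: "\<And>r L \<phi> d\<phi> x j. mollifier r L \<phi> d\<phi> \<Longrightarrow> r < \<delta> \<Longrightarrow> x \<in> K \<Longrightarrow>
        conv U (\<lambda>x. d\<phi> x $ j) x = conv (\<lambda>z. V z $ j) \<phi> x"
  defines "M \<equiv> gauss_on K" 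
  assumes U2: "integrable M (\<lambda>x. (U x)\<^sup>2)"
  shows "measure M (space M) * (LINT x|M. (U x)\<^sup>2) - (LINT x|M. U x)\<^sup>2 
    \<le> measure M (space M) * (\<Sum>j\<in>UNIV. LINT x|M. (V x $ j)\<^sup>2)"
proof -
  define m where "m = measure M (space M)"
  define R where "R = m * (\<Sum>j\<in>UNIV. LINT x|M. (V x $ j)\<^sup>2)"
  define J where "J = (\<lambda>\<psi>. 2 * (m * (LINT x|M. U x * \<psi> x) - (LINT x|M. U x) * (LINT x|M. \<psi> x)) 
      - (m * (LINT x|M. (\<psi> x)\<^sup>2) - (LINT x|M. \<psi> x)\<^sup>2))"
  have Kb[measurable]: "K \<in> sets borel" using K(1) by (rule borel_compact)
  have [measurable_cong]: "sets M = sets borel" by (simp add: M_def)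
  interpret finite_measure M unfolding M_def by (rule finite_measure_gauss_on_compact[OF K(1)])
  have Ub[measurable]: "U \<in> borel_measurable borel" using borel_measurable_integrable[OF U] by simp
  have J1: "J \<psi> \<le> R" if "continuous_on UNIV \<psi>" for \<psi>
    unfolding J_def R_def m_def M_def by (rule variance_dual_bound[OF K U V \<delta> weak that])
  define clamp where "clamp c t = max (- c) (min c t)" for c t :: real
  obtain g where g: "\<And>n. continuous_on UNIV (g n)" "AE x in lborel. (\<lambda>n. g n x :: real) \<longlonglongrightarrow> U x"
    using ex_continuous_approximation[OF Ub] by blast
  have [measurable]: "g n \<in> borel_measurable borel" for n using g(1) by (rule borel_measurable_continuous_onI)
  have gM: "AE x in M. (\<lambda>n. g n x :: real) \<longlonglongrightarrow> U x"
    unfolding M_def AE_gauss_on[OF Kb] using g(2) by eventually_elim simp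
  have J2: "J (\<lambda>x. clamp (real c) (U x)) \<le> R" for c :: nat
  proof (rule LIMSEQ_le_const2)
    show "(\<lambda>n. J (\<lambda>x. clamp (real c) (g n x))) \<longlonglongrightarrow> J (\<lambda>x. clamp (real c) (U x))"
      unfolding J_def m_def
    proof (rule tendsto_dual_functional[where b = "\<lambda>_. real c"])
      show "AE x in M. (\<lambda>n. clamp (real c) (g n x)) \<longlonglongrightarrow> clamp (real c) (U x)"
        using gM unfolding clamp_def by eventually_elim (intro tendsto_intros)
    qed (use U2 in \<open>auto simp: clamp_def finite_measure_axioms\<close>)
    show "\<exists>N. \<forall>n\<ge>N. J (\<lambda>x. clamp (real c) (g n x)) \<le> R"
      unfolding clamp_def by (intro exI allI impI J1 continuous_intros g(1))
  qed
  have "J U \<le> R"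
  proof (rule LIMSEQ_le_const2)
    show "(\<lambda>c. J (\<lambda>x. clamp (real c) (U x))) \<longlonglongrightarrow> J U"
      unfolding J_def m_def
    proof (rule tendsto_dual_functional[where b = U])
      show "AE x in M. (\<lambda>c. clamp (real c) (U x)) \<longlonglongrightarrow> U x"
      proof (intro AE_I2 tendsto_eventually)
        fix x
        obtain c0 where "\<bar>U x\<bar> \<le> real c0" using real_arch_simple by blast
        then show "\<forall>\<^sub>F c in sequentially. clamp (real c) (U x) = U x"
          by (intro eventually_sequentiallyI[of c0]) (auto simp: clamp_def)
      qed
    qed (use U2 in \<open>auto simp: clamp_def finite_measure_axioms\<close>)
  qed (use J2 in blast)
  then show ?thesis by (simp add: J_def R_def m_def power2_eq_square)
qed

section \<open>Weak gradients on an open set and their Borel versions\<close>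

text \<open>Sobolev functions are given as Lebesgue measurable functions, while convolution and
  Fubini are carried out on \<open>lborel\<close>; cutting off to \<open>S\<close> turns local
  integrability into integrability.\<close>

lemma ex_borel_version:
  fixes f :: "real^'n \<Rightarrow> real"
  assumes S: "S \<in> sets borel" and f: "set_integrable lebesgue S f"
  shows "\<exists>P. integrable lborel P \<and> (AE z in lebesgue. indicator S z * f z = P z)"
proof -
  have f': "integrable lebesgue (\<lambda>z. indicator S z * f z)" using f by (simp add: set_integrable_def)
  then have "(\<lambda>z. indicator S z * f z) \<in> borel_measurable (completion lborel)" by (rule borel_measurable_integrable)
  then obtain P where P: "P \<in> borel_measurable lborel" "AE z in lborel. indicator S z * f z = P z"
    using completion_ex_borel_measurable_real by blast
  have ae: "AE z in lebesgue. indicator S z * f z = P z" using P(2) by (simp add: AE_completion_iff)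
  have "integrable lebesgue P"
    by (rule integrable_cong_AE_imp[OF f' _ ae]) (use P(1) in \<open>simp add: measurable_completion\<close>)
  then have "integrable lborel P" using P(1) by (simp add: integrable_completion)
  then show ?thesis using ae by blast
qed

lemma test_fun_mollifier:
  assumes m: "mollifier r L \<phi> d\<phi>" and sub: "cball x r \<subseteq> \<Omega>"
  shows "test_fun \<Omega> (\<lambda>z. \<phi> (x - z))"
proof -
  have supp: "{z. \<phi> (x - z) \<noteq> 0} \<subseteq> cball x r"
    using mollifier.support[OF m] by (force simp: dist_norm)
  then have "closure {z. \<phi> (x - z) \<noteq> 0} \<subseteq> cball x r" by (rule closure_minimal) simp
  then show ?thesis unfolding test_fun_def using mollifier.smooth[OF m] sub
    by (auto simp: compact_closure intro: bounded_subset[OF bounded_cball supp])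
qed

text \<open>The test function is z \<mapsto> \<phi> (x - z). The minus sign from its inner
  derivative cancels the one in the definition of the weak gradient. All integrands vanish off the
  closed ball inside \<open>S\<close>, where \<open>U\<close> and \<open>V\<close> agree almost
  everywhere with \<open>u\<close> and the component of \<open>g\<close>.\<close>

lemma weak_gradient_mollifier:
  fixes \<Omega> S :: "(real^'n) set" and u :: "real^'n \<Rightarrow> real"
  assumes wg: "weak_gradient \<Omega> u g" and m: "mollifier r L \<phi> d\<phi>"
    and S: "cball x r \<subseteq> S" "S \<subseteq> \<Omega>"
    and U: "integrable lborel U" "AE z in lebesgue. indicator S z * u z = U z"
    and V: "integrable lborel V" "AE z in lebesgue. indicator S z * g z $ j = V z"
    and um: "set_integrable lebesgue S u" "set_integrable lebesgue S (\<lambda>z. g z $ j)"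
  shows "conv U (\<lambda>x. d\<phi> x $ j) x = conv V \<phi> x"
proof -
  have d: "((\<lambda>z. \<phi> (x - z)) has_derivative (\<lambda>h. - d\<phi> (x - z) \<bullet> h)) (at z)" for z
  proof -
    have "((\<lambda>z. x - z) has_derivative (\<lambda>h. - h)) (at z)" by (auto intro!: derivative_eq_intros)
    then have "((\<lambda>z. \<phi> (x - z)) has_derivative (\<lambda>h. d\<phi> (x - z) \<bullet> (- h))) (at z)"
      by (rule has_derivative_compose[OF _ mollifier.deriv[OF m]])
    then show ?thesis by simp
  qed
  have tf: "test_fun \<Omega> (\<lambda>z. \<phi> (x - z))" using test_fun_mollifier[OF m] S by blast
  have eq: "(LINT z:\<Omega>|lebesgue. u z * (- d\<phi> (x - z)) $ j) = - (LINT z:\<Omega>|lebesgue. g z $ j * \<phi> (x - z))"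
  proof -
    have "\<And>\<phi> d\<phi> j. test_fun \<Omega> \<phi> \<Longrightarrow> (\<And>x. (\<phi> has_derivative (\<lambda>h. d\<phi> x \<bullet> h)) (at x)) \<Longrightarrow>
      (LINT x:\<Omega>|lebesgue. u x * d\<phi> x $ j) = - (LINT x:\<Omega>|lebesgue. g x $ j * \<phi> x)"
      using wg unfolding weak_gradient_def by blast
    from this[OF tf d] show ?thesis .
  qed
  have conv_eq: "(LINT z:\<Omega>|lebesgue. f z * k (x - z)) = conv P k x"
    if P: "integrable lborel P" "AE z in lebesgue. indicator S z * f z = P z" and k[measurable]: "k \<in> borel_measurable borel"
      and fm: "set_integrable lebesgue S f" and k0: "\<And>y. norm y > r \<Longrightarrow> k y = 0" for f P and k :: "real^'n \<Rightarrow> real"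
  proof -
    have [measurable]: "P \<in> borel_measurable borel" using borel_measurable_integrable[OF P(1)] by simp
    have km: "(\<lambda>z. k (x - z)) \<in> borel_measurable lebesgue" 
    proof -
      have "(\<lambda>z. k (x - z)) \<in> borel_measurable lborel" by measurable
      then show ?thesis by (rule measurable_completion)
    qed
    have fm': "(\<lambda>z. indicator S z * f z) \<in> borel_measurable lebesgue"
      using borel_measurable_integrable[OF fm[unfolded set_integrable_def]] by simp
    have "(LINT z:\<Omega>|lebesgue. f z * k (x - z)) = (LINT z|lebesgue. (indicator S z * f z) * k (x - z))"
      unfolding set_lebesgue_integral_def
    proof (intro Bochner_Integration.integral_cong refl)
      fix z
      show "indicator \<Omega> z *\<^sub>R (f z * k (x - z)) = (indicator S z * f z) * k (x - z)"
      proof (cases "norm (x - z) > r")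
        case False
        then have "z \<in> cball x r" by (simp add: dist_norm)
        then have "z \<in> S" "z \<in> \<Omega>" using S by blast+
        then show ?thesis by simp
      qed (simp add: k0)
    qed
    also have "\<dots> = (LINT z|lebesgue. P z * k (x - z))"
    proof (rule integral_cong_AE)
      show "AE z in lebesgue. (indicator S z * f z) * k (x - z) = P z * k (x - z)"
        using P(2) by eventually_elim simp
      have "(\<lambda>z. P z * k (x - z)) \<in> borel_measurable lborel" by measurable
      then show "(\<lambda>z. P z * k (x - z)) \<in> borel_measurable lebesgue" by (rule measurable_completion)
      show "(\<lambda>z. (indicator S z * f z) * k (x - z)) \<in> borel_measurable lebesgue"
        by (rule borel_measurable_times[OF fm' km])
    qed
    also have "\<dots> = (LINT z|lborel. P z * k (x - z))" by (rule integral_completion) measurable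
    finally show ?thesis by (simp add: conv_def)
  qed
  have 1: "(LINT z:\<Omega>|lebesgue. u z * d\<phi> (x - z) $ j) = conv U (\<lambda>x. d\<phi> x $ j) x"
    by (rule conv_eq[OF U mollifier.measurable(2)[OF m] um(1)]) (simp add: mollifier.support_deriv[OF m])
  have 2: "(LINT z:\<Omega>|lebesgue. g z $ j * \<phi> (x - z)) = conv V \<phi> x"
    by (rule conv_eq[OF V mollifier.measurable(1)[OF m] um(2)]) (simp add: mollifier.support[OF m])
  have "(LINT z:\<Omega>|lebesgue. u z * (- d\<phi> (x - z)) $ j) = - (LINT z:\<Omega>|lebesgue. u z * d\<phi> (x - z) $ j)"
    by (simp add: set_lebesgue_integral_def)
  then show ?thesis using eq 1 2 by simp
qed

text \<open>The closed \<delta>-neighbourhood \<open>S\<close> of \<open>K\<close> is still a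
  compact subset of \<Omega>, so \<open>u\<close> and \<open>g\<close> are integrable on it, and
  kernels of radius below \<delta> centred in \<open>K\<close> see nothing outside \<open>S\<close>.
  The rest translates between Lebesgue integrals over \<open>K\<close> and integrals against
  \<open>gauss_on K\<close>.\<close>

lemma variance_le_on_compact_convex:
  fixes K \<Omega> :: "(real^'n) set"
  assumes \<Omega>: "open \<Omega>" and K: "compact K" "convex K" "K \<subseteq> \<Omega>" and H: "H1_gauss \<Omega> u g"
  shows "(LINT x:K|lebesgue. gauss x) * (LINT x:K|lebesgue. gauss x * (u x)\<^sup>2) - (LINT x:K|lebesgue. gauss x * u x)\<^sup>2
    \<le> (LINT x:K|lebesgue. gauss x) * (LINT x:K|lebesgue. gauss x * (norm (g x))\<^sup>2)"
proof -
  have wg: "weak_gradient \<Omega> u g" and u2: "set_integrable lebesgue \<Omega> (\<lambda>x. gauss x * (u x)\<^sup>2)"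
    and g2: "set_integrable lebesgue \<Omega> (\<lambda>x. gauss x * (norm (g x))\<^sup>2)" using H by (auto simp: H1_gauss_def)
  obtain \<delta> where \<delta>: "\<delta> > 0" "(\<Union>x\<in>K. cball x \<delta>) \<subseteq> \<Omega>"
    using compact_subset_open_imp_cball_epsilon_subset[OF K(1) \<Omega> K(3)] by blast
  define S where "S = (\<Union>x\<in>K. \<Union>y\<in>cball 0 \<delta>. {x + y})"
  have cS: "compact S" unfolding S_def by (rule compact_sums'[OF K(1) compact_cball])
  have ballS: "cball x \<delta> \<subseteq> S" if "x \<in> K" for x
  proof
    fix y assume "y \<in> cball x \<delta>"
    then have "y - x \<in> cball 0 \<delta>" by (simp add: dist_norm norm_minus_commute)
    then show "y \<in> S" unfolding S_def using that by (intro UN_I[of x] UN_I[of "y - x"]) auto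
  qed
  have S\<Omega>: "S \<subseteq> \<Omega>"
  proof
    fix z assume "z \<in> S"
    then obtain x y where "x \<in> K" "norm y \<le> \<delta>" "z = x + y" by (auto simp: S_def)
    then have "z \<in> cball x \<delta>" by (simp add: dist_norm)
    then show "z \<in> \<Omega>" using \<delta>(2) \<open>x \<in> K\<close> by blast
  qed
  have KS: "K \<subseteq> S" using ballS \<delta>(1) by (meson centre_in_cball less_imp_le subset_iff)
  have Sb: "S \<in> sets borel" and Kb[measurable]: "K \<in> sets borel" using cS K(1) by (auto intro: borel_compact)
  have li: "set_integrable lebesgue S u" "set_integrable lebesgue S (\<lambda>z. g z $ j)" for j
    using wg cS S\<Omega> by (auto simp: weak_gradient_def loc_integrable_def)
  obtain U where U: "integrable lborel U" "AE z in lebesgue. indicator S z * u z = U z"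
    using ex_borel_version[OF Sb li(1)] by blast
  have "\<exists>P. integrable lborel P \<and> (AE z in lebesgue. indicator S z * g z $ j = P z)" for j
    using ex_borel_version[OF Sb li(2)] by blast
  then obtain v where v: "\<And>j. integrable lborel (v j)" "\<And>j. AE z in lebesgue. indicator S z * g z $ j = v j z"
    by metis
  define V where "V z = (\<chi> j. v j z)" for z
  have Vj: "(\<lambda>z. V z $ j) = v j" for j by (simp add: V_def)
  have [measurable]: "U \<in> borel_measurable borel" "v j \<in> borel_measurable borel" for j
    using borel_measurable_integrable[OF U(1)] borel_measurable_integrable[OF v(1)] by auto
  have leb: "f \<in> borel_measurable lebesgue" if "f \<in> borel_measurable borel" for f :: "real^'n \<Rightarrow> real"
    by (rule measurable_completion) (use that in simp)
  \<comment> \<open>A positive lower bound of the weight on \<open>S\<close> converts weighted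
    square integrability of the gradient into unweighted square integrability. If \<open>S\<close>
    is empty any positive number will do.\<close>
  obtain c where c: "c > 0" "\<And>z. z \<in> S \<Longrightarrow> gauss z \<ge> c"
  proof (cases "S = {}")
    case False
    then obtain z0 where "z0 \<in> S" "\<And>z. z \<in> S \<Longrightarrow> gauss z0 \<le> gauss z"
      using continuous_attains_inf[OF cS _ continuous_on_gauss] by blast
    then show ?thesis using that[of "gauss z0"] gauss_pos by blast
  qed (use that[of 1] in auto)
  have v2: "integrable lborel (\<lambda>z. (v j z)\<^sup>2)" for j
  proof -
    have "integrable lebesgue (\<lambda>z. (v j z)\<^sup>2)"
    proof (rule Bochner_Integration.integrable_bound)
      show "integrable lebesgue (\<lambda>z. (1 / c) * (indicator \<Omega> z *\<^sub>R (gauss z * (norm (g z))\<^sup>2)))"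
        using g2 by (simp add: set_integrable_def)
      show "AE z in lebesgue. norm ((v j z)\<^sup>2) \<le> norm ((1 / c) * (indicator \<Omega> z *\<^sub>R (gauss z * (norm (g z))\<^sup>2)))"
        using v(2)[of j]
      proof eventually_elim
        case (elim z)
        show ?case
        proof (cases "z \<in> S")
          case True
          have "(g z $ j)\<^sup>2 \<le> (norm (g z))\<^sup>2" by (metis component_le_norm_cart power_mono abs_ge_zero power2_abs)
          then have "c * (g z $ j)\<^sup>2 \<le> gauss z * (norm (g z))\<^sup>2"
            using c True by (intro mult_mono) (auto intro: less_imp_le[OF gauss_pos])
          moreover have "v j z = g z $ j" using elim True by simp
          ultimately show ?thesis using True S\<Omega> c(1) gauss_pos[of z] by (auto simp: field_simps abs_mult)
        next
          case False
          then show ?thesis using elim by simp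
        qed
      qed
      show "(\<lambda>z. (v j z)\<^sup>2) \<in> borel_measurable lebesgue" by (rule leb) measurable
    qed
    then show ?thesis by (subst (asm) integrable_completion) auto
  qed
  have iK: "set_integrable lebesgue K f" if "set_integrable lebesgue \<Omega> f" for f :: "real^'n \<Rightarrow> real"
    by (rule set_integrable_subset[OF that]) (use K in auto)
  have transfer_int: "integrable (gauss_on K) F" 
    and transfer: "(LINT x|gauss_on K. F x) = (LINT x:K|lebesgue. gauss x * f x)"
    if F[measurable]: "F \<in> borel_measurable borel" and eq: "AE x in lebesgue. x \<in> K \<longrightarrow> f x = F x" 
      and f: "set_integrable lebesgue K (\<lambda>x. gauss x * f x)" for f F
  proof -
    have fm: "(\<lambda>x. indicator K x * gauss x * F x) \<in> borel_measurable lborel" by measurable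
    have ae: "AE x in lebesgue. indicator K x *\<^sub>R (gauss x * f x) = indicator K x * gauss x * F x"
      using eq by eventually_elim (auto simp: indicator_def)
    show "(LINT x|gauss_on K. F x) = (LINT x:K|lebesgue. gauss x * f x)"
    proof -
      have "(LINT x:K|lebesgue. gauss x * f x) = (LINT x|lebesgue. indicator K x * gauss x * F x)"
        unfolding set_lebesgue_integral_def
        by (rule integral_cong_AE[OF borel_measurable_integrable[OF f[unfolded set_integrable_def]] measurable_completion[OF fm] ae])
      also have "\<dots> = (LINT x|lborel. indicator K x * gauss x * F x)" by (rule integral_completion) (use fm in simp)
      finally show ?thesis by (simp add: integral_gauss_on)
    qed
    have "integrable lebesgue (\<lambda>x. indicator K x * gauss x * F x)"
      by (rule integrable_cong_AE_imp[OF f[unfolded set_integrable_def] measurable_completion[OF fm] ae])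
    then have "integrable lborel (\<lambda>x. indicator K x * gauss x * F x)" 
      by (subst (asm) integrable_completion) (use fm in auto)
    then show "integrable (gauss_on K) F" by (simp add: integrable_gauss_on)
  qed
  have i1: "set_integrable lebesgue K gauss"
  proof -
    have "integrable lborel (\<lambda>x. indicator K x *\<^sub>R gauss x)"
      by (rule borel_integrable_compact[OF K(1) continuous_on_gauss])
    then show ?thesis unfolding set_integrable_def by (subst integrable_completion) auto
  qed
  have m: "measure (gauss_on K) (space (gauss_on K)) = (LINT x:K|lebesgue. gauss x)"
    using transfer[of "\<lambda>_. 1" "\<lambda>_. 1"] i1 by simp
  have AEu: "AE x in lebesgue. x \<in> K \<longrightarrow> u x = U x"
    using U(2) by eventually_elim (use KS in \<open>auto simp: indicator_def\<close>)
  have AEv: "AE x in lebesgue. x \<in> K \<longrightarrow> g x $ j = v j x" for j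
    using v(2)[of j] by eventually_elim (use KS in \<open>auto simp: indicator_def\<close>)
  have AEu2: "AE x in lebesgue. x \<in> K \<longrightarrow> (u x)\<^sup>2 = (U x)\<^sup>2" using AEu by eventually_elim auto
  have iu2: "integrable (gauss_on K) (\<lambda>x. (U x)\<^sup>2)" by (rule transfer_int[OF _ AEu2 iK[OF u2]]) simp
  have eu2: "(LINT x|gauss_on K. (U x)\<^sup>2) = (LINT x:K|lebesgue. gauss x * (u x)\<^sup>2)"
    by (rule transfer[OF _ AEu2 iK[OF u2]]) simp
  \<comment> \<open>Square integrability implies integrability because the Gaussian measure of
    \<open>K\<close> is finite; the result is then carried back from \<open>U\<close> to
    \<open>u\<close>.\<close>
  have iu: "set_integrable lebesgue K (\<lambda>x. gauss x * u x)"
  proof -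
    interpret finite_measure "gauss_on K" by (rule finite_measure_gauss_on_compact[OF K(1)])
    have "integrable (gauss_on K) U" 
      by (rule square_integrable_imp_integrable[OF _ iu2]) (simp add: gauss_on_def)
    then have "integrable lborel (\<lambda>x. indicator K x * gauss x * U x)" by (simp add: integrable_gauss_on)
    then have "integrable lebesgue (\<lambda>x. indicator K x * gauss x * U x)" by (subst integrable_completion) auto
    then show ?thesis unfolding set_integrable_def
    proof (rule integrable_cong_AE_imp)
      have "(\<lambda>x. (indicator K x * gauss x) * (indicator S x * u x)) \<in> borel_measurable lebesgue"
      proof (rule borel_measurable_times)
        show "(\<lambda>x. indicator K x * gauss x) \<in> borel_measurable lebesgue" by (rule leb) measurable
        show "(\<lambda>x. indicator S x * u x) \<in> borel_measurable lebesgue"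
          using borel_measurable_integrable[OF li(1)[unfolded set_integrable_def]] by simp
      qed
      also have "(\<lambda>x. (indicator K x * gauss x) * (indicator S x * u x)) = (\<lambda>x. indicator K x *\<^sub>R (gauss x * u x))"
        using KS by (auto simp: fun_eq_iff indicator_def)
      finally show "(\<lambda>x. indicator K x *\<^sub>R (gauss x * u x)) \<in> borel_measurable lebesgue" .
      show "AE x in lebesgue. indicator K x * gauss x * U x = indicator K x *\<^sub>R (gauss x * u x)"
        using AEu by eventually_elim (auto simp: indicator_def)
    qed
  qed
  have eu: "(LINT x|gauss_on K. U x) = (LINT x:K|lebesgue. gauss x * u x)"
    by (rule transfer[OF _ AEu iu]) simp
  have AEg: "AE x in lebesgue. x \<in> K \<longrightarrow> (norm (g x))\<^sup>2 = (\<Sum>j\<in>UNIV. (v j x)\<^sup>2)"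
  proof -
    have "AE x in lebesgue. \<forall>j. x \<in> K \<longrightarrow> g x $ j = v j x" by (subst AE_all_countable) (use AEv in blast)
    then show ?thesis unfolding power2_norm_eq_inner inner_vec_def by eventually_elim (simp add: power2_eq_square)
  qed
  have eg: "(LINT x|gauss_on K. (\<Sum>j\<in>UNIV. (v j x)\<^sup>2)) = (LINT x:K|lebesgue. gauss x * (norm (g x))\<^sup>2)"
    by (rule transfer[OF _ AEg iK[OF g2]]) measurable
  have eg': "(LINT x|gauss_on K. (\<Sum>j\<in>UNIV. (v j x)\<^sup>2)) = (\<Sum>j\<in>UNIV. LINT x|gauss_on K. (v j x)\<^sup>2)"
  proof (rule Bochner_Integration.integral_sum)
    fix j
    have "integrable (gauss_on K) (\<lambda>x. \<Sum>j\<in>UNIV. (v j x)\<^sup>2)" 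
      by (rule transfer_int[OF _ AEg iK[OF g2]]) measurable
    then show "integrable (gauss_on K) (\<lambda>x. (v j x)\<^sup>2)"
    proof (rule Bochner_Integration.integrable_bound)
      show "(\<lambda>x. (v j x)\<^sup>2) \<in> borel_measurable (gauss_on K)" by measurable
      show "AE x in gauss_on K. norm ((v j x)\<^sup>2) \<le> norm (\<Sum>j\<in>UNIV. (v j x)\<^sup>2)"
        using member_le_sum[of j UNIV "\<lambda>j. (v j _)\<^sup>2"] by (intro AE_I2) (simp add: sum_nonneg)
    qed
  qed
  have "measure (gauss_on K) (space (gauss_on K)) * (LINT x|gauss_on K. (U x)\<^sup>2) - (LINT x|gauss_on K. U x)\<^sup>2 
    \<le> measure (gauss_on K) (space (gauss_on K)) * (\<Sum>j\<in>UNIV. LINT x|gauss_on K. (V x $ j)\<^sup>2)"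
  proof (rule variance_le_of_weak_gradient[OF K(1,2) U(1) _ _ \<delta>(1) _ iu2])
    fix r L x j and \<phi> :: "real^'n \<Rightarrow> real" and d\<phi>
    assume m: "mollifier r L \<phi> d\<phi>" and r: "r < \<delta>" and x: "x \<in> K"
    have "cball x r \<subseteq> S" using ballS[OF x] r by (meson less_imp_le order_trans subset_cball)
    from weak_gradient_mollifier[OF wg m this S\<Omega> U v li]
    show "conv U (\<lambda>x. d\<phi> x $ j) x = conv (\<lambda>z. V z $ j) \<phi> x" by (simp add: Vj)
  qed (auto simp: V_def v v2)
  then show ?thesis unfolding m eu2 eu eg[symmetric] eg' by (simp add: V_def)
qed

section \<open>Integrability against the Gaussian weight\<close>

text \<open>Expanding (|t| / 2 - 1)^2 >= 0 gives - t^2 / 4 <= 1 - |t|, a comparison with a two-sided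
  exponential that has an elementary integral.\<close>

lemma nn_integral_exp_neg_square_quarter_finite:
  "(\<integral>\<^sup>+t. ennreal (exp (- t\<^sup>2 / 4)) \<partial>lborel) < \<infinity>"
proof -
  let ?E = "\<lambda>t::real. ennreal (exp (- t)) * indicator {0..} t"
  have "((\<lambda>t::real. - exp (- t)) \<longlongrightarrow> - 0) at_top"
    by (intro tendsto_minus filterlim_compose[OF exp_at_bot] filterlim_uminus_at_bot_at_top)
  then have E: "(\<integral>\<^sup>+t. ?E t \<partial>lborel) = ennreal (- 0 - (- exp (- 0)))"
    by (intro nn_integral_FTC_atLeast) (auto intro!: derivative_eq_intros)
  have E': "(\<integral>\<^sup>+t. ?E (- t) \<partial>lborel) = (\<integral>\<^sup>+t. ?E t \<partial>lborel)"
    using nn_integral_real_affine[of ?E "-1" 0] by simp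
  have "(\<integral>\<^sup>+t. ennreal (exp (- t\<^sup>2 / 4)) \<partial>lborel) \<le> (\<integral>\<^sup>+t. ennreal (exp 1) * (?E t + ?E (- t)) \<partial>lborel)"
  proof (intro nn_integral_mono)
    fix t :: real
    have "0 \<le> (\<bar>t\<bar> / 2 - 1)\<^sup>2" by simp
    then have "- t\<^sup>2 / 4 \<le> 1 - \<bar>t\<bar>" by (simp add: power2_eq_square algebra_simps)
    then have "exp (- t\<^sup>2 / 4) \<le> exp (1 + - \<bar>t\<bar>)" by simp
    also have "\<dots> = exp 1 * exp (- \<bar>t\<bar>)" by (rule exp_add)
    finally have "ennreal (exp (- t\<^sup>2 / 4)) \<le> ennreal (exp 1) * ennreal (exp (- \<bar>t\<bar>))"
      by (simp add: ennreal_mult[symmetric])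
    also have "ennreal (exp (- \<bar>t\<bar>)) \<le> ?E t + ?E (- t)"
      by (cases "t \<ge> 0") (auto simp: indicator_def)
    finally show "ennreal (exp (- t\<^sup>2 / 4)) \<le> ennreal (exp 1) * (?E t + ?E (- t))" by (simp add: mult_left_mono)
  qed
  also have "\<dots> = ennreal (exp 1) * ((\<integral>\<^sup>+t. ?E t \<partial>lborel) + (\<integral>\<^sup>+t. ?E (- t) \<partial>lborel))"
    by (subst nn_integral_cmult, simp, subst nn_integral_add) auto
  also have "\<dots> < \<infinity>" unfolding E' E by (simp add: ennreal_mult_less_top)
  finally show ?thesis .
qed

lemma integrable_exp_neg_norm_square_quarter:
  "integrable lborel (\<lambda>x::'a::euclidean_space. exp (- (norm x)\<^sup>2 / 4))"
proof (rule integrableI_bounded)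
  have eq: "ennreal (norm (exp (- (norm x)\<^sup>2 / 4))) = (\<Prod>b\<in>Basis. ennreal (exp (- (x \<bullet> b)\<^sup>2 / 4)))" for x :: 'a
  proof -
    have "- (norm x)\<^sup>2 / 4 = (\<Sum>b\<in>Basis. - (x \<bullet> b)\<^sup>2 / 4)"
      unfolding power2_norm_eq_inner by (subst euclidean_inner) (simp add: power2_eq_square sum_negf sum_divide_distrib)
    then show ?thesis by (simp add: exp_sum prod_ennreal abs_prod)
  qed
  have "(\<integral>\<^sup>+x. ennreal (norm (exp (- (norm x)\<^sup>2 / 4))) \<partial>(lborel :: 'a measure))
     = (\<Prod>b\<in>(Basis :: 'a set). \<integral>\<^sup>+t. ennreal (exp (- t\<^sup>2 / 4)) \<partial>lborel)"
    unfolding eq by (rule nn_integral_lborel_prod) auto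
  also have "\<dots> < \<infinity>"
  proof -
    obtain a where "(\<integral>\<^sup>+t. ennreal (exp (- t\<^sup>2 / 4)) \<partial>lborel) = ennreal a" "a \<ge> 0"
      using nn_integral_exp_neg_square_quarter_finite by (metis ennreal_cases infinity_ennreal_def less_irrefl)
    then show ?thesis by (simp only: prod_constant ennreal_power infinity_ennreal_def ennreal_less_top)
  qed
  finally show "(\<integral>\<^sup>+x. ennreal (norm (exp (- (norm x)\<^sup>2 / 4))) \<partial>(lborel :: 'a measure)) < \<infinity>" .
qed simp

text \<open>Half of the Gaussian decay absorbs the quadratic growth: with s = |x|^2, 1 + s <= 4 *
  exp (s / 4), and exp (- s / 4) remains. This is the origin of the quarter in the two preceding
  lemmas.\<close>

lemma integrable_gauss_quadratic:
  fixes f :: "real^'n \<Rightarrow> real"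
  assumes [measurable]: "f \<in> borel_measurable borel" and f: "\<And>x. \<bar>f x\<bar> \<le> C * (1 + (norm x)\<^sup>2)"
  shows "integrable lborel (\<lambda>x. gauss x * f x)"
proof (rule Bochner_Integration.integrable_bound)
  define c :: real where "c = (2 * pi) powr (- real CARD('n) / 2)"
  have c: "c \<ge> 0" by (simp add: c_def)
  show "integrable lborel (\<lambda>x::real^'n. c * \<bar>C\<bar> * 4 * exp (- (norm x)\<^sup>2 / 4))"
    using integrable_exp_neg_norm_square_quarter[where 'a = "real^'n"] by simp
  show "AE x in lborel. norm (gauss x * f x) \<le> norm (c * \<bar>C\<bar> * 4 * exp (- (norm x)\<^sup>2 / 4))"
  proof (rule AE_I2)
    fix x :: "real^'n"
    define s where "s = (norm x)\<^sup>2"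
    have s: "s \<ge> 0" by (simp add: s_def)
    have "1 + s \<le> 4 * exp (s / 4)" using exp_ge_add_one_self[of "s / 4"] by linarith
    then have "exp (- s / 2) * (1 + s) \<le> exp (- s / 2) * (4 * exp (s / 4))" by (intro mult_left_mono) auto
    also have "\<dots> = 4 * exp (- s / 4)" by (simp add: exp_add[symmetric] mult.left_commute)
    finally have e: "exp (- s / 2) * (1 + s) \<le> 4 * exp (- s / 4)" .
    have "\<bar>f x\<bar> \<le> \<bar>C\<bar> * (1 + s)"
      using order_trans[OF f[of x, folded s_def] mult_right_mono[OF abs_ge_self]] s by simp
    then have "norm (gauss x * f x) \<le> c * exp (- s / 2) * (\<bar>C\<bar> * (1 + s))"
      unfolding gauss_def c_def[symmetric] s_def[symmetric] norm_mult using c by (simp add: abs_mult mult.assoc mult_left_mono)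
    also have "\<dots> = c * \<bar>C\<bar> * (exp (- s / 2) * (1 + s))" by (simp add: mult_ac)
    also have "\<dots> \<le> c * \<bar>C\<bar> * (4 * exp (- s / 4))" using e c by (intro mult_left_mono) auto
    finally show "norm (gauss x * f x) \<le> norm (c * \<bar>C\<bar> * 4 * exp (- (norm x)\<^sup>2 / 4))"
      using c by (simp add: s_def abs_mult mult.assoc)
  qed
qed measurable

lemma integrable_gauss: "integrable lborel gauss"
  using integrable_gauss_quadratic[of "\<lambda>_. 1" 1] by simp

lemma set_integrable_lebesgue_subset:
  fixes f :: "real^'n \<Rightarrow> real"
  assumes "integrable lborel f" "S \<in> sets lebesgue"
  shows "set_integrable lebesgue S f"
proof -
  have "f \<in> borel_measurable lborel" using assms by simp
  then have "integrable lebesgue f" using assms integrable_completion by blast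
  then have "set_integrable lebesgue UNIV f" by (simp add: set_integrable_def)
  then show ?thesis by (rule set_integrable_subset) (use assms in auto)
qed

section \<open>Exhaustion of a convex open set and the Poincare inequality on it\<close>

text \<open>The sets are the inner parallel sets at distance 1 / (k + 1), cut off by balls. They are
  convex: if w outside \<Omega> were closer than \<delta> k to a convex combination z of x and y,
  then x + v and y + v with v = w - z would lie in \<Omega>, and so would their combination w.
  Writing \<open>C k\<close> as an intersection over the complement makes it the whole space when
  \<Omega> is.\<close>

lemma convex_open_exhaustion:
  fixes \<Omega> :: "(real^'n) set"
  assumes "open \<Omega>" "convex \<Omega>"
  obtains K :: "nat \<Rightarrow> (real^'n) set" 
  where "\<And>k. compact (K k)" "\<And>k. convex (K k)" "\<And>k. K k \<subseteq> \<Omega>" "incseq K" "(\<Union>k. K k) = \<Omega>"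
proof -
  define \<delta> where "\<delta> k = 1 / real (Suc k)" for k
  have \<delta>: "\<delta> k > 0" for k by (simp add: \<delta>_def)
  define C where "C k = (\<Inter>y\<in>-\<Omega>. {x. \<delta> k \<le> dist x y})" for k
  define K where "K k = C k \<inter> cball 0 (real k)" for k
  have "closed (C k)" for k unfolding C_def
    by (intro closed_INT ballI closed_Collect_le continuous_intros)
  then have comp: "compact (K k)" for k unfolding K_def by (intro closed_Int_compact) auto
  have "convex (C k)" for k
  proof (rule convexI)
    fix x y a b assume xy: "x \<in> C k" "y \<in> C k" and ab: "0 \<le> a" "0 \<le> b" "a + b = (1::real)"
    show "a *\<^sub>R x + b *\<^sub>R y \<in> C k"
    proof (rule ccontr)
      let ?z = "a *\<^sub>R x + b *\<^sub>R y"
      assume "?z \<notin> C k"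
      then obtain w where w: "w \<notin> \<Omega>" "dist ?z w < \<delta> k" by (auto simp: C_def not_le)
      define v where "v = w - ?z"
      have v: "norm v < \<delta> k" using w(2) by (simp add: v_def dist_norm norm_minus_commute)
      have in\<Omega>: "p + v \<in> \<Omega>" if "p \<in> C k" for p
      proof (rule ccontr)
        assume "p + v \<notin> \<Omega>"
        then have "\<delta> k \<le> dist p (p + v)" using that by (auto simp: C_def)
        then show False using v by (simp add: dist_norm)
      qed
      have "a *\<^sub>R (x + v) + b *\<^sub>R (y + v) \<in> \<Omega>"
        by (rule convexD[OF assms(2) in\<Omega>[OF xy(1)] in\<Omega>[OF xy(2)] ab])
      moreover have "a *\<^sub>R (x + v) + b *\<^sub>R (y + v) = ?z + (a + b) *\<^sub>R v" by (simp add: algebra_simps)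
      ultimately show False using w(1) ab(3) by (simp add: v_def)
    qed
  qed
  then have conv: "convex (K k)" for k unfolding K_def by (intro convex_Int) auto
  have sub: "K k \<subseteq> \<Omega>" for k
  proof
    fix x assume x: "x \<in> K k"
    show "x \<in> \<Omega>"
    proof (rule ccontr)
      assume "x \<notin> \<Omega>"
      then have "\<delta> k \<le> dist x x" using x unfolding K_def C_def by blast
      then show False using \<delta>[of k] by simp
    qed
  qed
  have inc: "incseq K"
  proof (rule incseq_SucI, rule subsetI)
    fix k x assume x: "x \<in> K k"
    have "\<delta> (Suc k) \<le> \<delta> k" by (simp add: \<delta>_def field_simps)
    then show "x \<in> K (Suc k)" using x by (auto simp: K_def C_def intro: order_trans)
  qed
  have "x \<in> (\<Union>k. K k)" if x: "x \<in> \<Omega>" for x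
  proof -
    obtain e where e: "e > 0" "ball x e \<subseteq> \<Omega>" using openE[OF assms(1) x] by blast
    obtain k1 where k1: "1 / real (Suc k1) < e" using nat_approx_posE[OF e(1)] by blast
    obtain k2 where k2: "norm x \<le> real k2" using real_arch_simple by blast
    define k where "k = max k1 k2"
    have "\<delta> k \<le> \<delta> k1" by (simp add: \<delta>_def k_def field_simps)
    then have "\<delta> k < e" using k1 by (simp add: \<delta>_def)
    then have "x \<in> C k" using e(2) by (force simp: C_def not_less[symmetric])
    then show ?thesis using k2 by (auto simp: K_def k_def)
  qed
  then have "(\<Union>k. K k) = \<Omega>" using sub by blast
  then show ?thesis using that comp conv sub inc by blast
qed

text \<open>The inequality on \<open>K k\<close> keeps its mean term, which tends to 0 only in the
  limit. Dividing by the mass \<open>G\<close>, positive for a nonempty open set, finishes the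
  proof.\<close>

theorem gaussian_poincare:
  fixes \<Omega> :: "(real^'n) set"
  assumes \<Omega>: "open \<Omega>" "convex \<Omega>" "\<Omega> \<noteq> {}" and H: "H1_gauss \<Omega> u g"
    and mean: "(LINT x:\<Omega>|lebesgue. gauss x * u x) = 0"
  shows "(LINT x:\<Omega>|lebesgue. gauss x * (u x)\<^sup>2) \<le> (LINT x:\<Omega>|lebesgue. gauss x * (norm (g x))\<^sup>2)"
proof -
  have wg: "weak_gradient \<Omega> u g" and u2: "set_integrable lebesgue \<Omega> (\<lambda>x. gauss x * (u x)\<^sup>2)"
    and g2: "set_integrable lebesgue \<Omega> (\<lambda>x. gauss x * (norm (g x))\<^sup>2)" using H by (auto simp: H1_gauss_def)
  obtain K :: "nat \<Rightarrow> (real^'n) set" where K: "\<And>k. compact (K k)" "\<And>k. convex (K k)" "\<And>k. K k \<subseteq> \<Omega>" "incseq K" "(\<Union>k. K k) = \<Omega>"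
    using convex_open_exhaustion[OF \<Omega>(1,2)] by blast
  have Kl: "K k \<in> sets lebesgue" for k using borel_compact[OF K(1)] by simp
  have \<Omega>b: "\<Omega> \<in> sets lebesgue" using \<Omega>(1) by simp
  have i1: "set_integrable lebesgue \<Omega> gauss"
    by (rule set_integrable_lebesgue_subset[OF integrable_gauss \<Omega>b])
  have iu: "set_integrable lebesgue \<Omega> (\<lambda>x. gauss x * u x)"
    unfolding set_integrable_def
  proof (rule Bochner_Integration.integrable_bound)
    show "integrable lebesgue (\<lambda>x. indicator \<Omega> x *\<^sub>R gauss x + indicator \<Omega> x *\<^sub>R (gauss x * (u x)\<^sup>2))"
      using i1 u2 unfolding set_integrable_def by (rule Bochner_Integration.integrable_add)
    show "(\<lambda>x. indicator \<Omega> x *\<^sub>R (gauss x * u x)) \<in> borel_measurable lebesgue"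
    \<comment> \<open>\<open>u\<close> is only locally integrable on \<Omega>, so measurability on
      all of \<Omega> is obtained as a limit along the compact sets \<open>K k\<close>.\<close>
    proof (rule borel_measurable_LIMSEQ_real)
      have "(\<lambda>x. gauss x * (indicator (K k) x *\<^sub>R u x)) \<in> borel_measurable lebesgue" for k
      proof (rule borel_measurable_times)
        show "gauss \<in> borel_measurable lebesgue" by (rule measurable_completion) simp
        show "(\<lambda>x. indicator (K k) x *\<^sub>R u x) \<in> borel_measurable lebesgue"
        proof -
          have "set_integrable lebesgue (K k) u"
            using wg K(1,3) by (auto simp: weak_gradient_def loc_integrable_def)
          then show ?thesis unfolding set_integrable_def by (rule borel_measurable_integrable)
        qed
      qed
      moreover have "(\<lambda>x. gauss x * (indicator (K k) x *\<^sub>R u x)) = (\<lambda>x. indicator (K k) x *\<^sub>R (gauss x * u x))" for k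
        by (auto simp: fun_eq_iff)
      ultimately show "(\<lambda>x. indicator (K k) x *\<^sub>R (gauss x * u x)) \<in> borel_measurable lebesgue" for k by simp
      show "(\<lambda>k. indicator (K k) x *\<^sub>R (gauss x * u x)) \<longlonglongrightarrow> indicator \<Omega> x *\<^sub>R (gauss x * u x)" for x
        using LIMSEQ_indicator_incseq[OF K(4), of x] K(5) by (intro tendsto_intros) simp
    qed
    have "\<bar>u x\<bar> \<le> 1 + (u x)\<^sup>2" for x
    proof -
      have "0 \<le> (\<bar>u x\<bar> - 1)\<^sup>2" by simp
      also have "\<dots> = (u x)\<^sup>2 - 2 * \<bar>u x\<bar> + 1" by (simp add: power2_eq_square algebra_simps)
      finally show ?thesis by linarith
    qed
    then have "gauss x * \<bar>u x\<bar> \<le> gauss x * (1 + (u x)\<^sup>2)" for x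
      using less_imp_le[OF gauss_pos] by (intro mult_left_mono) auto
    then show "AE x in lebesgue. norm (indicator \<Omega> x *\<^sub>R (gauss x * u x)) 
       \<le> norm (indicator \<Omega> x *\<^sub>R gauss x + indicator \<Omega> x *\<^sub>R (gauss x * (u x)\<^sup>2))"
      by (intro AE_I2) (auto simp: indicator_def abs_mult abs_of_pos[OF gauss_pos] distrib_left intro: order_trans abs_ge_self)
  qed
  have lim: "(\<lambda>k. LINT x:K k|lebesgue. f x) \<longlonglongrightarrow> (LINT x:\<Omega>|lebesgue. f x)" 
    if "set_integrable lebesgue \<Omega> f" for f :: "real^'n \<Rightarrow> real"
    using set_integral_cont_up[OF Kl K(4), of f] that by (simp add: K(5))
  define G where "G = (LINT x:\<Omega>|lebesgue. gauss x)"
  have "G * (LINT x:\<Omega>|lebesgue. gauss x * (u x)\<^sup>2) - (LINT x:\<Omega>|lebesgue. gauss x * u x)\<^sup>2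
    \<le> G * (LINT x:\<Omega>|lebesgue. gauss x * (norm (g x))\<^sup>2)"
    unfolding G_def
  proof (rule LIMSEQ_le)
    show "(\<lambda>k. (LINT x:K k|lebesgue. gauss x) * (LINT x:K k|lebesgue. gauss x * (u x)\<^sup>2) - (LINT x:K k|lebesgue. gauss x * u x)\<^sup>2)
      \<longlonglongrightarrow> (LINT x:\<Omega>|lebesgue. gauss x) * (LINT x:\<Omega>|lebesgue. gauss x * (u x)\<^sup>2) - (LINT x:\<Omega>|lebesgue. gauss x * u x)\<^sup>2"
      by (intro tendsto_intros lim i1 u2 iu)
    show "(\<lambda>k. (LINT x:K k|lebesgue. gauss x) * (LINT x:K k|lebesgue. gauss x * (norm (g x))\<^sup>2))
      \<longlonglongrightarrow> (LINT x:\<Omega>|lebesgue. gauss x) * (LINT x:\<Omega>|lebesgue. gauss x * (norm (g x))\<^sup>2)"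
      by (intro tendsto_intros lim i1 g2)
  qed (use variance_le_on_compact_convex[OF \<Omega>(1) K(1-3) H] in blast)
  moreover have "G > 0"
  proof -
    have "G \<ge> 0" unfolding G_def set_lebesgue_integral_def
      by (intro Bochner_Integration.integral_nonneg) (auto simp: less_imp_le[OF gauss_pos])
    moreover have "G \<noteq> 0"
    proof
      assume "G = 0"
      then have "AE x in lebesgue. indicator \<Omega> x *\<^sub>R gauss x = 0"
        unfolding G_def set_lebesgue_integral_def using i1[unfolded set_integrable_def]
        by (subst (asm) integral_nonneg_eq_0_iff_AE) (auto simp: less_imp_le[OF gauss_pos])
      then have "AE x in lebesgue. x \<notin> \<Omega>" by eventually_elim (auto simp: indicator_def gauss_pos less_imp_neq[OF gauss_pos, symmetric])
      then have "\<Omega> \<in> null_sets lebesgue" by (subst AE_iff_null_sets[OF \<Omega>b])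
      then have "negligible \<Omega>" by (simp add: negligible_iff_null_sets)
      then show False using open_not_negligible[OF \<Omega>(1,3)] by simp
    qed
    ultimately show ?thesis by simp
  qed
  ultimately show ?thesis by (simp add: mean)
qed

section \<open>Affine test functions and strips\<close>

text \<open>Difference quotients in direction j have integral 0 by translation invariance of
  Lebesgue measure. The Lipschitz constant dominates them on the ball of radius R + 1, the step
  sizes being at most 1, so the limit may be taken under the integral.\<close>

lemma integral_partial_derivative_eq_0:
  fixes \<psi> :: "real^'n \<Rightarrow> real"
  assumes C1: "Ck 1 \<psi>" and supp: "\<And>x. norm x > R \<Longrightarrow> \<psi> x = 0"
    and d: "\<And>x. (\<psi> has_derivative (\<lambda>h. d\<psi> x \<bullet> h)) (at x)"
  shows "integrable lborel (\<lambda>x. d\<psi> x $ j)" "(LINT x|lborel. d\<psi> x $ j) = 0"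
proof -
  obtain L where L: "L \<ge> 0" "\<And>x y. \<bar>\<psi> x - \<psi> y\<bar> \<le> L * norm (x - y)"
    using Ck_compact_support_Lipschitz[OF C1 supp] by blast
  have c\<psi>: "continuous_on UNIV \<psi>" by (rule continuous_on_Lipschitz_abs[OF L(2)])
  then have [measurable]: "\<psi> \<in> borel_measurable borel" by (rule borel_measurable_continuous_onI)
  have i\<psi>: "integrable lborel \<psi>"
  proof -
    have "integrable lborel (\<lambda>x. indicator (cball 0 R) x *\<^sub>R \<psi> x)"
      by (intro borel_integrable_compact continuous_on_subset[OF c\<psi>]) auto
    moreover have "(\<lambda>x. indicator (cball 0 R) x *\<^sub>R \<psi> x) = \<psi>"
      using supp by (auto simp: fun_eq_iff indicator_def)
    ultimately show ?thesis by simp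
  qed
  define e :: "real^'n" where "e = axis j 1"
  have e1: "norm e = 1" by (simp add: e_def norm_axis_1)
  define t where "t n = 1 / real (Suc n)" for n
  have t: "t n > 0" "t n \<le> 1" for n by (auto simp: t_def)
  have tlim: "filterlim t (at 0) sequentially"
    unfolding t_def filterlim_at using LIMSEQ_inverse_real_of_nat by (auto simp: inverse_eq_divide)
  define q where "q n x = (\<psi> (x + t n *\<^sub>R e) - \<psi> x) / t n" for n x
  have qlim: "(\<lambda>n. q n x) \<longlonglongrightarrow> d\<psi> x $ j" for x
  proof -
    have "((\<lambda>s. x + s *\<^sub>R e) has_derivative (\<lambda>s. s *\<^sub>R e)) (at 0)" by (auto intro!: derivative_eq_intros)
    then have "((\<lambda>s. \<psi> (x + s *\<^sub>R e)) has_derivative (\<lambda>s. d\<psi> x \<bullet> (s *\<^sub>R e))) (at 0)"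
      by (rule has_derivative_compose) (use d in simp)
    then have "((\<lambda>s. \<psi> (x + s *\<^sub>R e)) has_field_derivative (d\<psi> x $ j)) (at 0)"
      unfolding has_field_derivative_def
      by (rule has_derivative_eq_rhs) (auto simp: fun_eq_iff e_def inner_axis)
    then have "((\<lambda>s. (\<psi> (x + s *\<^sub>R e) - \<psi> x) / s) \<longlongrightarrow> d\<psi> x $ j) (at 0)" by (simp add: DERIV_def)
    from filterlim_compose[OF this tlim] show ?thesis by (simp add: q_def)
  qed
  have qb: "norm (q n x) \<le> L * indicator (cball 0 (R + 1)) x" for n x
  proof (cases "norm x > R + 1")
    case True
    have "norm x \<le> norm (x + t n *\<^sub>R e) + norm (t n *\<^sub>R e)" 
      using norm_triangle_ineq4[of "x + t n *\<^sub>R e" "t n *\<^sub>R e"] by simp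
    then have "norm (x + t n *\<^sub>R e) > R" "norm x > R" using True t[of n] e1 by auto
    then show ?thesis using True supp by (simp add: q_def)
  next
    case False
    have "\<bar>\<psi> (x + t n *\<^sub>R e) - \<psi> x\<bar> \<le> L * t n" using L(2)[of "x + t n *\<^sub>R e" x] t[of n] e1 by simp
    then show ?thesis using False t[of n] by (simp add: q_def field_simps)
  qed
  have iB: "integrable lborel (\<lambda>x::real^'n. L * indicator (cball 0 (R + 1)) x)"
  proof -
    have "integrable lborel (\<lambda>x. indicator (cball 0 (R + 1)) x *\<^sub>R (L :: real))" 
      by (intro borel_integrable_compact) auto
    then show ?thesis by (simp add: mult.commute)
  qed
  have [measurable]: "q n \<in> borel_measurable borel" for n unfolding q_def by measurable
  have dm[measurable]: "(\<lambda>x. d\<psi> x $ j) \<in> borel_measurable borel"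
    by (rule borel_measurable_LIMSEQ_real[where u = q]) (auto intro: qlim)
  show "integrable lborel (\<lambda>x. d\<psi> x $ j)"
    by (rule integrable_dominated_convergence[OF _ _ iB, of _ q]) (use qlim qb in auto)
  have "(\<lambda>n. LINT x|lborel. q n x) \<longlonglongrightarrow> (LINT x|lborel. d\<psi> x $ j)"
    by (rule integral_dominated_convergence[OF _ _ iB]) (use qlim qb in auto)
  moreover have "(LINT x|lborel. q n x) = 0" for n
  proof -
    have it: "integrable lborel (\<lambda>x. \<psi> (x + t n *\<^sub>R e))"
      using integrable_lborel_translate_diff[OF i\<psi>, of "- (t n *\<^sub>R e)"] by simp
    have "(LINT x|lborel. \<psi> (x + t n *\<^sub>R e)) = (LINT x|lborel. \<psi> x)"
      using integral_lborel_translate_diff[of \<psi> "- (t n *\<^sub>R e)"] by simp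
    then show ?thesis unfolding q_def using i\<psi> it by simp
  qed
  ultimately show "(LINT x|lborel. d\<psi> x $ j) = 0" by (simp add: LIMSEQ_const_iff)
qed

lemma affine_has_derivative: "((\<lambda>x. x \<bullet> v - c) has_derivative (\<lambda>h. v \<bullet> h)) (at x)"
  by (auto intro!: derivative_eq_intros simp: inner_commute)

lemma Ck_affine: "Ck k (\<lambda>x::real^'n. x \<bullet> v - c)"
proof (cases k)
  case (Suc k')
  show ?thesis unfolding Suc by (rule Ck_SucI[OF affine_has_derivative]) (rule Ck_const)
qed (auto intro!: continuous_intros)

lemma set_integrable_lebesgue_compact:
  fixes f :: "real^'n \<Rightarrow> real"
  assumes "compact K" "continuous_on UNIV f"
  shows "set_integrable lebesgue K f"
proof -
  have [measurable]: "f \<in> borel_measurable borel" "K \<in> sets borel"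
    using assms by (auto intro: borel_measurable_continuous_onI borel_compact)
  have "integrable lborel (\<lambda>x. indicator K x *\<^sub>R f x)"
    by (intro borel_integrable_compact continuous_on_subset[OF assms(2)] assms(1)) auto
  then show ?thesis unfolding set_integrable_def by (subst integrable_completion) auto
qed

text \<open>Integration by parts through the product \<psi> of the affine function and the test
  function: \<psi> has compact support, so its partial derivatives integrate to 0, and the product
  rule splits them into the two required terms.\<close>

lemma weak_gradient_affine:
  fixes v :: "real^'n"
  shows "weak_gradient \<Omega> (\<lambda>x. x \<bullet> v - c) (\<lambda>x. v)"
  unfolding weak_gradient_def loc_integrable_def
proof (intro conjI allI impI)
  fix K :: "(real^'n) set" and j assume K: "compact K \<and> K \<subseteq> \<Omega>"
  show "set_integrable lebesgue K (\<lambda>x. x \<bullet> v - c)" "set_integrable lebesgue K (\<lambda>x. v $ j)"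
    using K by (auto intro!: set_integrable_lebesgue_compact continuous_intros)
next
  fix \<phi> :: "real^'n \<Rightarrow> real" and d\<phi> j
  assume "test_fun \<Omega> \<phi> \<and> (\<forall>x. (\<phi> has_derivative (\<lambda>h. d\<phi> x \<bullet> h)) (at x))"
  then have sm: "Ck k \<phi>" and cp: "compact (closure {x. \<phi> x \<noteq> 0})" and sub: "closure {x. \<phi> x \<noteq> 0} \<subseteq> \<Omega>"
    and d: "(\<phi> has_derivative (\<lambda>h. d\<phi> x \<bullet> h)) (at x)" for k x
    by (auto simp: test_fun_def smooth_def)
  define S where "S = closure {x. \<phi> x \<noteq> 0}"
  let ?u = "\<lambda>x. x \<bullet> v - c"
  note cp = cp[folded S_def] and sub = sub[folded S_def]
  have closed_S: "closed S" by (simp add: S_def)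
  obtain R where R: "\<And>x. x \<in> S \<Longrightarrow> norm x \<le> R" using compact_imp_bounded[OF cp] unfolding bounded_iff S_def by blast
  have \<phi>0: "\<phi> x = 0" if "x \<notin> S" for x using that closure_subset[of "{x. \<phi> x \<noteq> 0}"] unfolding S_def by blast
  have \<phi>R: "\<phi> x = 0" if "norm x > R" for x using R[of x] \<phi>0[of x] that by force
  have d0: "d\<phi> x = 0" if "x \<notin> S" for x
  proof -
    have "(\<phi> has_derivative (\<lambda>h. 0)) (at x)"
      by (rule has_derivative_transform_within_open[of "\<lambda>_. 0" _ _ _ "- S"]) (use that \<phi>0 in \<open>auto simp: S_def[symmetric] open_closed closed_S\<close>)
    then have "(\<lambda>h. d\<phi> x \<bullet> h) = (\<lambda>h. 0)" using has_derivative_unique[OF d[of x]] by blast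
    then have "d\<phi> x \<bullet> d\<phi> x = 0" by metis
    then show ?thesis by simp
  qed
  have c\<phi>: "continuous_on UNIV \<phi>" using sm[of 0] by simp
  define \<psi> where "\<psi> x = ?u x * \<phi> x" for x
  have d\<psi>: "(\<psi> has_derivative (\<lambda>h. (?u x *\<^sub>R d\<phi> x + \<phi> x *\<^sub>R v) \<bullet> h)) (at x)" for x
    unfolding \<psi>_def
    by (rule has_derivative_eq_rhs[OF has_derivative_mult[OF affine_has_derivative d]])
       (auto simp: inner_add_left algebra_simps)
  have C1: "Ck 1 \<psi>" unfolding \<psi>_def by (intro Ck_mult Ck_affine sm)
  note I = integral_partial_derivative_eq_0[OF C1 _ d\<psi>, of R j]
  have i1: "integrable lborel (\<lambda>x. ?u x * d\<phi> x $ j + \<phi> x * v $ j)" 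
    and z: "(LINT x|lborel. ?u x * d\<phi> x $ j + \<phi> x * v $ j) = 0"
    using I \<phi>R by (auto simp: \<psi>_def)
  have i2: "integrable lborel (\<lambda>x. \<phi> x * v $ j)"
  proof -
    have "integrable lborel (\<lambda>x. indicator S x *\<^sub>R (\<phi> x * v $ j))"
      by (intro borel_integrable_compact cp continuous_intros continuous_on_subset[OF c\<phi>]) auto
    moreover have "(\<lambda>x. indicator S x *\<^sub>R (\<phi> x * v $ j)) = (\<lambda>x. \<phi> x * v $ j)"
      using \<phi>0 by (auto simp: fun_eq_iff indicator_def)
    ultimately show ?thesis by simp
  qed
  have i3: "integrable lborel (\<lambda>x. ?u x * d\<phi> x $ j)"
    using Bochner_Integration.integrable_diff[OF i1 i2] by simp
  have lift: "(LINT x:\<Omega>|lebesgue. f x) = (LINT x|lborel. f x)" 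
    if "integrable lborel f" "\<And>x. x \<notin> S \<Longrightarrow> f x = 0" for f :: "real^'n \<Rightarrow> real"
  proof -
    have "(LINT x:\<Omega>|lebesgue. f x) = (LINT x|lebesgue. f x)"
      unfolding set_lebesgue_integral_def using that(2) sub
      by (intro Bochner_Integration.integral_cong) (auto simp: indicator_def)
    also have "\<dots> = (LINT x|lborel. f x)"
      by (rule integral_completion) (use borel_measurable_integrable[OF that(1)] in simp)
    finally show ?thesis .
  qed
  have "(LINT x|lborel. ?u x * d\<phi> x $ j) = - (LINT x|lborel. \<phi> x * v $ j)"
    using z i2 i3 by simp
  moreover have "(LINT x:\<Omega>|lebesgue. ?u x * d\<phi> x $ j) = (LINT x|lborel. ?u x * d\<phi> x $ j)"
    by (rule lift[OF i3]) (simp add: d0)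
  moreover have "(LINT x:\<Omega>|lebesgue. \<phi> x * v $ j) = (LINT x|lborel. \<phi> x * v $ j)"
    by (rule lift[OF i2]) (simp add: \<phi>0)
  ultimately show "(LINT x:\<Omega>|lebesgue. ?u x * d\<phi> x $ j) = - (LINT x:\<Omega>|lebesgue. v $ j * \<phi> x)"
    unfolding mult.commute[of "v $ j"] by (simp only:)
qed

lemma set_integrable_gauss_quadratic:
  fixes f :: "real^'n \<Rightarrow> real"
  assumes "open \<Omega>" "continuous_on UNIV f" "\<And>x. \<bar>f x\<bar> \<le> C * (1 + (norm x)\<^sup>2)"
  shows "set_integrable lebesgue \<Omega> (\<lambda>x. gauss x * f x)"
  by (intro set_integrable_lebesgue_subset integrable_gauss_quadratic assms borel_measurable_continuous_onI) (use assms in auto)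

lemma set_integral_gauss_pos:
  fixes \<Omega> :: "(real^'n) set" and f :: "real^'n \<Rightarrow> real"
  assumes \<Omega>: "open \<Omega>" "\<Omega> \<noteq> {}" and i: "set_integrable lebesgue \<Omega> (\<lambda>x. gauss x * f x)"
    and f: "\<And>x. f x \<ge> 0" and neg: "negligible {x. f x = 0}"
  shows "(LINT x:\<Omega>|lebesgue. gauss x * f x) > 0"
proof (rule ccontr)
  assume "\<not> ?thesis"
  moreover have "(LINT x:\<Omega>|lebesgue. gauss x * f x) \<ge> 0" unfolding set_lebesgue_integral_def
    by (intro Bochner_Integration.integral_nonneg) (auto simp: less_imp_le[OF gauss_pos] f)
  ultimately have "(LINT x:\<Omega>|lebesgue. gauss x * f x) = 0" by simp
  then have "AE x in lebesgue. indicator \<Omega> x *\<^sub>R (gauss x * f x) = 0"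
    unfolding set_lebesgue_integral_def using i[unfolded set_integrable_def]
    by (subst (asm) integral_nonneg_eq_0_iff_AE) (auto simp: less_imp_le[OF gauss_pos] f)
  moreover have "AE x in lebesgue. x \<notin> {x. f x = 0}"
    by (rule AE_not_in) (use neg in \<open>simp add: negligible_iff_null_sets\<close>)
  ultimately have "AE x in lebesgue. x \<notin> \<Omega>"
    by eventually_elim (auto simp: indicator_def less_imp_neq[OF gauss_pos, symmetric])
  then have "\<Omega> \<in> null_sets lebesgue" using \<Omega>(1) by (subst AE_iff_null_sets) auto
  then have "negligible \<Omega>" by (simp add: negligible_iff_null_sets)
  then show False using open_not_negligible[OF \<Omega>] by simp
qed

section \<open>Rayleigh quotients and the lower bound\<close>

definition mu1_values :: "(real^'n) set \<Rightarrow> real set" where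
  "mu1_values \<Omega> = {R. \<exists>u g. H1_gauss \<Omega> u g \<and>
       (LINT x:\<Omega>|lebesgue. gauss x * u x) = 0 \<and>
       (LINT x:\<Omega>|lebesgue. gauss x * (u x)\<^sup>2) > 0 \<and>
       R = (LINT x:\<Omega>|lebesgue. gauss x * (norm (g x))\<^sup>2) / (LINT x:\<Omega>|lebesgue. gauss x * (u x)\<^sup>2)}"

lemma mu1_eq_Inf_values: "mu1 \<Omega> = Inf (mu1_values \<Omega>)"
  by (simp add: mu1_def mu1_values_def)

lemma abs_inner_diff_square_le: "(x \<bullet> v - c)\<^sup>2 \<le> (2 * (norm v)\<^sup>2 + 2 * c\<^sup>2) * (1 + (norm x)\<^sup>2)"
proof -
  have "(x \<bullet> v)\<^sup>2 \<le> (norm x)\<^sup>2 * (norm v)\<^sup>2"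
    using Cauchy_Schwarz_ineq[of x v] by (simp add: power2_norm_eq_inner)
  moreover have "(x \<bullet> v - c)\<^sup>2 \<le> 2 * (x \<bullet> v)\<^sup>2 + 2 * c\<^sup>2"
    using zero_le_power2[of "x \<bullet> v + c"] by (simp add: power2_eq_square algebra_simps)
  ultimately have "(x \<bullet> v - c)\<^sup>2 \<le> 2 * ((norm x)\<^sup>2 * (norm v)\<^sup>2) + 2 * c\<^sup>2" by linarith
  also have "\<dots> \<le> (2 * (norm v)\<^sup>2 + 2 * c\<^sup>2) * (1 + (norm x)\<^sup>2)" by (simp add: algebra_simps)
  finally show ?thesis .
qed

lemma abs_inner_le: "\<bar>x \<bullet> v\<bar> \<le> norm v * (1 + (norm x)\<^sup>2)"
proof -
  have "norm x \<le> 1 + (norm x)\<^sup>2"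
  proof -
    have "2 * norm x \<le> 1 + (norm x)\<^sup>2"
      using zero_le_power2[of "norm x - 1"] by (simp add: power2_eq_square algebra_simps)
    then show ?thesis using norm_ge_zero[of x] by linarith
  qed
  then have "norm x * norm v \<le> (1 + (norm x)\<^sup>2) * norm v" by (intro mult_right_mono) auto
  then show ?thesis using Cauchy_Schwarz_ineq2[of x v] by (simp add: mult.commute)
qed

text \<open>Subtracting the Gaussian mean \<open>c\<close> makes the affine function admissible, and
  its denominator is positive because its zero set is a hyperplane. The value shows that there are
  Rayleigh quotients at all, and for strips it is the optimal one.\<close>

lemma affine_mu1_value:
  fixes \<Omega> :: "(real^'n) set" and v :: "real^'n"
  assumes \<Omega>: "open \<Omega>" "\<Omega> \<noteq> {}" and v: "v \<noteq> 0"
  defines "G \<equiv> LINT x:\<Omega>|lebesgue. gauss x"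
  defines "c \<equiv> (LINT x:\<Omega>|lebesgue. gauss x * (x \<bullet> v)) / G"
  shows "(norm v)\<^sup>2 * G / (LINT x:\<Omega>|lebesgue. gauss x * (x \<bullet> v - c)\<^sup>2) \<in> mu1_values \<Omega>"
proof -
  have iG: "set_integrable lebesgue \<Omega> gauss"
    using set_integrable_gauss_quadratic[OF \<Omega>(1), of "\<lambda>_. 1" 1] by simp
  have iv: "set_integrable lebesgue \<Omega> (\<lambda>x. gauss x * (x \<bullet> v))"
    by (intro set_integrable_gauss_quadratic[OF \<Omega>(1) _ abs_inner_le] continuous_intros)
  have i2: "set_integrable lebesgue \<Omega> (\<lambda>x. gauss x * (x \<bullet> v - c)\<^sup>2)"
    by (intro set_integrable_gauss_quadratic[OF \<Omega>(1), where C = "2 * (norm v)\<^sup>2 + 2 * c\<^sup>2"] continuous_intros)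
       (use abs_inner_diff_square_le[of _ v c] in simp)
  have ig: "set_integrable lebesgue \<Omega> (\<lambda>x. gauss x * (norm v)\<^sup>2)"
    by (rule set_integrable_gauss_quadratic[OF \<Omega>(1), where C = "(norm v)\<^sup>2"]) (auto simp: algebra_simps)
  have G: "G > 0" unfolding G_def
    using set_integral_gauss_pos[OF \<Omega>, of "\<lambda>_. 1"] iG by simp
  have pos: "(LINT x:\<Omega>|lebesgue. gauss x * (x \<bullet> v - c)\<^sup>2) > 0"
  proof (rule set_integral_gauss_pos[OF \<Omega> i2])
    have "{x. (x \<bullet> v - c)\<^sup>2 = 0} = {x. v \<bullet> x = c}" by (auto simp: inner_commute)
    then show "negligible {x. (x \<bullet> v - c)\<^sup>2 = 0}" using negligible_hyperplane[of v c] v by simp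
  qed simp
  have "(LINT x:\<Omega>|lebesgue. gauss x * (x \<bullet> v - c)) = (LINT x:\<Omega>|lebesgue. gauss x * (x \<bullet> v) - gauss x * c)"
    by (simp add: right_diff_distrib)
  also have "\<dots> = (LINT x:\<Omega>|lebesgue. gauss x * (x \<bullet> v)) - (LINT x:\<Omega>|lebesgue. gauss x * c)"
    by (rule set_integral_diff) (use iv iG in auto)
  also have "\<dots> = 0" using G by (simp add: c_def G_def)
  finally have mean: "(LINT x:\<Omega>|lebesgue. gauss x * (x \<bullet> v - c)) = 0" .
  have "H1_gauss \<Omega> (\<lambda>x. x \<bullet> v - c) (\<lambda>x. v)"
    unfolding H1_gauss_def using weak_gradient_affine i2 ig by blast
  moreover have "(LINT x:\<Omega>|lebesgue. gauss x * (norm v)\<^sup>2) = (norm v)\<^sup>2 * G"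
    by (simp add: G_def mult.commute)
  ultimately show ?thesis unfolding mu1_values_def using mean pos 
    by (intro CollectI exI[of _ "\<lambda>x. x \<bullet> v - c"] exI[of _ "\<lambda>x. v"]) (simp add: G_def)
qed

lemma mu1_values_ge_1:
  assumes "open \<Omega>" "convex \<Omega>" "\<Omega> \<noteq> {}" "R \<in> mu1_values \<Omega>"
  shows "1 \<le> R"
proof -
  obtain u g where H: "H1_gauss \<Omega> u g" "(LINT x:\<Omega>|lebesgue. gauss x * u x) = 0"
     and pos: "(LINT x:\<Omega>|lebesgue. gauss x * (u x)\<^sup>2) > 0"
     and R: "R = (LINT x:\<Omega>|lebesgue. gauss x * (norm (g x))\<^sup>2) / (LINT x:\<Omega>|lebesgue. gauss x * (u x)\<^sup>2)"
    using assms(4) unfolding mu1_values_def by blast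
  show ?thesis using gaussian_poincare[OF assms(1-3) H] pos by (simp add: R)
qed

text \<open>An affine function shows that the set of Rayleigh quotients is nonempty; on the empty set \<open>Inf\<close> is unspecified.\<close>

theorem mu1_ge_1:
  fixes \<Omega> :: "(real^'n) set"
  assumes "open \<Omega>" "convex \<Omega>" "\<Omega> \<noteq> {}"
  shows "1 \<le> mu1 \<Omega>"
  unfolding mu1_eq_Inf_values
proof (rule cInf_greatest)
  have "(axis undefined 1 :: real^'n) \<noteq> 0" by (simp add: axis_eq_0_iff)
  from affine_mu1_value[OF assms(1,3) this] show "mu1_values \<Omega> \<noteq> {}" by blast
qed (use mu1_values_ge_1[OF assms] in blast)

section \<open>Sets invariant along a direction\<close>

lemma gauss_translate:
  assumes "norm v = 1"
  shows "gauss (x + t *\<^sub>R v) = gauss x * exp (- t * (x \<bullet> v)) * exp (- t\<^sup>2 / 2)"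
proof -
  have "- (norm (x + t *\<^sub>R v))\<^sup>2 / 2 = - (norm x)\<^sup>2 / 2 + - t * (x \<bullet> v) + - t\<^sup>2 / 2"
    using assms unfolding power2_norm_eq_inner norm_eq_1
    by (simp add: inner_add inner_commute power2_eq_square field_simps)
  then show ?thesis unfolding gauss_def by (simp only: exp_add mult.assoc)
qed

context
  fixes S :: "(real^'n) set" and v :: "real^'n"
  assumes S: "S \<in> sets borel" and v: "norm v = 1"
    and inv: "\<And>x t. x \<in> S \<Longrightarrow> x + t *\<^sub>R v \<in> S"
begin

lemma indicator_translate: "indicator S (x + t *\<^sub>R v) = (indicator S x :: real)"
  using inv[of x t] inv[of "x + t *\<^sub>R v" "- t"] by (auto simp: indicator_def)

text \<open>By \<open>gauss_translate\<close>, exp (- t * (x \<bullet> v)) * gauss x is exp (t^2 /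
  2) times the Gaussian at x + t v. The indicator of \<open>S\<close> is invariant under this shift,
  and so is Lebesgue measure.\<close>

lemma gaussian_exponential_moment:
  shows "integrable lborel (\<lambda>x. indicator S x * gauss x * exp (- t * (x \<bullet> v)))" (is ?I)
    and "(LINT x|lborel. indicator S x * gauss x * exp (- t * (x \<bullet> v))) 
      = exp (t\<^sup>2 / 2) * (LINT x|lborel. indicator S x * gauss x)" (is ?E)
proof -
  note [measurable] = S
  define f where "f x = indicator S x * gauss x" for x :: "real^'n"
  have [measurable]: "f \<in> borel_measurable borel" unfolding f_def by measurable
  have eq: "indicator S x * gauss x * exp (- t * (x \<bullet> v)) = exp (t\<^sup>2 / 2) * f (x - (- t *\<^sub>R v))" for x
  proof -
    have "exp (t\<^sup>2 / 2) * exp (- t\<^sup>2 / 2) = 1" by (simp add: exp_add[symmetric])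
    then show ?thesis using indicator_translate[of x t] gauss_translate[OF v, of x t]
      by (simp add: f_def mult_ac)
  qed
  have f: "integrable lborel f"
    unfolding f_def by (rule Bochner_Integration.integrable_bound[OF integrable_gauss]) (auto simp: indicator_def)
  show ?I unfolding eq using integrable_lborel_translate_diff[OF f, of "- t *\<^sub>R v"] by simp
  show ?E unfolding eq using integral_lborel_translate_diff[of f "- t *\<^sub>R v"] by (simp add: f_def)
qed

text \<open>All moments are read off the Laplace transform \<open>t \<mapsto> exp (t\<^sup>2 / 2) G\<close> of \<open>x \<bullet> v\<close>, which only uses translation
invariance of Lebesgue measure: the first from \<open>exp y \<ge> 1 + y\<close>, the second from \<open>exp y + exp (- y) - 2 \<le> y\<^sup>2 exp |y|\<close>.\<close>

lemma gaussian_moments: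
  defines "G \<equiv> LINT x|lborel. indicator S x * gauss x"
  shows "(LINT x|lborel. indicator S x * gauss x * (x \<bullet> v)) = 0"
    and "G \<le> (LINT x|lborel. indicator S x * gauss x * (x \<bullet> v)\<^sup>2)"
proof -
  note [measurable] = S
  define f where "f x = indicator S x * gauss x" for x :: "real^'n"
  have [measurable]: "f \<in> borel_measurable borel" unfolding f_def by measurable
  have fnn: "f x \<ge> 0" for x by (simp add: f_def less_imp_le[OF gauss_pos])
  have fle: "f x \<le> gauss x" for x by (simp add: f_def indicator_def less_imp_le[OF gauss_pos])
  have iE: "integrable lborel (\<lambda>x. f x * exp (- t * (x \<bullet> v)))" 
    and E: "(LINT x|lborel. f x * exp (- t * (x \<bullet> v))) = exp (t\<^sup>2 / 2) * G" for t
    using gaussian_exponential_moment[of t] by (simp_all add: f_def G_def)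
  have iq: "integrable lborel (\<lambda>x. f x * h x)" if "continuous_on UNIV h" "\<And>x. \<bar>h x\<bar> \<le> C * (1 + (norm x)\<^sup>2)" for h C
  proof (rule Bochner_Integration.integrable_bound)
    have [measurable]: "h \<in> borel_measurable borel" using that(1) by (rule borel_measurable_continuous_onI)
    show "integrable lborel (\<lambda>x. gauss x * h x)" by (rule integrable_gauss_quadratic) (use that in auto)
    show "AE x in lborel. norm (f x * h x) \<le> norm (gauss x * h x)"
      using fle fnn by (auto simp: abs_mult abs_of_nonneg less_imp_le[OF gauss_pos] intro!: mult_right_mono)
    show "(\<lambda>x. f x * h x) \<in> borel_measurable lborel" by measurable
  qed
  have if1: "integrable lborel f" using iE[of 0] by simp
  have iX: "integrable lborel (\<lambda>x. f x * (x \<bullet> v))" by (intro iq[OF _ abs_inner_le] continuous_intros)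
  have iX2: "integrable lborel (\<lambda>x. f x * (x \<bullet> v)\<^sup>2)"
    by (intro iq[where C = "2 * (norm v)\<^sup>2 + 2 * 0\<^sup>2"] continuous_intros) (use abs_inner_diff_square_le[of _ v 0] in simp)
  have G0: "G \<ge> 0" unfolding G_def using fnn unfolding f_def by simp
  have G: "G = (LINT x|lborel. f x)" by (simp add: G_def f_def)
  define m where "m = (LINT x|lborel. f x * (x \<bullet> v))"
  have mt: "- t * m \<le> (exp (t\<^sup>2 / 2) - 1) * G" for t
  proof -
    have "(LINT x|lborel. f x + (- t) * (f x * (x \<bullet> v))) \<le> (LINT x|lborel. f x * exp (- t * (x \<bullet> v)))"
    proof (rule integral_mono)
      show "f x + (- t) * (f x * (x \<bullet> v)) \<le> f x * exp (- t * (x \<bullet> v))" for x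
        using mult_left_mono[OF exp_ge_add_one_self[of "- t * (x \<bullet> v)"] fnn[of x]] by (simp add: algebra_simps)
    qed (use if1 iX iE in auto)
    then have "G + (- t) * m \<le> exp (t\<^sup>2 / 2) * G"
      unfolding E using if1 iX by (simp add: G m_def)
    then show ?thesis by (simp add: algebra_simps)
  qed
  \<comment> \<open>In \<open>mt\<close> the left side is linear in t and the right side is
    quadratic near 0; using both signs of t gives the bound for |m|.\<close>
  have m_le: "\<bar>m\<bar> \<le> G * t" if t: "0 < t" "t \<le> 1" for t
  proof -
    have "t\<^sup>2 / 2 \<le> 1" using t power_le_one[of t 2] by simp
    then have "exp (t\<^sup>2 / 2) - 1 \<le> t\<^sup>2" using exp_bound_half[of "t\<^sup>2 / 2"] exp_bound_lemma[of "t\<^sup>2 / 2"] t power_le_one[of t 2] by simp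
    then have "(exp (t\<^sup>2 / 2) - 1) * G \<le> t\<^sup>2 * G" using G0 by (intro mult_right_mono)
    then have "t * \<bar>m\<bar> \<le> t * (G * t)" using mt[of t] mt[of "- t"] by (auto simp: abs_if power2_eq_square mult_ac)
    then show ?thesis using t by simp
  qed
  have "m = 0"
  proof (rule ccontr)
    assume "m \<noteq> 0"
    \<comment> \<open>With this t the bound reads |m| <= |m| / 2. The denominator uses G + 1 because
      \<open>G\<close> is only known to be nonnegative.\<close>
    define t where "t = min 1 (\<bar>m\<bar> / (2 * (G + 1)))"
    have t: "0 < t" "t \<le> 1" using \<open>m \<noteq> 0\<close> G0 by (auto simp: t_def)
    have "\<bar>m\<bar> \<le> G * t" by (rule m_le[OF t])
    also have "\<dots> \<le> (G + 1) * (\<bar>m\<bar> / (2 * (G + 1)))" using G0 t by (intro mult_mono) (auto simp: t_def)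
    also have "\<dots> = \<bar>m\<bar> / 2"
    proof -
      have "2 * G + 2 \<noteq> 0" using G0 by linarith
      then show ?thesis by (simp add: field_simps)
    qed
    finally show False using \<open>m \<noteq> 0\<close> by simp
  qed
  then show "(LINT x|lborel. indicator S x * gauss x * (x \<bullet> v)) = 0" by (simp add: m_def f_def)
  have exp2: "exp y + exp (- y) - 2 \<le> y\<^sup>2 * exp \<bar>y\<bar>" for y :: real
  proof -
    have "exp z \<le> 1 + z + exp \<bar>z\<bar> / 2 * z\<^sup>2" for z :: real
    proof -
      obtain s where s: "\<bar>s\<bar> \<le> \<bar>z\<bar>" "exp z = (\<Sum>m<2. z ^ m / fact m) + exp s / fact 2 * z\<^sup>2"
        using Maclaurin_exp_le[of z 2] by blast
      have "exp s / 2 * z\<^sup>2 \<le> exp \<bar>z\<bar> / 2 * z\<^sup>2" using s(1) by (intro mult_right_mono divide_right_mono) auto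
      then show ?thesis using s(2) by (simp add: eval_nat_numeral)
    qed
    from this[of y] this[of "- y"] show ?thesis by (simp add: algebra_simps)
  qed
  \<comment> \<open>With t = 1 / (n + 1), t^2 * h n dominates the symmetric second difference of the
    exponential, whose integral is at least t^2 * G; as n grows, \<open>h n\<close> tends to the
    second-moment integrand.\<close>
  define h where "h n x = f x * ((x \<bullet> v)\<^sup>2 * exp (\<bar>x \<bullet> v\<bar> / real (Suc n)))" for n x
  \<comment> \<open>For y = |x \<bullet> v|, y^2 <= 2 * exp y and exp (y / (n + 1)) <= exp y, so y^2
    * exp (y / (n + 1)) is at most 2 * exp (2 * y). Exponentials of both signs dominate this without
    an absolute value, and their integrability is already known.\<close>
  define w where "w x = 2 * (f x * exp (- 2 * (x \<bullet> v)) + f x * exp (- (- 2) * (x \<bullet> v)))" for x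
  have iw: "integrable lborel w" unfolding w_def using iE[of 2] iE[of "-2"] by simp
  have [measurable]: "h n \<in> borel_measurable borel" for n unfolding h_def by measurable
  have hw: "norm (h n x) \<le> w x" for n x
  proof -
    define y where "y = \<bar>x \<bullet> v\<bar>"
    have y: "y \<ge> 0" by (simp add: y_def)
    have "y\<^sup>2 \<le> 2 * exp y" using exp_lower_Taylor_quadratic[OF y] y by simp
    moreover have "exp (y / real (Suc n)) \<le> exp y" using y by (simp add: field_simps)
    ultimately have "y\<^sup>2 * exp (y / real (Suc n)) \<le> (2 * exp y) * exp y" by (intro mult_mono) auto
    also have "\<dots> = 2 * exp (2 * y)" by (simp add: exp_add[symmetric])
    also have "\<dots> \<le> 2 * (exp (- 2 * (x \<bullet> v)) + exp (- (- 2) * (x \<bullet> v)))" by (auto simp: y_def abs_if)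
    finally have "f x * (y\<^sup>2 * exp (y / real (Suc n))) \<le> f x * (2 * (exp (- 2 * (x \<bullet> v)) + exp (- (- 2) * (x \<bullet> v))))"
      using fnn by (intro mult_left_mono)
    then show ?thesis using fnn[of x] by (simp add: h_def w_def y_def algebra_simps)
  qed
  have hlim: "(\<lambda>n. h n x) \<longlonglongrightarrow> f x * (x \<bullet> v)\<^sup>2" for x
  proof -
    have "(\<lambda>n. \<bar>x \<bullet> v\<bar> / real (Suc n)) \<longlonglongrightarrow> 0" 
      using LIMSEQ_Suc[OF lim_const_over_n[of "\<bar>x \<bullet> v\<bar>"]] by simp
    then have "(\<lambda>n. f x * ((x \<bullet> v)\<^sup>2 * exp (\<bar>x \<bullet> v\<bar> / real (Suc n)))) \<longlonglongrightarrow> f x * ((x \<bullet> v)\<^sup>2 * exp 0)"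
      by (intro tendsto_intros)
    then show ?thesis by (simp add: h_def)
  qed
  have "(\<lambda>n. LINT x|lborel. h n x) \<longlonglongrightarrow> (LINT x|lborel. f x * (x \<bullet> v)\<^sup>2)"
    by (rule integral_dominated_convergence[OF _ _ iw]) (use hlim hw in auto)
  moreover have "G \<le> (LINT x|lborel. h n x)" for n
  proof -
    define t where "t = 1 / real (Suc n)"
    have t: "t > 0" by (simp add: t_def)
    have ih: "integrable lborel (h n)"
    proof (rule Bochner_Integration.integrable_bound[OF iw])
      show "AE x in lborel. norm (h n x) \<le> norm (w x)"
        using order_trans[OF hw abs_ge_self] by (intro AE_I2) simp
    qed measurable
    have "1 + t\<^sup>2 / 2 \<le> exp (t\<^sup>2 / 2)" by (rule exp_ge_add_one_self)
    then have "(1 + t\<^sup>2 / 2) * G \<le> exp (t\<^sup>2 / 2) * G" using G0 by (intro mult_right_mono)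
    then have "t\<^sup>2 * G \<le> exp (t\<^sup>2 / 2) * G + exp ((- t)\<^sup>2 / 2) * G - 2 * G" by (simp add: algebra_simps)
    also have "\<dots> = (LINT x|lborel. f x * exp (- t * (x \<bullet> v)) + f x * exp (- (- t) * (x \<bullet> v)) - 2 * f x)"
      unfolding E[of t, symmetric] E[of "- t", symmetric] using iE[of t] iE[of "- t"] if1 by (simp add: G)
    also have "\<dots> \<le> (LINT x|lborel. t\<^sup>2 * h n x)"
    proof (rule integral_mono)
      show "f x * exp (- t * (x \<bullet> v)) + f x * exp (- (- t) * (x \<bullet> v)) - 2 * f x \<le> t\<^sup>2 * h n x" for x
      proof -
        have "exp (t * (x \<bullet> v)) + exp (- (t * (x \<bullet> v))) - 2 \<le> (t * (x \<bullet> v))\<^sup>2 * exp \<bar>t * (x \<bullet> v)\<bar>" by (rule exp2)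
        also have "\<bar>t * (x \<bullet> v)\<bar> = \<bar>x \<bullet> v\<bar> / real (Suc n)" using t by (simp add: abs_mult t_def)
        finally have "f x * (exp (t * (x \<bullet> v)) + exp (- (t * (x \<bullet> v))) - 2) \<le> f x * ((t * (x \<bullet> v))\<^sup>2 * exp (\<bar>x \<bullet> v\<bar> / real (Suc n)))"
          using fnn by (intro mult_left_mono)
        then show ?thesis by (simp add: h_def power_mult_distrib algebra_simps)
      qed
    qed (use iE[of t] iE[of "- t"] if1 ih in auto)
    finally show ?thesis using t by simp
  qed
  ultimately have "G \<le> (LINT x|lborel. f x * (x \<bullet> v)\<^sup>2)"
    by (intro LIMSEQ_le_const) auto
  then show "G \<le> (LINT x|lborel. indicator S x * gauss x * (x \<bullet> v)\<^sup>2)" by (simp add: f_def)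
qed

end

text \<open>The mean of x \<bullet> v vanishes, so the centring constant of
  \<open>affine_mu1_value\<close> is 0 and the quotient is G / A. The moment bound G <= A makes it
  at most 1; the opposite inequality is the Poincare bound itself.\<close>

theorem mu1_eq_1_of_translation_invariant:
  fixes S :: "(real^'n) set"
  assumes S: "open S" "convex S" "S \<noteq> {}" and v: "norm v = 1"
    and inv: "\<And>x t. x \<in> S \<Longrightarrow> x + t *\<^sub>R v \<in> S"
  shows "mu1 S = 1"
proof (rule antisym)
  have Sb[measurable]: "S \<in> sets borel" using S(1) by simp
  have lift: "(LINT x:S|lebesgue. gauss x * f x) = (LINT x|lborel. indicator S x * gauss x * f x)"
    if [measurable]: "f \<in> borel_measurable borel" for f
    unfolding set_lebesgue_integral_def by (subst integral_completion[symmetric]) (auto simp: mult.assoc)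
  note mom = gaussian_moments[OF Sb v inv]
  have mean: "(LINT x:S|lebesgue. gauss x * (x \<bullet> v)) = 0" using mom(1) by (simp add: lift)
  have v0: "v \<noteq> 0" using v by auto
  define A where "A = (LINT x:S|lebesgue. gauss x * (x \<bullet> v)\<^sup>2)"
  define G where "G = (LINT x:S|lebesgue. gauss x)"
  have mem: "G / A \<in> mu1_values S"
    using affine_mu1_value[OF S(1,3) v0] v by (simp add: mean A_def G_def)
  have GA: "G \<le> A" using mom(2) lift[of "\<lambda>_. 1"] by (simp add: A_def G_def lift)
  have "mu1 S \<le> G / A" unfolding mu1_eq_Inf_values
    by (rule cInf_lower[OF mem]) (use mu1_values_ge_1[OF S] in \<open>auto simp: bdd_below_def\<close>)
  also have "G / A \<le> 1"
  proof -
    have "A \<ge> 0" unfolding A_def set_lebesgue_integral_def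
      by (intro Bochner_Integration.integral_nonneg) (auto simp: less_imp_le[OF gauss_pos])
    \<comment> \<open>For A = 0 the quotient is 0 by the convention for division.\<close>
    then show ?thesis using GA by (cases "A = 0") (auto simp: divide_le_eq_1)
  qed
  finally show "mu1 S \<le> 1" .
  show "1 \<le> mu1 S" by (rule mu1_ge_1[OF S])
qed

theorem theorem1p1:
  fixes \<Omega> :: "(real^'n) set"
  assumes "CARD('n) \<ge> 2"
    and "open \<Omega>" and "connected \<Omega>" and "\<Omega> \<noteq> {}" and "convex \<Omega>"
    and "C2_boundary \<Omega>"
    and "uniform_interior_sphere \<Omega>"
  shows "mu1 \<Omega> \<ge> 1 \<and>
    (\<forall>a::real. \<forall>i::'n. \<forall>(f::real^'n \<Rightarrow> real^'n) b. a > 0 \<and> orthogonal_transformation f \<longrightarrow>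
       mu1 ((\<lambda>x. f x + b) ` {x::real^'n. - a < x $ i \<and> x $ i < a}) = 1)"
proof (intro conjI allI impI)
  show "mu1 \<Omega> \<ge> 1" by (rule mu1_ge_1) fact+
next
  fix a :: real and i :: 'n and f :: "real^'n \<Rightarrow> real^'n" and b
  assume "a > 0 \<and> orthogonal_transformation f"
  then have a: "a > 0" and f: "orthogonal_transformation f" by auto
  \<comment> \<open>Dimension at least 2 supplies a coordinate j other than i. The strip restricts
    coordinate i only, so its image under the rigid motion is invariant along the unit vector f
    (axis j 1).\<close>
  have "(UNIV :: 'n set) \<noteq> {i}"
  proof
    assume "(UNIV :: 'n set) = {i}"
    then have "CARD('n) = card {i}" by simp
    then show False using assms(1) by simp
  qed
  then obtain j where j: "j \<noteq> i" by blast
  let ?w = "f (axis i 1)"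
  let ?S = "(\<lambda>x. f x + b) ` {x::real^'n. - a < x $ i \<and> x $ i < a}"
  have lin: "linear f" and inner: "f x \<bullet> f y = x \<bullet> y" for x y
    using f by (auto simp: orthogonal_transformation_def)
  \<comment> \<open>Written as an intersection of two open half-spaces normal to the image of axis
    i, the moved strip is visibly open and convex.\<close>
  have S_eq: "?S = {x. (x - b) \<bullet> ?w < a} \<inter> {x. - a < (x - b) \<bullet> ?w}"
  proof (intro set_eqI iffI)
    fix x assume "x \<in> {x. (x - b) \<bullet> ?w < a} \<inter> {x. - a < (x - b) \<bullet> ?w}"
    moreover obtain y where y: "x - b = f y" using orthogonal_transformation_surj[OF f] by (metis surjD)
    ultimately have "- a < y $ i \<and> y $ i < a" using inner by (simp add: inner_axis)
    moreover have "x = f y + b" using y by (simp add: algebra_simps)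
    ultimately show "x \<in> ?S" by blast
  qed (use inner in \<open>auto simp: inner_axis\<close>)
  show "mu1 ?S = 1"
  proof (rule mu1_eq_1_of_translation_invariant)
    show "open ?S" unfolding S_eq by (intro open_Int open_Collect_less continuous_intros)
    have "?S = {x. ?w \<bullet> x < a + b \<bullet> ?w} \<inter> {x. ?w \<bullet> x > b \<bullet> ?w - a}"
      unfolding S_eq by (auto simp: inner_diff_left inner_commute)
    then show "convex ?S" by (simp only: convex_Int convex_halfspace_lt convex_halfspace_gt)
    show "?S \<noteq> {}" using a by (auto intro: exI[of _ 0])
    show "norm (f (axis j 1)) = 1" using orthogonal_transformation_norm[OF f] by (simp add: norm_axis_1)
    fix x t assume "x \<in> ?S"
    then obtain y where y: "x = f y + b" "- a < y $ i" "y $ i < a" by auto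
    have "x + t *\<^sub>R f (axis j 1) = f (y + t *\<^sub>R axis j 1) + b"
      using lin by (simp add: y(1) linear_add linear_scale)
    moreover have "(y + t *\<^sub>R axis j 1) $ i = y $ i" using j by (simp add: axis_def)
    ultimately show "x + t *\<^sub>R f (axis j 1) \<in> ?S" using y by (metis (mono_tags, lifting) imageI mem_Collect_eq)
  qed
qed

end
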